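(* Let $(M,J,[\nabla])$ be a c-projective manifold of real dimension $2n\ge4$ and $\tilde\eta(t)=\tilde\eta-t\eta$ a metrisability pencil with $\eta$ nondegenerate, so that $\eta$ corresponds to a compatible (pseudo-)Kähler metric $g$. Then the functions $I_t,L_t:TM\to\mathbb R$ (for all $t\in\mathbb R$) mutually commute under the Poisson bracket on $TM$ induced by $g$.
   Context: $(M,J)$ is a complex manifold; $[\nabla]$ is a class of torsion-free connections with $\nabla J=0$, two being equivalent iff $\hat\nabla_XY=\nabla_XY+\frac12(\Upsilon(X)Y+\Upsilon(Y)X-\Upsilon(JX)JY-\Upsilon(JY)JX)$ for a real $1$-form $\Upsilon$. Unbarred/barred indices refer to $T^{1,0}M$/$T^{0,1}M$. $\mathcal E_{\mathbb R}(1,1)$ is the oriented $(n+1)$st root of $\Lambda^{2n}TM$, $\mathcal E(k,k)=\mathcal E_{\mathbb R}(1,1)^k\otimes\mathbb C$, $B(k,k)=B\otimes\mathcal E(k,k)$. The metrisability equation for a real section $\eta^{\bar bc}$ of $T^{0,1}M\otimes T^{1,0}M(-1,-1)$ is $\nabla_a\eta^{\bar bc}+\delta_a{}^cX^{\bar b}=0$, $\nabla_{\bar a}\eta^{\bar bc}+\delta_{\bar a}{}^{\bar b}X^c=0$ for some $X^c$ with conjugate $X^{\bar c}$. A metrisability pencil is a family $\tilde\eta(t)=\tilde\eta-t\eta$, $t\in\mathbb R$, where $\eta,\tilde\eta$ are linearly independent real solutions. With $\varepsilon_{ab\cdots c}$ the tautological section of $\Lambda^{n,0}(n+1,0)$,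 $\det\eta=\frac1{n!}\bar\varepsilon_{\bar a\bar c\cdots\bar e}\varepsilon_{bd\cdots f}\eta^{\bar ab}\cdots\eta^{\bar ef}\in\Gamma(\mathcal E_{\mathbb R}(1,1))$; when $\eta$ is nondegenerate, the compatible metric $g$ has inverse $g^{\bar ab}=(\det\eta)\eta^{\bar ab}$ (its Levi-Civita connection lies in $[\nabla]$), and $\tau_g=\det\eta$. Write $\tilde\eta^{\bar ac}=\eta^{\bar ab}A_b{}^c$, $A(t)=A-t\,\mathrm{Id}$ as endomorphism of $T^{1,0}M$, $\Omega^{\alpha\beta}=J_\gamma{}^\beta g^{\alpha\gamma}$, and $$\widetilde K^\beta(t)=\Omega^{\alpha\beta}\nabla_\alpha\det A(t),\qquad\widetilde H_{b\bar a}(t)=\tfrac1{(n-1)!}\bar\varepsilon_{\bar a\bar c\cdots\bar e}\varepsilon_{bd\cdots f}\tilde\eta^{\bar cd}(t)\cdots\tilde\eta^{\bar ef}(t),$$ the latter viewed as a weighted $J$-invariant symmetric tensor $\widetilde H_{\alpha\beta}(t)$. The functions are $$L_t(X)=g(\widetilde K(t),X),\qquad I_t(X)=\tau_g^{-2}\widetilde H(t)(X,X),\qquad X\in TM.$$ The Poisson bracket on $TM$ induced by $g$ is the canonical one of $T^*M$ transported by the isomorphism $TM\cong T^*M$ given by $g$. *)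

theory Defs
  imports "HOL-Analysis.Analysis"
begin

section \<open>Smooth maps between open subsets of Euclidean spaces\<close>

fun Ck_on :: "nat \<Rightarrow> 'a::euclidean_space set \<Rightarrow> ('a \<Rightarrow> 'b::real_normed_vector) \<Rightarrow> bool" where
  "Ck_on 0 S f \<longleftrightarrow> continuous_on S f"
| "Ck_on (Suc k) S f \<longleftrightarrow>
     f differentiable_on S \<and> (\<forall>v. Ck_on k S (\<lambda>x. frechet_derivative f (at x) v))"

definition smooth_on :: "'a::euclidean_space set \<Rightarrow> ('a \<Rightarrow> 'b::real_normed_vector) \<Rightarrow> bool" where
  "smooth_on S f \<longleftrightarrow> (\<forall>k. Ck_on k S f)"


section \<open>Complex manifolds\<close>

text \<open>
  The manifold is a Hausdorff second countable type \<open>'m\<close>; its complex dimension is \<open>CARD('n)\<close>.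
  A chart is a pair of a domain and a coordinate map \<open>z\<close> into \<open>complex^'n\<close>. A real tangent vector
  \<open>X\<close> has, in a chart, the coordinates \<open>v = dz(X)\<close> in \<open>complex^'n\<close>, which are at the same time
  the components \<open>X\<^sup>a\<close> of its \<open>(1,0)\<close>-part: \<open>X = X\<^sup>a \<partial>\<^sub>a + cnj (X\<^sup>a) \<partial>\<^bsub>a-bar\<^esub>\<close>. In these coordinates
  \<open>J\<close> is multiplication by \<open>\<i>\<close>.

  Sections of bundles over the manifold are given by their components: \<open>\<sigma> c p\<close> is the tuple of
  components at the point \<open>p\<close> in the chart \<open>c\<close>, and is only meaningful if \<open>c\<close> belongs to the atlas
  and \<open>p\<close> to the domain of \<open>c\<close>.
\<close>

type_synonym ('m, 'n) chart = "'m set \<times> ('m \<Rightarrow> complex^'n)"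

definition is_chart :: "('m::topological_space, 'n::finite) chart \<Rightarrow> bool" where
  "is_chart c \<longleftrightarrow> open (fst c) \<and> open (snd c ` fst c) \<and>
     homeomorphism (fst c) (snd c ` fst c) (snd c) (inv_into (fst c) (snd c))"

definition in_chart :: "('m, 'n::finite) chart \<Rightarrow> ('m \<Rightarrow> 'b) \<Rightarrow> complex^'n \<Rightarrow> 'b" where
  "in_chart c f = (\<lambda>x. f (inv_into (fst c) (snd c) x))"

definition dird :: "('m, 'n::finite) chart \<Rightarrow> ('m \<Rightarrow> 'b::real_normed_vector) \<Rightarrow> 'm \<Rightarrow> complex^'n \<Rightarrow> 'b"
  where "dird c f p v = frechet_derivative (in_chart c f) (at (snd c p)) v"

definition trans_map :: "('m, 'n::finite) chart \<Rightarrow> ('m, 'n) chart \<Rightarrow> complex^'n \<Rightarrow> complex^'n" where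
  "trans_map c c' = in_chart c (snd c')"

definition jac :: "('m, 'n::finite) chart \<Rightarrow> ('m, 'n) chart \<Rightarrow> 'm \<Rightarrow> complex^'n \<Rightarrow> complex^'n" where
  "jac c c' p = frechet_derivative (trans_map c c') (at (snd c p))"

definition jac2 ::
    "('m, 'n::finite) chart \<Rightarrow> ('m, 'n) chart \<Rightarrow> 'm \<Rightarrow> complex^'n \<Rightarrow> complex^'n \<Rightarrow> complex^'n" where
  "jac2 c c' p v w =
     frechet_derivative (\<lambda>x. frechet_derivative (trans_map c c') (at x) w) (at (snd c p)) v"

definition Jstr :: "complex^'n::finite \<Rightarrow> complex^'n" where
  "Jstr v = \<i> *s v"

definition complex_atlas :: "('m::topological_space, 'n::finite) chart set \<Rightarrow> bool" where
  "complex_atlas \<A> \<longleftrightarrow>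
     (\<forall>c\<in>\<A>. is_chart c) \<and> (\<Union>c\<in>\<A>. fst c) = UNIV \<and>
     (\<forall>c\<in>\<A>. \<forall>c'\<in>\<A>. smooth_on (snd c ` (fst c \<inter> fst c')) (trans_map c c') \<and>
        (\<forall>p \<in> fst c \<inter> fst c'. \<forall>v. jac c c' p (Jstr v) = Jstr (jac c c' p v)))"

definition charts_at :: "('m, 'n::finite) chart set \<Rightarrow> 'm \<Rightarrow> ('m, 'n) chart set" where
  "charts_at \<A> p = {c \<in> \<A>. p \<in> fst c}"

definition chart_at :: "('m, 'n::finite) chart set \<Rightarrow> 'm \<Rightarrow> ('m, 'n) chart" where
  "chart_at \<A> p = (SOME c. c \<in> charts_at \<A> p)"

definition smooth_section ::
    "('m, 'n::finite) chart set \<Rightarrow> (('m, 'n) chart \<Rightarrow> 'm \<Rightarrow> 'b::real_normed_vector) \<Rightarrow> bool" where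
  "smooth_section \<A> \<sigma> \<longleftrightarrow> (\<forall>c\<in>\<A>. smooth_on (snd c ` fst c) (in_chart c (\<sigma> c)))"

text \<open>
  The complex Jacobian \<open>\<partial>z'\<^sup>a/\<partial>z\<^sup>b\<close>, and the transition function of the bundle \<open>\<E>\<^sub>\<real>(1,1)\<close>, the oriented
  \<open>(n+1)\<close>st root of \<open>\<Lambda>\<^sup>2\<^sup>n TM\<close>: the latter has the real Jacobian determinant as transition function,
  which is the squared modulus of the complex one.
\<close>

definition cjac :: "('m, 'n::finite) chart \<Rightarrow> ('m, 'n) chart \<Rightarrow> 'm \<Rightarrow> complex^'n^'n" where
  "cjac c c' p = matrix (jac c c' p)"

definition weight_trans :: "('m, 'n::finite) chart \<Rightarrow> ('m, 'n) chart \<Rightarrow> 'm \<Rightarrow> real" where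
  "weight_trans c c' p = ((cmod (det (cjac c c' p)))\<^sup>2) powr (1 / (real CARD('n) + 1))"


section \<open>C-projective structures\<close>

text \<open>
  A connection on \<open>TM\<close> is given by its Christoffel symbols: in the chart \<open>c\<close>,
  \<open>\<nabla>\<^sub>X Y = D\<^sub>X Y + \<Gamma> c p X Y\<close>.
\<close>

type_synonym ('m, 'n) connection =
  "('m, 'n) chart \<Rightarrow> 'm \<Rightarrow> complex^'n \<Rightarrow> complex^'n \<Rightarrow> complex^'n"

definition affine_connection ::
    "('m::topological_space, 'n::finite) chart set \<Rightarrow> ('m, 'n) connection \<Rightarrow> bool" where
  "affine_connection \<A> \<Gamma> \<longleftrightarrow>
     (\<forall>c\<in>\<A>. \<forall>p\<in>fst c. bilinear (\<Gamma> c p)) \<and>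
     (\<forall>v w. smooth_section \<A> (\<lambda>c p. \<Gamma> c p v w)) \<and>
     (\<forall>c\<in>\<A>. \<forall>c'\<in>\<A>. \<forall>p \<in> fst c \<inter> fst c'. \<forall>v w.
        jac c c' p (\<Gamma> c p v w) = jac2 c c' p v w + \<Gamma> c' p (jac c c' p v) (jac c c' p w))"

definition torsion_free :: "('m, 'n::finite) chart set \<Rightarrow> ('m, 'n) connection \<Rightarrow> bool" where
  "torsion_free \<A> \<Gamma> \<longleftrightarrow> (\<forall>c\<in>\<A>. \<forall>p\<in>fst c. \<forall>v w. \<Gamma> c p v w = \<Gamma> c p w v)"

definition preserves_J :: "('m, 'n::finite) chart set \<Rightarrow> ('m, 'n) connection \<Rightarrow> bool" where
  "preserves_J \<A> \<Gamma> \<longleftrightarrow>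
     (\<forall>c\<in>\<A>. \<forall>p\<in>fst c. \<forall>v w. \<Gamma> c p v (Jstr w) = Jstr (\<Gamma> c p v w))"

definition complex_connection ::
    "('m::topological_space, 'n::finite) chart set \<Rightarrow> ('m, 'n) connection \<Rightarrow> bool" where
  "complex_connection \<A> \<Gamma> \<longleftrightarrow> affine_connection \<A> \<Gamma> \<and> torsion_free \<A> \<Gamma> \<and> preserves_J \<A> \<Gamma>"

definition real_one_form ::
    "('m, 'n::finite) chart set \<Rightarrow> (('m, 'n) chart \<Rightarrow> 'm \<Rightarrow> complex^'n \<Rightarrow> real) \<Rightarrow> bool" where
  "real_one_form \<A> \<Upsilon> \<longleftrightarrow>
     (\<forall>c\<in>\<A>. \<forall>p\<in>fst c. linear (\<Upsilon> c p)) \<and>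
     (\<forall>v. smooth_section \<A> (\<lambda>c p. \<Upsilon> c p v)) \<and>
     (\<forall>c\<in>\<A>. \<forall>c'\<in>\<A>. \<forall>p \<in> fst c \<inter> fst c'. \<forall>v. \<Upsilon> c p v = \<Upsilon> c' p (jac c c' p v))"

definition cproj_equiv ::
    "('m, 'n::finite) chart set \<Rightarrow> ('m, 'n) connection \<Rightarrow> ('m, 'n) connection \<Rightarrow> bool" where
  "cproj_equiv \<A> \<Gamma> \<Gamma>' \<longleftrightarrow> (\<exists>\<Upsilon>. real_one_form \<A> \<Upsilon> \<and>
     (\<forall>c\<in>\<A>. \<forall>p\<in>fst c. \<forall>X Y. \<Gamma>' c p X Y = \<Gamma> c p X Y +
        (1/2) *\<^sub>R (\<Upsilon> c p X *\<^sub>R Y + \<Upsilon> c p Y *\<^sub>R X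
                 - \<Upsilon> c p (Jstr X) *\<^sub>R Jstr Y - \<Upsilon> c p (Jstr Y) *\<^sub>R Jstr X)))"

definition c_projective_structure ::
    "('m::topological_space, 'n::finite) chart set \<Rightarrow> ('m, 'n) connection set \<Rightarrow> bool" where
  "c_projective_structure \<A> \<P> \<longleftrightarrow> (\<exists>\<Gamma>. complex_connection \<A> \<Gamma> \<and>
     \<P> = {\<Gamma>'. complex_connection \<A> \<Gamma>' \<and> cproj_equiv \<A> \<Gamma> \<Gamma>'})"


section \<open>The metrisability equation\<close>

text \<open>
  A section \<open>\<eta>\<close> of \<open>T\<^sup>0\<^sup>,\<^sup>1M \<otimes> T\<^sup>1\<^sup>,\<^sup>0M(-1,-1)\<close> has components \<open>\<eta> c p $ b $ d\<close>, where the first index \<open>b\<close>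
  is the barred one. It is real iff its matrix is Hermitian.
\<close>

type_synonym ('m, 'n) herm_field = "('m, 'n) chart \<Rightarrow> 'm \<Rightarrow> complex^'n^'n"

definition real_herm_section ::
    "('m, 'n::finite) chart set \<Rightarrow> ('m, 'n) herm_field \<Rightarrow> bool" where
  "real_herm_section \<A> \<eta> \<longleftrightarrow> smooth_section \<A> \<eta> \<and>
     (\<forall>c\<in>\<A>. \<forall>p\<in>fst c. \<forall>b d. cnj (\<eta> c p $ b $ d) = \<eta> c p $ d $ b) \<and>
     (\<forall>c\<in>\<A>. \<forall>c'\<in>\<A>. \<forall>p \<in> fst c \<inter> fst c'. \<forall>b d.
        \<eta> c' p $ b $ d = complex_of_real (inverse (weight_trans c c' p)) *
          (\<Sum>e\<in>UNIV. \<Sum>f\<in>UNIV. cnj (cjac c c' p $ b $ e) * cjac c c' p $ d $ f * \<eta> c p $ e $ f))"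

text \<open>Sections \<open>X\<^sup>c\<close> of \<open>T\<^sup>1\<^sup>,\<^sup>0M(-1,-1)\<close>.\<close>

definition weighted_vector_section ::
    "('m, 'n::finite) chart set \<Rightarrow> (('m, 'n) chart \<Rightarrow> 'm \<Rightarrow> complex^'n) \<Rightarrow> bool" where
  "weighted_vector_section \<A> X \<longleftrightarrow> smooth_section \<A> X \<and>
     (\<forall>c\<in>\<A>. \<forall>c'\<in>\<A>. \<forall>p \<in> fst c \<inter> fst c'.
        X c' p = inverse (weight_trans c c' p) *\<^sub>R (cjac c c' p *v X c p))"

text \<open>
  The covariant derivative of \<open>\<eta>\<close> in the direction of the real vector \<open>v\<close>. The connection
  acts on \<open>T\<^sup>1\<^sup>,\<^sup>0M\<close> by the complex linear endomorphism \<open>\<Gamma> c p v\<close>, on \<open>T\<^sup>0\<^sup>,\<^sup>1M\<close> by its conjugate, and on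
  \<open>\<E>\<^sub>\<real>(1,1)\<close> by \<open>1/(n+1)\<close> times its real trace, as induced from \<open>\<Lambda>\<^sup>2\<^sup>n TM\<close>.
\<close>

definition covd ::
    "('m, 'n::finite) connection \<Rightarrow> ('m, 'n) herm_field \<Rightarrow> ('m, 'n) chart \<Rightarrow> 'm \<Rightarrow> complex^'n
      \<Rightarrow> complex^'n^'n" where
  "covd \<Gamma> \<eta> c p v = (\<chi> b d.
      dird c (\<eta> c) p v $ b $ d
      + (\<Sum>e\<in>UNIV. cnj (\<Gamma> c p v (axis e 1) $ b) * \<eta> c p $ e $ d)
      + (\<Sum>e\<in>UNIV. \<Gamma> c p v (axis e 1) $ d * \<eta> c p $ b $ e)
      - complex_of_real ((\<Sum>i\<in>Basis. \<Gamma> c p v i \<bullet> i) / (real CARD('n) + 1)) * \<eta> c p $ b $ d)"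

text \<open>
  Complex linear extension to the coordinate fields
  \<open>\<partial>\<^sub>a = (\<partial>/\<partial>x\<^sup>a - \<i> \<partial>/\<partial>y\<^sup>a)/2\<close> and \<open>\<partial>\<^bsub>a-bar\<^esub> = (\<partial>/\<partial>x\<^sup>a + \<i> \<partial>/\<partial>y\<^sup>a)/2\<close>.
\<close>

definition nabla10 ::
    "('m, 'n::finite) connection \<Rightarrow> ('m, 'n) herm_field \<Rightarrow> ('m, 'n) chart \<Rightarrow> 'm \<Rightarrow> 'n \<Rightarrow> complex^'n^'n"
  where "nabla10 \<Gamma> \<eta> c p a = (\<chi> b d.
      (covd \<Gamma> \<eta> c p (axis a 1) $ b $ d - \<i> * covd \<Gamma> \<eta> c p (axis a \<i>) $ b $ d) / 2)"

definition nabla01 ::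
    "('m, 'n::finite) connection \<Rightarrow> ('m, 'n) herm_field \<Rightarrow> ('m, 'n) chart \<Rightarrow> 'm \<Rightarrow> 'n \<Rightarrow> complex^'n^'n"
  where "nabla01 \<Gamma> \<eta> c p a = (\<chi> b d.
      (covd \<Gamma> \<eta> c p (axis a 1) $ b $ d + \<i> * covd \<Gamma> \<eta> c p (axis a \<i>) $ b $ d) / 2)"

definition metrisability_equation ::
    "('m, 'n::finite) chart set \<Rightarrow> ('m, 'n) connection \<Rightarrow> ('m, 'n) herm_field \<Rightarrow> bool" where
  "metrisability_equation \<A> \<Gamma> \<eta> \<longleftrightarrow> (\<exists>X. weighted_vector_section \<A> X \<and>
     (\<forall>c\<in>\<A>. \<forall>p\<in>fst c. \<forall>a b d.
        nabla10 \<Gamma> \<eta> c p a $ b $ d + (if a = d then cnj (X c p $ b) else 0) = 0 \<and>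
        nabla01 \<Gamma> \<eta> c p a $ b $ d + (if a = b then X c p $ d else 0) = 0))"

text \<open>
  The metrisability equation is c-projectively invariant (only \<open>X\<close> depends on the connection),
  so it does not matter which connection of the class is used.
\<close>

definition metrisability_solution ::
    "('m, 'n::finite) chart set \<Rightarrow> ('m, 'n) connection set \<Rightarrow> ('m, 'n) herm_field \<Rightarrow> bool" where
  "metrisability_solution \<A> \<P> \<eta> \<longleftrightarrow>
     real_herm_section \<A> \<eta> \<and> (\<exists>\<Gamma>\<in>\<P>. metrisability_equation \<A> \<Gamma> \<eta>)"

definition linearly_independent_sections ::
    "('m, 'n::finite) chart set \<Rightarrow> ('m, 'n) herm_field \<Rightarrow> ('m, 'n) herm_field \<Rightarrow> bool" where
  "linearly_independent_sections \<A> \<eta> \<theta> \<longleftrightarrow>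
     (\<forall>r s::real. (\<forall>c\<in>\<A>. \<forall>p\<in>fst c. r *\<^sub>R \<eta> c p + s *\<^sub>R \<theta> c p = 0) \<longrightarrow> r = 0 \<and> s = 0)"

text \<open>The pencil \<open>\<theta> - t \<eta>\<close>, where \<open>\<theta>\<close> is the second solution (\<open>\<eta>\<close> with a tilde).\<close>

definition metrisability_pencil ::
    "('m, 'n::finite) chart set \<Rightarrow> ('m, 'n) connection set
      \<Rightarrow> ('m, 'n) herm_field \<Rightarrow> ('m, 'n) herm_field \<Rightarrow> bool" where
  "metrisability_pencil \<A> \<P> \<eta> \<theta> \<longleftrightarrow>
     metrisability_solution \<A> \<P> \<eta> \<and> metrisability_solution \<A> \<P> \<theta> \<and>
     linearly_independent_sections \<A> \<eta> \<theta>"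

definition pencil :: "('m, 'n::finite) herm_field \<Rightarrow> ('m, 'n) herm_field \<Rightarrow> real \<Rightarrow> ('m, 'n) herm_field"
  where "pencil \<eta> \<theta> t c p = \<theta> c p - t *\<^sub>R \<eta> c p"

definition nondegenerate :: "('m, 'n::finite) chart set \<Rightarrow> ('m, 'n) herm_field \<Rightarrow> bool" where
  "nondegenerate \<A> \<eta> \<longleftrightarrow> (\<forall>c\<in>\<A>. \<forall>p\<in>fst c. invertible (\<eta> c p))"


section \<open>Objects associated with a pencil\<close>

text \<open>
  In a chart the weight bundles are trivialised by the coordinate frame, so the components of the
  tautological section \<open>\<epsilon>\<close> are given by the Levi-Civita symbol. The slots of \<open>\<epsilon>\<close> are
  labelled by \<open>'n\<close> itself: a multi-index is a function from slots to indices. Only products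
  of two \<open>\<epsilon>\<close>'s occur, so the choice of labelling is irrelevant; for the same reason any slot may
  serve as the first one.
\<close>

definition levi_civita :: "('n::finite \<Rightarrow> 'n) \<Rightarrow> complex" where
  "levi_civita f = (if f permutes UNIV then of_int (sign f) else 0)"

definition first_slot :: "'n::finite" where
  "first_slot = (SOME s. True)"

text \<open>\<open>det \<eta>\<close> is real because \<open>\<eta>\<close> is Hermitian; it is a section of \<open>\<E>\<^sub>\<real>(1,1)\<close>.\<close>

definition det_eta :: "complex^'n^'n::finite \<Rightarrow> real" where
  "det_eta N = Re (1 / fact CARD('n) *
     (\<Sum>f\<in>UNIV. \<Sum>g\<in>UNIV. levi_civita f * levi_civita g * (\<Prod>s\<in>UNIV. N $ f s $ g s)))"

text \<open>\<open>H\<^bsub>b a-bar\<^esub> = eps_cofactor N $ b $ a\<close>, with \<open>N\<close> the components of \<open>\<theta> - t \<eta>\<close>.\<close>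

definition eps_cofactor :: "complex^'n^'n::finite \<Rightarrow> complex^'n^'n" where
  "eps_cofactor N = (\<chi> b a. 1 / fact (CARD('n) - 1) *
     (\<Sum>f\<in>{f. f first_slot = a}. \<Sum>g\<in>{g. g first_slot = b}.
        levi_civita f * levi_civita g * (\<Prod>s\<in>UNIV - {first_slot}. N $ f s $ g s)))"

text \<open>
  The \<open>J\<close>-invariant symmetric real bilinear form with complex components \<open>h\<^bsub>b a-bar\<^esub>\<close>,
  evaluated on real tangent vectors: \<open>h(X,Y) = h\<^bsub>b a-bar\<^esub> (X\<^sup>b cnj (Y\<^sup>a) + Y\<^sup>b cnj (X\<^sup>a))\<close>.
\<close>

definition real_form :: "complex^'n^'n::finite \<Rightarrow> complex^'n \<Rightarrow> complex^'n \<Rightarrow> real" where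
  "real_form h X Y =
     Re (\<Sum>b\<in>UNIV. \<Sum>a\<in>UNIV. h $ b $ a * (X $ b * cnj (Y $ a) + Y $ b * cnj (X $ a)))"

text \<open>\<open>metric_up $ a $ b = g\<^bsup>a-bar b\<^esup>\<close> and \<open>metric_low $ b $ a = g\<^bsub>b a-bar\<^esub>\<close>.\<close>

definition metric_up :: "('m, 'n::finite) herm_field \<Rightarrow> ('m, 'n) herm_field" where
  "metric_up \<eta> c p = det_eta (\<eta> c p) *\<^sub>R \<eta> c p"

definition metric_low :: "('m, 'n::finite) herm_field \<Rightarrow> ('m, 'n) herm_field" where
  "metric_low \<eta> c p = matrix_inv (metric_up \<eta> c p)"

definition metric ::
    "('m, 'n::finite) herm_field \<Rightarrow> ('m, 'n) chart \<Rightarrow> 'm \<Rightarrow> complex^'n \<Rightarrow> complex^'n \<Rightarrow> real" where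
  "metric \<eta> c p = real_form (metric_low \<eta> c p)"

text \<open>The endomorphism \<open>A\<close> of \<open>T\<^sup>1\<^sup>,\<^sup>0M\<close> with \<open>\<theta> = \<eta> ** A\<close>, where \<open>A $ b $ d = A\<^sub>b\<^sup>d\<close>.\<close>

definition pencil_endo :: "('m, 'n::finite) herm_field \<Rightarrow> ('m, 'n) herm_field \<Rightarrow> ('m, 'n) herm_field"
  where "pencil_endo \<eta> \<theta> c p = matrix_inv (\<eta> c p) ** \<theta> c p"

text \<open>\<open>det A(t)\<close> is real because \<open>A\<close> is self-adjoint with respect to \<open>\<eta>\<close>.\<close>

definition det_A ::
    "('m, 'n::finite) herm_field \<Rightarrow> ('m, 'n) herm_field \<Rightarrow> real \<Rightarrow> ('m, 'n) chart \<Rightarrow> 'm \<Rightarrow> real" where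
  "det_A \<eta> \<theta> t c p = Re (det (pencil_endo \<eta> \<theta> c p - mat (complex_of_real t)))"

text \<open>
  The components \<open>\<omega>\<^bsub>a-bar\<^esub> = \<omega>(\<partial>\<^bsub>a-bar\<^esub>)\<close> of a real covector \<open>\<omega>\<close>, and the vector
  \<open>(\<omega>\<^sup>\<sharp>)\<^sup>\<beta> = g\<^bsup>\<alpha>\<beta>\<^esup> \<omega>\<^sub>\<alpha>\<close>, whose \<open>(1,0)\<close>-components are \<open>g\<^bsup>a-bar b\<^esup> \<omega>\<^bsub>a-bar\<^esub>\<close>.
  Thus \<open>\<Omega>\<^bsup>\<alpha>\<beta>\<^esup> \<omega>\<^sub>\<alpha> = J\<^sub>\<gamma>\<^sup>\<beta> g\<^bsup>\<alpha>\<gamma>\<^esup> \<omega>\<^sub>\<alpha>\<close> is \<open>J (\<omega>\<^sup>\<sharp>)\<close>.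
\<close>

definition covec01 :: "(complex^'n::finite \<Rightarrow> real) \<Rightarrow> 'n \<Rightarrow> complex" where
  "covec01 \<omega> a = (complex_of_real (\<omega> (axis a 1)) + \<i> * complex_of_real (\<omega> (axis a \<i>))) / 2"

definition raise_index :: "complex^'n^'n::finite \<Rightarrow> (complex^'n \<Rightarrow> real) \<Rightarrow> complex^'n" where
  "raise_index k \<omega> = (\<chi> b. \<Sum>a\<in>UNIV. k $ a $ b * covec01 \<omega> a)"

definition Kvec ::
    "('m, 'n::finite) herm_field \<Rightarrow> ('m, 'n) herm_field \<Rightarrow> real \<Rightarrow> ('m, 'n) chart \<Rightarrow> 'm \<Rightarrow> complex^'n"
  where "Kvec \<eta> \<theta> t c p =
    Jstr (raise_index (metric_up \<eta> c p) (dird c (det_A \<eta> \<theta> t c) p))"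


section \<open>Tangent and cotangent bundle and the Poisson bracket\<close>

text \<open>
  A tangent vector at \<open>p\<close> is the family of its coordinate tuples in all charts around \<open>p\<close>; a
  cotangent vector is the family of the corresponding linear functionals. Both are set to zero in
  all other charts. Functions on these bundles are evaluated in an arbitrary chart around \<open>p\<close>.
\<close>

type_synonym ('m, 'n) tvec = "'m \<times> (('m, 'n) chart \<Rightarrow> complex^'n)"
type_synonym ('m, 'n) covec = "'m \<times> (('m, 'n) chart \<Rightarrow> complex^'n \<Rightarrow> real)"

definition tangent_bundle :: "('m, 'n::finite) chart set \<Rightarrow> ('m, 'n) tvec set" where
  "tangent_bundle \<A> = {(p, v).
     (\<forall>c\<in>charts_at \<A> p. \<forall>c'\<in>charts_at \<A> p. v c' = jac c c' p (v c)) \<and>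
     (\<forall>c. c \<notin> charts_at \<A> p \<longrightarrow> v c = 0)}"

definition cotangent_bundle :: "('m, 'n::finite) chart set \<Rightarrow> ('m, 'n) covec set" where
  "cotangent_bundle \<A> = {(p, \<theta>).
     (\<forall>c\<in>charts_at \<A> p. linear (\<theta> c)) \<and>
     (\<forall>c\<in>charts_at \<A> p. \<forall>c'\<in>charts_at \<A> p. \<forall>v. \<theta> c v = \<theta> c' (jac c c' p v)) \<and>
     (\<forall>c. c \<notin> charts_at \<A> p \<longrightarrow> \<theta> c = (\<lambda>_. 0))}"

definition L_fun ::
    "('m, 'n::finite) chart set \<Rightarrow> ('m, 'n) herm_field \<Rightarrow> ('m, 'n) herm_field \<Rightarrow> real
      \<Rightarrow> ('m, 'n) tvec \<Rightarrow> real" where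
  "L_fun \<A> \<eta> \<theta> t = (\<lambda>(p, v). let c = chart_at \<A> p in metric \<eta> c p (Kvec \<eta> \<theta> t c p) (v c))"

definition I_fun ::
    "('m, 'n::finite) chart set \<Rightarrow> ('m, 'n) herm_field \<Rightarrow> ('m, 'n) herm_field \<Rightarrow> real
      \<Rightarrow> ('m, 'n) tvec \<Rightarrow> real" where
  "I_fun \<A> \<eta> \<theta> t = (\<lambda>(p, v). let c = chart_at \<A> p in
     inverse ((det_eta (\<eta> c p))\<^sup>2) * real_form (eps_cofactor (pencil \<eta> \<theta> t c p)) (v c) (v c))"

text \<open>
  Canonical coordinates \<open>(x, \<xi>)\<close> on the cotangent bundle over a chart \<open>c\<close>: \<open>\<xi>\<close> collects the components
  of the covector with respect to the real coordinate basis. \<open>cotangent_point\<close> is the inverse.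
\<close>

definition cotangent_coords ::
    "('m, 'n::finite) chart \<Rightarrow> ('m, 'n) covec \<Rightarrow> (complex^'n) \<times> (complex^'n)" where
  "cotangent_coords c = (\<lambda>(p, \<theta>). (snd c p, \<Sum>i\<in>Basis. \<theta> c i *\<^sub>R i))"

definition cotangent_point ::
    "('m, 'n::finite) chart set \<Rightarrow> ('m, 'n) chart \<Rightarrow> (complex^'n) \<times> (complex^'n) \<Rightarrow> ('m, 'n) covec" where
  "cotangent_point \<A> c = (\<lambda>(x, \<xi>). let p = inv_into (fst c) (snd c) x in
     (p, \<lambda>c'. if c' \<in> charts_at \<A> p then (\<lambda>v. \<xi> \<bullet> jac c' c p v) else (\<lambda>_. 0)))"

text \<open>
  The canonical Poisson bracket
  \<open>\<Sum>\<^sub>i (\<partial>F/\<partial>x\<^sup>i \<partial>G/\<partial>\<xi>\<^sub>i - \<partial>F/\<partial>\<xi>\<^sub>i \<partial>G/\<partial>x\<^sup>i)\<close>, which does not depend on the chart.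
\<close>

definition canonical_bracket ::
    "('m, 'n::finite) chart set \<Rightarrow> (('m, 'n) covec \<Rightarrow> real) \<Rightarrow> (('m, 'n) covec \<Rightarrow> real)
      \<Rightarrow> ('m, 'n) covec \<Rightarrow> real" where
  "canonical_bracket \<A> F G \<omega> = (let c = chart_at \<A> (fst \<omega>);
      DF = frechet_derivative (F \<circ> cotangent_point \<A> c) (at (cotangent_coords c \<omega>));
      DG = frechet_derivative (G \<circ> cotangent_point \<A> c) (at (cotangent_coords c \<omega>))
    in \<Sum>i\<in>Basis. DF (i, 0) * DG (0, i) - DF (0, i) * DG (i, 0))"

definition flat ::
    "('m, 'n::finite) chart set \<Rightarrow> ('m, 'n) herm_field \<Rightarrow> ('m, 'n) tvec \<Rightarrow> ('m, 'n) covec" where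
  "flat \<A> \<eta> = (\<lambda>(p, v).
     (p, \<lambda>c. if c \<in> charts_at \<A> p then metric \<eta> c p (v c) else (\<lambda>_. 0)))"

definition poisson_bracket ::
    "('m, 'n::finite) chart set \<Rightarrow> ('m, 'n) herm_field
      \<Rightarrow> (('m, 'n) tvec \<Rightarrow> real) \<Rightarrow> (('m, 'n) tvec \<Rightarrow> real) \<Rightarrow> ('m, 'n) tvec \<Rightarrow> real" where
  "poisson_bracket \<A> \<eta> F G X = canonical_bracket \<A>
     (F \<circ> inv_into (tangent_bundle \<A>) (flat \<A> \<eta>)) (G \<circ> inv_into (tangent_bundle \<A>) (flat \<A> \<eta>))
     (flat \<A> \<eta> X)"

end

theory Submission
  imports Defs "HOL-Computational_Algebra.Polynomial"
begin

text \<open>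
  Everything happens in a chart. Write \<open>g = (det \<eta>) \<eta>\<close> for the inverse metric, \<open>h\<close> for its inverse,
  \<open>A = \<eta>\<^sup>-\<^sup>1 \<theta>\<close> for the endomorphism of the pencil, and \<open>*\<close> for the Hermitian adjoint. A torsion-free
  connection with \<open>\<nabla>J = 0\<close> is given by complex matrices \<open>G v\<close> that are complex linear and symmetric
  in the two lower indices, and a change of connection in the c-projective class can be absorbed
  into the right hand side of the metrisability equation. Choosing it so that \<open>\<eta>\<close> becomes parallel
  turns the two equations into
    \<open>D\<^sub>v g = - g G(v) - G(v)* g\<close> and \<open>D\<^sub>v A = [G(v), A] - \<Lambda> v\<^sup>T - h v' (g \<Lambda>)*\<close>, \<open>v'\<close> the conjugate of \<open>v\<close>.
  These are the axioms of the locale \<open>local_pencil\<close>; they hold in every chart by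
  \<open>solution_in_chart\<close>, \<open>local_pencilI\<close> and \<open>local_pencil_in_chart\<close>.

  Let \<open>B\<^sub>t\<close> be the cofactor matrix and \<open>d\<^sub>t\<close> the determinant of \<open>A - t\<close>, and let \<open>b\<^sub>t = g B\<^sub>t \<Lambda>\<close>. Transported
  to the cotangent bundle by \<open>g\<close>, the functions are (\<open>pullback_eq\<close>)
    \<open>I\<^sub>t = 1/2 Re (\<xi>\<^sup>T g B\<^sub>t \<xi>')\<close> and \<open>L\<^sub>t = Re (\<i> \<xi>\<^sup>T b\<^sub>t)\<close>.
  All brackets are computed from the two equations above and from the resolvent identity
  \<open>(t - s) B\<^sub>t B\<^sub>s = d\<^sub>s B\<^sub>t - d\<^sub>t B\<^sub>s\<close>. For instance \<open>{I\<^sub>t, I\<^sub>s}\<close> is the antisymmetrisation in \<open>t, s\<close> of the sum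
  of a term that is symmetric because \<open>G\<close> is, and of a term which by the resolvent identity equals
  \<open>- Re (a\<^sub>t q\<^sub>s - a\<^sub>s q\<^sub>t) / (t - s)\<close> with \<open>a\<^sub>t = \<xi>\<^sup>T b\<^sub>t\<close> and \<open>q\<^sub>t = \<xi>\<^sup>T g B\<^sub>t \<xi>'\<close>; this is symmetric too.

  The brackets with \<open>L\<^sub>t\<close> contain the derivative of \<open>\<Lambda>\<close>. The symmetry of the second derivatives of \<open>g\<close> and
  \<open>A\<close> says that the curvature \<open>R\<close> of \<open>G\<close> has type \<open>(1,1)\<close> and that \<open>[R, A]\<close> is an explicit expression in
  the covariant derivative of \<open>\<Lambda>\<close>. In complex dimension at least 2 this has two consequences: the
  complex linear part of the covariant derivative vanishes (\<open>covLam10_0\<close>), so that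
  \<open>D\<^sub>v \<Lambda> = G(v) \<Lambda> + M v'\<close> with a Hermitian matrix \<open>M\<close>, and \<open>M g\<close> commutes with \<open>A\<close> (\<open>Hess_g_A\<close>).
  The first means that the vector fields \<open>K\<^sub>t\<close> are holomorphic, the second that their covariant
  derivatives are compatible with all \<open>B\<^sub>s\<close>; together they make \<open>{L\<^sub>t, L\<^sub>s}\<close> and \<open>{L\<^sub>t, I\<^sub>s}\<close> vanish by the same
  kind of computation.

  The computations divide by \<open>d\<^sub>t\<close>, \<open>d\<^sub>s\<close> and \<open>t - s\<close>. At a given point these are nonzero for generic
  parameters, and the brackets are continuous in \<open>t\<close> and in \<open>s\<close>, so they vanish for all parameters
  (\<open>brackets_vanish\<close>).
\<close>

section \<open>Determinants and cofactors from Levi-Civita symbols\<close>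

lemma sum_levi_civita_det:
  fixes N :: "complex^'n^'n::finite"
  shows "(\<Sum>g\<in>UNIV. levi_civita g * (\<Prod>s\<in>UNIV. N $ f s $ g s)) = det (\<chi> s. N $ f s)"
proof -
  have "(\<Sum>g\<in>UNIV. levi_civita g * (\<Prod>s\<in>UNIV. N $ f s $ g s))
      = (\<Sum>g\<in>{p. p permutes UNIV}. levi_civita g * (\<Prod>s\<in>UNIV. N $ f s $ g s))"
    by (rule sum.mono_neutral_right) (auto simp: levi_civita_def)
  also have "\<dots> = det (\<chi> s. N $ f s)"
    unfolding det_def by (rule sum.cong) (auto simp: levi_civita_def)
  finally show ?thesis .
qed

lemma levi_civita_det_rows:
  fixes N :: "complex^'n^'n::finite"
  shows "levi_civita f * det (\<chi> s. N $ f s) = (if f permutes UNIV then det N else 0)"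
proof (cases "f permutes UNIV")
  case True
  have "det (\<chi> s. N $ f s) = of_int (sign f) * det N"
    using det_permute_rows[OF True, of N] by simp
  moreover have "(of_int (sign f) * of_int (sign f) :: complex) = 1"
    by (metis of_int_1 of_int_mult sign_idempotent)
  ultimately show ?thesis using True
    by (simp add: levi_civita_def flip: mult.assoc)
qed (simp add: levi_civita_def)

lemma det_eta_eq_Re_det: "det_eta N = Re (det N)"
  for N :: "complex^'n^'n::finite"
proof -
  have "(\<Sum>f\<in>UNIV. \<Sum>g\<in>UNIV. levi_civita f * levi_civita g * (\<Prod>s\<in>UNIV. N $ f s $ g s))
     = (\<Sum>f\<in>(UNIV :: ('n \<Rightarrow> 'n) set). levi_civita f * det (\<chi> s. N $ f s))"
    unfolding sum_levi_civita_det[symmetric] by (simp add: sum_distrib_left mult.assoc)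
  also have "\<dots> = (\<Sum>f\<in>{f::'n\<Rightarrow>'n. f permutes UNIV}. det N)"
    by (simp add: levi_civita_det_rows sum.If_cases)
  also have "\<dots> = of_nat (fact CARD('n)) * det N"
    using card_permutations[of "UNIV :: 'n set" "CARD('n)"] by simp
  finally show ?thesis by (simp add: det_eta_def)
qed

lemma card_permutes_value:
  fixes a b :: "'n::finite"
  shows "card {f. f permutes (UNIV :: 'n set) \<and> f a = b} = fact (CARD('n) - 1)"
proof -
  let ?P = "\<lambda>c. {f. f permutes (UNIV :: 'n set) \<and> f a = c}"
  have eq: "card (?P c) = card (?P b)" for c
  proof -
    have "bij_betw (\<lambda>f. Transposition.transpose b c \<circ> f) (?P c) (?P b)"
      by (rule bij_betw_byWitness[where f' = "\<lambda>f. Transposition.transpose b c \<circ> f"])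
         (auto simp: fun_eq_iff permutes_compose permutes_swap_id)
    thus ?thesis by (rule bij_betw_same_card)
  qed
  have "fact CARD('n) = card {f. f permutes (UNIV :: 'n set)}"
    by (simp add: card_permutations)
  also have "{f. f permutes (UNIV :: 'n set)} = (\<Union>c\<in>UNIV. ?P c)" by auto
  also have "card \<dots> = (\<Sum>c\<in>UNIV. card (?P c))"
    by (rule card_UN_disjoint) auto
  also have "\<dots> = (\<Sum>c\<in>(UNIV :: 'n set). card (?P b))" by (rule sum.cong[OF refl eq])
  also have "\<dots> = CARD('n) * card (?P b)" by simp
  finally have "fact CARD('n) = CARD('n) * card (?P b)" .
  moreover have "fact CARD('n) = CARD('n) * (fact (CARD('n) - 1) :: nat)"
    by (subst fact_reduce) auto
  ultimately show ?thesis by simp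
qed

text \<open>
  Laplace expansion. Contracting the free slot of the cofactor matrix with row \<open>c\<close> of \<open>N\<close> completes
  one of the two Levi-Civita contractions to the determinant of \<open>N\<close> with its rows rearranged by \<open>f\<close>,
  where the row in the first slot is replaced by row \<open>c\<close>. This vanishes unless \<open>c\<close> is the row that
  was omitted, and the permutations with a prescribed first value cancel the factorial.
\<close>

lemma matrix_mult_eps_cofactor:
  fixes N :: "complex^'n^'n::finite"
  shows "N ** eps_cofactor N = mat (det N)"
proof -
  have "(N ** eps_cofactor N) $ c $ a = (if c = a then det N else 0)" for c a
  proof -
    let ?z = "first_slot :: 'n"
    let ?r = "\<lambda>f g. levi_civita f * levi_civita g * (\<Prod>s\<in>UNIV - {?z}. N $ f s $ g s)"
    have row: "(\<Sum>g\<in>UNIV. N $ c $ g ?z * ?r f g) = levi_civita f * det (\<chi> s. N $ (f(?z := c)) s)"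
      for f
    proof -
      have "N $ c $ g ?z * ?r f g
          = levi_civita f * (levi_civita g * (\<Prod>s\<in>UNIV. N $ (f(?z := c)) s $ g s))" for g
      proof -
        have "(\<Prod>s\<in>UNIV. N $ (f(?z := c)) s $ g s)
            = N $ c $ g ?z * (\<Prod>s\<in>UNIV - {?z}. N $ (f(?z := c)) s $ g s)"
          by (subst prod.remove[of _ ?z]) auto
        also have "(\<Prod>s\<in>UNIV - {?z}. N $ (f(?z := c)) s $ g s)
            = (\<Prod>s\<in>UNIV - {?z}. N $ f s $ g s)"
          by (rule prod.cong) auto
        finally show ?thesis by simp
      qed
      thus ?thesis by (simp only: sum_distrib_left[symmetric] sum_levi_civita_det)
    qed
    have val: "levi_civita f * det (\<chi> s. N $ (f(?z := c)) s)
        = (if f permutes UNIV \<and> c = a then det N else 0)" if "f ?z = a" for f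
    proof (cases "f permutes UNIV \<and> c \<noteq> a")
      case True
      then obtain s where s: "f s = c" by (metis permutes_surj surjD)
      with True that have "s \<noteq> ?z" by auto
      hence "det (\<chi> s. N $ (f(?z := c)) s) = 0"
        by (intro det_identical_rows[of ?z s]) (auto simp: row_def s)
      with True show ?thesis by simp
    next
      case False
      show ?thesis
      proof (cases "f permutes UNIV")
        case True
        with False that have "f(?z := c) = f" by auto
        thus ?thesis using levi_civita_det_rows[of f N] True False by simp
      qed (simp add: levi_civita_def)
    qed
    have "(N ** eps_cofactor N) $ c $ a = 1 / fact (CARD('n) - 1) *
       (\<Sum>b\<in>UNIV. \<Sum>f\<in>{f. f ?z = a}. \<Sum>g\<in>{g. g ?z = b}. N $ c $ b * ?r f g)"
      by (simp add: matrix_matrix_mult_def eps_cofactor_def sum_distrib_left mult_ac)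
    also have "(\<Sum>b\<in>UNIV. \<Sum>f\<in>{f. f ?z = a}. \<Sum>g\<in>{g. g ?z = b}. N $ c $ b * ?r f g)
      = (\<Sum>f\<in>{f. f ?z = a}. \<Sum>b\<in>UNIV. \<Sum>g\<in>{g\<in>UNIV. g ?z = b}. N $ c $ g ?z * ?r f g)"
      by (subst sum.swap) (intro sum.cong, auto)
    also have "\<dots> = (\<Sum>f\<in>{f. f ?z = a}. \<Sum>g\<in>UNIV. N $ c $ g ?z * ?r f g)"
      by (intro sum.cong refl sum.group) auto
    also have "\<dots> = (\<Sum>f\<in>{f. f ?z = a}. if f permutes UNIV \<and> c = a then det N else 0)"
      unfolding row by (intro sum.cong refl val) simp
    also have "\<dots> = (\<Sum>f\<in>{f. f permutes UNIV \<and> f ?z = a}. if c = a then det N else 0)"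
      by (intro sum.mono_neutral_cong_right) auto
    also have "\<dots> = fact (CARD('n) - 1) * (if c = a then det N else 0)"
      by (simp add: card_permutes_value)
    finally show ?thesis by simp
  qed
  thus ?thesis by (simp add: vec_eq_iff mat_def)
qed

text \<open>
  The device by which identities are freed from the assumption that \<open>N - t\<close> is invertible: this
  excludes only finitely many \<open>t\<close>.
\<close>

lemma continuous_eq_off_finite:
  fixes \<phi> :: "real \<Rightarrow> 'b::t2_space"
  assumes "continuous_on UNIV \<phi>" "finite Z" "\<And>t. t \<notin> Z \<Longrightarrow> \<phi> t = c"
  shows "\<phi> t = c"
proof -
  have "(\<phi> \<longlongrightarrow> \<phi> t) (at t)"
    using assms(1) by (simp add: continuous_on_eq_continuous_at isCont_def)
  moreover have "(\<phi> \<longlongrightarrow> c) (at t)"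
  proof (rule tendsto_eventually)
    have "eventually (\<lambda>s. s \<in> - (Z - {t})) (nhds t)"
      using assms(2) by (intro eventually_nhds_in_open open_Compl finite_imp_closed) auto
    hence "eventually (\<lambda>s. s \<notin> Z) (at t)"
      by (auto simp: eventually_at_filter elim: eventually_mono)
    thus "eventually (\<lambda>s. \<phi> s = c) (at t)"
      by (rule eventually_mono) (simp add: assms(3))
  qed
  ultimately show ?thesis by (rule tendsto_unique[OF trivial_limit_at])
qed

lemma mat_scal: "mat c ** M = (\<chi> i j. c * M $ i $ j)" "M ** mat c = (\<chi> i j. c * M $ i $ j)"
  for M :: "complex^'n^'n::finite"
  by (simp_all add: matrix_matrix_mult_def mat_def vec_eq_iff mult_delta_left mult_delta_right)

lemma mat_mult_vector: "mat c *v x = c *s x" for x :: "complex^'n::finite"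
  by (simp add: matrix_vector_mult_def mat_def vec_eq_iff mult_delta_left)

lemma finite_real_eigenvalues:
  fixes A :: "complex^'n^'n::finite"
  shows "finite {t::real. det (A - mat (complex_of_real t)) = 0}"
proof -
  define p :: "complex poly" where "p = (\<Sum>f\<in>{f. f permutes (UNIV :: 'n set)}.
      of_int (sign f) * (\<Prod>i\<in>UNIV. [:A $ i $ f i, - (if i = f i then 1 else 0):]))"
  have p: "poly p z = det (A - mat z)" for z
    by (auto simp: p_def det_def mat_def poly_sum poly_prod intro!: sum.cong prod.cong)
  obtain B where B: "B > 0" "\<And>x. norm (A *v x) \<le> B * norm x"
    using bounded_linear.pos_bounded[of "(*v) A"]
    by (metis matrix_vector_mul_bounded_linear mult.commute)
  \<comment> \<open>A number larger than a bound for the operator norm is not an eigenvalue.\<close>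
  have "det (A - mat (complex_of_real (B + 1))) \<noteq> 0"
  proof
    assume "det (A - mat (complex_of_real (B + 1))) = 0"
    then obtain x where x: "x \<noteq> 0" "(A - mat (complex_of_real (B + 1))) *v x = 0"
      by (metis invertible_det_nz invertible_left_inverse matrix_left_invertible_ker)
    have "A *v x = (B + 1) *\<^sub>R x"
      using x(2) by (simp add: matrix_vector_mult_diff_rdistrib mat_mult_vector)
        (simp add: vec_eq_iff scaleR_conv_of_real[where 'a = complex] algebra_simps)
    with B(2)[of x] have "(B + 1) * norm x \<le> B * norm x"
      using B(1) by simp
    with x(1) show False by (simp add: algebra_simps)
  qed
  hence "p \<noteq> 0" using p by (metis poly_0)
  hence "finite {z. poly p z = 0}" by (rule poly_roots_finite)
  hence "finite (complex_of_real -` {z. poly p z = 0})"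
    by (rule finite_vimageI) (simp add: inj_on_def)
  thus ?thesis by (simp add: p vimage_def)
qed

lemma continuous_on_mat [continuous_intros]:
  fixes f :: "'a::topological_space \<Rightarrow> complex"
  assumes "continuous_on S f" shows "continuous_on S (\<lambda>x. mat (f x) :: complex^'n^'n)"
proof -
  have "continuous_on S (\<lambda>x. if i = j then f x else 0)" for i j :: 'n
    using assms by (cases "i = j") auto
  thus ?thesis unfolding mat_def by (intro continuous_on_vec_lambda)
qed

lemma continuous_on_det [continuous_intros]:
  fixes f :: "'a::topological_space \<Rightarrow> complex^'n^'n::finite"
  assumes "continuous_on S f" shows "continuous_on S (\<lambda>x. det (f x))"
  unfolding det_def by (intro continuous_intros assms)

lemma continuous_on_matrix_mult [continuous_intros]:
  fixes f g :: "'a::topological_space \<Rightarrow> complex^'n^'n::finite"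
  assumes "continuous_on S f" "continuous_on S g" shows "continuous_on S (\<lambda>x. f x ** g x)"
  unfolding matrix_matrix_mult_def by (intro continuous_on_vec_lambda continuous_intros assms)

lemma continuous_on_matrix_vector_mult [continuous_intros]:
  fixes f :: "'a::topological_space \<Rightarrow> complex^'n^'n::finite"
  assumes "continuous_on S f" "continuous_on S g" shows "continuous_on S (\<lambda>x. f x *v g x)"
  unfolding matrix_vector_mult_def by (intro continuous_on_vec_lambda continuous_intros assms)

lemma continuous_on_eps_cofactor [continuous_intros]:
  fixes f :: "'a::topological_space \<Rightarrow> complex^'n^'n::finite"
  assumes "continuous_on S f" shows "continuous_on S (\<lambda>x. eps_cofactor (f x))"
  unfolding eps_cofactor_def by (intro continuous_on_vec_lambda continuous_intros assms)

lemma eq_if_eq_on_invertible: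
  fixes \<phi> \<psi> :: "complex^'n^'n::finite \<Rightarrow> 'b::t2_space"
  assumes "continuous_on UNIV \<phi>" "continuous_on UNIV \<psi>" "\<And>N. det N \<noteq> 0 \<Longrightarrow> \<phi> N = \<psi> N"
  shows "\<phi> N = \<psi> N"
proof -
  let ?N = "\<lambda>t::real. N - mat (complex_of_real t)"
  have c: "continuous_on UNIV ?N" by (intro continuous_intros)
  have lim: "((\<omega> \<circ> ?N) \<longlongrightarrow> \<omega> (?N 0)) (at 0)" if "continuous_on UNIV \<omega>" for \<omega> :: "complex^'n^'n \<Rightarrow> 'b"
  proof -
    have "continuous_on UNIV (\<omega> \<circ> ?N)"
      by (intro continuous_on_compose c continuous_on_subset[OF that]) simp
    hence "isCont (\<omega> \<circ> ?N) 0" using continuous_on_eq_continuous_at[OF open_UNIV] by blast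
    thus ?thesis unfolding isCont_def by (simp only: o_apply)
  qed
  note * = lim[OF assms(1)] lim[OF assms(2)]
  have "eventually (\<lambda>t. t \<in> - ({t. det (?N t) = 0} - {0})) (nhds 0)"
    by (intro eventually_nhds_in_open open_Compl finite_imp_closed finite_Diff
        finite_real_eigenvalues) auto
  hence "eventually (\<lambda>t. (\<phi> \<circ> ?N) t = (\<psi> \<circ> ?N) t) (at 0)"
    unfolding eventually_at_filter by (rule eventually_mono) (auto simp: assms(3))
  with *(1) have "((\<psi> \<circ> ?N) \<longlongrightarrow> \<phi> (?N 0)) (at 0)" by (rule Lim_transform_eventually)
  with *(2) have "\<phi> (?N 0) = \<psi> (?N 0)" by (metis tendsto_unique trivial_limit_at)
  moreover have "?N 0 = N" by (simp add: vec_eq_iff mat_def)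
  ultimately show ?thesis by simp
qed

lemma mat_commute: "M ** mat c = mat c ** M" for M :: "complex^'n^'n::finite"
  by (simp add: mat_scal)

lemma mat_mult_mat: "mat a ** mat b = (mat (a * b) :: complex^'n^'n::finite)"
  by (simp add: mat_scal) (simp add: mat_def vec_eq_iff)

lemma eps_cofactor_mult_matrix:
  fixes N :: "complex^'n^'n::finite"
  shows "eps_cofactor N ** N = mat (det N)"
proof (rule eq_if_eq_on_invertible[where \<phi> = "\<lambda>N. eps_cofactor N ** N"])
  fix N :: "complex^'n^'n" assume d: "det N \<noteq> 0"
  have "N ** (mat (inverse (det N)) ** eps_cofactor N) = mat 1"
    by (metis d left_inverse mat_commute mat_mult_mat matrix_mul_assoc matrix_mult_eps_cofactor mult.commute)
  hence "(mat (inverse (det N)) ** eps_cofactor N) ** N = mat 1"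
    by (simp add: matrix_left_right_inverse)
  hence "mat (det N) ** ((mat (inverse (det N)) ** eps_cofactor N) ** N) = mat (det N)" by simp
  thus "eps_cofactor N ** N = mat (det N)" using d
    by (simp add: matrix_mul_assoc mat_mult_mat)
qed (intro continuous_intros)+

lemma eps_cofactor_unique:
  fixes N :: "complex^'n^'n::finite"
  assumes "det N \<noteq> 0" "N ** X = mat (det N)"
  shows "X = eps_cofactor N"
proof -
  have "mat (det N) ** X = eps_cofactor N ** (N ** X)"
    by (simp add: matrix_mul_assoc eps_cofactor_mult_matrix)
  also have "\<dots> = mat (det N) ** eps_cofactor N" by (simp only: assms(2) mat_commute)
  finally show ?thesis using assms(1) by (simp add: mat_scal vec_eq_iff)
qed

text \<open>
  For invertible matrices the cofactor matrix is the determinant times the inverse; the general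
  case follows in one argument at a time by density.
\<close>

lemma eps_cofactor_mult:
  fixes X Y :: "complex^'n^'n::finite"
  shows "eps_cofactor (X ** Y) = eps_cofactor Y ** eps_cofactor X"
proof -
  have inv: "eps_cofactor (X ** Y) = eps_cofactor Y ** eps_cofactor X"
    if "det X \<noteq> 0" "det Y \<noteq> 0" for X Y :: "complex^'n^'n"
  proof (rule eps_cofactor_unique[symmetric])
    have "(X ** Y) ** (eps_cofactor Y ** eps_cofactor X)
        = X ** (Y ** eps_cofactor Y) ** eps_cofactor X" by (simp add: matrix_mul_assoc)
    also have "\<dots> = mat (det Y) ** (X ** eps_cofactor X)"
      by (simp only: matrix_mult_eps_cofactor[of Y] mat_commute[of X] matrix_mul_assoc)
    also have "\<dots> = mat (det (X ** Y))"
      by (simp add: matrix_mult_eps_cofactor mat_mult_mat det_mul mult.commute)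
    finally show "(X ** Y) ** (eps_cofactor Y ** eps_cofactor X) = mat (det (X ** Y))" .
  qed (use that in \<open>simp add: det_mul\<close>)
  have "eps_cofactor (X ** Y) = eps_cofactor Y ** eps_cofactor X" if "det X \<noteq> 0" for X Y :: "complex^'n^'n"
    by (rule eq_if_eq_on_invertible[where N = Y]) (auto intro!: continuous_intros inv that)
  thus ?thesis
    by (intro eq_if_eq_on_invertible[where N = X and \<phi> = "\<lambda>X. eps_cofactor (X ** Y)"])
       (auto intro!: continuous_intros)
qed

section \<open>Complex matrices and vectors\<close>

declare transpose_matrix_vector [simp del] vector_transpose_matrix [simp del]

text \<open>
  Transposed matrices are kept in the form \<open>transpose M *v x\<close>, so that conjugation and adjunction
  can be pushed through products of a matrix and a vector.
\<close>

definition hadj :: "complex^'n^'m \<Rightarrow> complex^'m^'n" where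
  "hadj M = (\<chi> i j. cnj (M $ j $ i))"

definition cconj :: "complex^'n \<Rightarrow> complex^'n" where
  "cconj v = (\<chi> i. cnj (v $ i))"

definition outer :: "complex^'n \<Rightarrow> complex^'n \<Rightarrow> complex^'n^'n" where
  "outer u v = (\<chi> i j. u $ i * v $ j)"

text \<open>
  The complex bilinear pairing, not the Hermitian one: the complex type of an expression then shows
  in the number of conjugations that occur in it.
\<close>

definition cdot :: "complex^'n::finite \<Rightarrow> complex^'n \<Rightarrow> complex" where
  "cdot u v = (\<Sum>i\<in>UNIV. u $ i * v $ i)"

lemma cdot_add: "cdot (u + w) v = cdot u v + cdot w v" "cdot u (v + w) = cdot u v + cdot u w"
  by (simp_all add: cdot_def algebra_simps sum.distrib)
lemma cdot_diff: "cdot (u - w) v = cdot u v - cdot w v" "cdot u (v - w) = cdot u v - cdot u w"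
  by (simp_all add: cdot_def algebra_simps sum_subtractf)
lemma cdot_minus: "cdot (- u) v = - cdot u v" "cdot u (- v) = - cdot u v"
  by (simp_all add: cdot_def sum_negf)
lemma cdot_scale: "cdot (c *s u) v = c * cdot u v" "cdot u (c *s v) = c * cdot u v"
  by (simp_all add: cdot_def sum_distrib_left mult_ac)
lemma cdot_commute: "cdot u v = cdot v u"
  by (simp add: cdot_def mult.commute)
lemma cnj_cdot: "cnj (cdot u v) = cdot (cconj u) (cconj v)"
  by (simp add: cdot_def cconj_def)
lemma cdot_matrix: "cdot u (M *v v) = cdot (transpose M *v u) v"
proof -
  have "cdot u (M *v v) = (\<Sum>i\<in>UNIV. \<Sum>j\<in>UNIV. u $ i * M $ i $ j * v $ j)"
    by (simp add: cdot_def matrix_vector_mult_def sum_distrib_left mult.assoc)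
  also have "\<dots> = (\<Sum>j\<in>UNIV. \<Sum>i\<in>UNIV. u $ i * M $ i $ j * v $ j)" by (rule sum.swap)
  also have "\<dots> = cdot (transpose M *v u) v"
    by (simp add: cdot_def matrix_vector_mult_def transpose_def sum_distrib_left mult_ac)
  finally show ?thesis .
qed
lemma cdot_eq_0D: "(\<And>u. cdot u v = 0) \<Longrightarrow> v = 0"
proof -
  assume *: "\<And>u. cdot u v = 0"
  have "v $ i = 0" for i using *[of "axis i 1"] by (simp add: cdot_def axis_def mult_delta_left)
  thus ?thesis by (simp add: vec_eq_iff)
qed
lemma inner_eq_cdot: "u \<bullet> v = Re (cdot u (cconj v))" for u v :: "complex^'n::finite"
  by (simp add: inner_vec_def cdot_def cconj_def inner_complex_def)

lemma cconj_cconj [simp]: "cconj (cconj v) = v" by (simp add: cconj_def vec_eq_iff)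
lemma cconj_add: "cconj (u + v) = cconj u + cconj v" by (simp add: cconj_def vec_eq_iff)
lemma cconj_diff: "cconj (u - v) = cconj u - cconj v" by (simp add: cconj_def vec_eq_iff)
lemma cconj_minus: "cconj (- u) = - cconj u" by (simp add: cconj_def vec_eq_iff)
lemma cconj_scale: "cconj (c *s u) = cnj c *s cconj u" by (simp add: cconj_def vec_eq_iff)
lemma cconj_matrix: "cconj (M *v v) = transpose (hadj M) *v cconj v"
  by (simp add: cconj_def hadj_def transpose_def matrix_vector_mult_def vec_eq_iff)
lemma cconj_0 [simp]: "cconj 0 = 0" by (simp add: cconj_def vec_eq_iff)
lemma hadj_hadj [simp]: "hadj (hadj M) = M" by (simp add: hadj_def vec_eq_iff)
lemma hadj_mult: "hadj (M ** N) = hadj N ** hadj M"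
  by (simp add: hadj_def matrix_matrix_mult_def vec_eq_iff mult.commute)
lemma hadj_add: "hadj (M + N) = hadj M + hadj N" by (simp add: hadj_def vec_eq_iff)
lemma hadj_diff: "hadj (M - N) = hadj M - hadj N" by (simp add: hadj_def vec_eq_iff)
lemma hadj_minus: "hadj (- M) = - hadj M" by (simp add: hadj_def vec_eq_iff)
lemma hadj_mat: "hadj (mat c) = mat (cnj c)" by (simp add: hadj_def mat_def vec_eq_iff)
lemma hadj_scaleR: "hadj (r *\<^sub>R M) = r *\<^sub>R hadj M" by (simp add: hadj_def vec_eq_iff)
lemma hadj_outer: "hadj (outer u v) = outer (cconj v) (cconj u)"
  by (simp add: hadj_def outer_def cconj_def vec_eq_iff mult.commute)
lemma cdot_hadj: "cdot (cconj u) (M *v v) = cnj (cdot (cconj v) (hadj M *v u))"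
  by (subst cdot_matrix) (simp add: cnj_cdot cconj_matrix cdot_commute)

lemma matrix_add_rdistrib: "(A + B) ** C = A ** C + B ** C" for A :: "complex^'n^'m"
  by (vector matrix_matrix_mult_def algebra_simps sum.distrib)
lemma matrix_diff_ldistrib: "A ** (B - C) = A ** B - A ** C" for A :: "complex^'n^'m"
  by (vector matrix_matrix_mult_def algebra_simps sum_subtractf)
lemma matrix_diff_rdistrib: "(A - B) ** C = A ** C - B ** C" for A :: "complex^'n^'m"
  by (vector matrix_matrix_mult_def algebra_simps sum_subtractf)
lemma matrix_minus_left: "(- A) ** B = - (A ** B)" for A :: "complex^'n^'m"
  by (vector matrix_matrix_mult_def sum_negf)
lemma matrix_minus_right: "A ** (- B) = - (A ** B)" for A :: "complex^'n^'m"
  by (vector matrix_matrix_mult_def sum_negf)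
lemma matrix_scaleR_left: "(r *\<^sub>R A) ** B = r *\<^sub>R (A ** B)" for A :: "complex^'n^'m"
  by (vector matrix_matrix_mult_def scaleR_sum_right)
lemma matrix_scaleR_right: "A ** (r *\<^sub>R B) = r *\<^sub>R (A ** B)" for A :: "complex^'n^'m"
  by (vector matrix_matrix_mult_def scaleR_sum_right)
lemma matrix_vector_minus: "(- A) *v x = - (A *v x)" "A *v (- x) = - (A *v x)"
  for A :: "complex^'n^'m"
  by (vector matrix_vector_mult_def sum_negf)+
lemma matrix_vector_scale: "A *v (c *s x) = c *s (A *v x)" for A :: "complex^'n^'m"
  by (vector matrix_vector_mult_def sum_distrib_left mult_ac)
lemma matrix_mult_outer: "M ** outer u v = outer (M *v u) v"
  by (simp add: matrix_matrix_mult_def outer_def matrix_vector_mult_def vec_eq_iff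
      sum_distrib_right mult.assoc)
lemma outer_mult_matrix: "outer u v ** M = outer u (transpose M *v v)"
  by (simp add: matrix_matrix_mult_def outer_def matrix_vector_mult_def transpose_def vec_eq_iff
      sum_distrib_left mult_ac)
lemma outer_mult_vector: "outer u v *v x = cdot v x *s u"
  by (simp add: outer_def matrix_vector_mult_def cdot_def vec_eq_iff sum_distrib_left mult_ac)
lemma outer_add: "outer (u + w) v = outer u v + outer w v" "outer u (v + w) = outer u v + outer u w"
  by (simp_all add: outer_def vec_eq_iff algebra_simps)
lemma outer_diff: "outer (u - w) v = outer u v - outer w v" "outer u (v - w) = outer u v - outer u w"
  by (simp_all add: outer_def vec_eq_iff algebra_simps)
lemma outer_minus: "outer (- u) v = - outer u v" "outer u (- v) = - outer u v"
  by (simp_all add: outer_def vec_eq_iff)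
lemma outer_scale: "outer (c *s u) v = mat c ** outer u v" "outer u (c *s v) = mat c ** outer u v"
  by (simp_all add: outer_def mat_scal vec_eq_iff)
lemma trace_outer: "trace (outer u v) = cdot u v"
  by (simp add: trace_def outer_def cdot_def)
lemma trace_mult_outer: "trace (M ** outer u v) = cdot v (M *v u)"
  by (simp add: matrix_mult_outer trace_outer cdot_commute)
lemma trace_mat_mult: "trace (mat c ** M) = c * trace M" for M :: "complex^'n^'n::finite"
  by (simp add: mat_scal trace_def sum_distrib_left)
lemma transpose_outer: "transpose (outer u v) = outer v u"
  by (simp add: transpose_def outer_def vec_eq_iff mult.commute)

lemmas matrix_distribs = matrix_add_ldistrib matrix_add_rdistrib matrix_diff_ldistrib
  matrix_diff_rdistrib matrix_minus_left matrix_minus_right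
lemmas matrix_vector_distribs = matrix_vector_mult_add_rdistrib matrix_vector_mult_diff_rdistrib
  matrix_vector_right_distrib matrix_vector_mult_diff_distrib matrix_vector_minus
lemmas cdot_distribs = cdot_add cdot_diff cdot_minus cdot_scale
lemmas cconj_distribs = cconj_add cconj_diff cconj_minus cconj_scale
lemmas hadj_distribs = hadj_mult hadj_add hadj_diff hadj_minus hadj_outer hadj_scaleR

section \<open>Derivatives of matrix-valued functions\<close>

lemma has_derivative_vec_lambda [derivative_intros]:
  fixes f :: "'i::finite \<Rightarrow> 'a::real_normed_vector \<Rightarrow> 'b::euclidean_space"
  assumes "\<And>i. (f i has_derivative f' i) (at x within S)"
  shows "((\<lambda>x. \<chi> i. f i x) has_derivative (\<lambda>h. \<chi> i. f' i h)) (at x within S)"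
  unfolding has_derivative_componentwise_within[of "\<lambda>x. \<chi> i. f i x"]
  by (auto simp: Basis_vec_def inner_axis intro!: has_derivative_inner_left assms)

lemma has_derivative_mat [derivative_intros]:
  fixes f :: "'a::real_normed_vector \<Rightarrow> complex"
  assumes "(f has_derivative f') (at x within S)"
  shows "((\<lambda>x. mat (f x) :: complex^'n^'n::finite) has_derivative (\<lambda>h. mat (f' h))) (at x within S)"
proof -
  have "((\<lambda>x. if i = j then f x else 0) has_derivative (\<lambda>h. if i = j then f' h else 0)) (at x within S)"
    for i j :: 'n using assms by (cases "i = j") auto
  thus ?thesis unfolding mat_def by (intro has_derivative_vec_lambda)
qed

lemma bilinear_imp_has_derivative:
  fixes B :: "'a::euclidean_space \<Rightarrow> 'b::euclidean_space \<Rightarrow> 'c::real_normed_vector"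
  assumes "bilinear B" "(f has_derivative f') (at x within S)" "(g has_derivative g') (at x within S)"
  shows "((\<lambda>x. B (f x) (g x)) has_derivative (\<lambda>h. B (f x) (g' h) + B (f' h) (g x))) (at x within S)"
proof -
  interpret bounded_bilinear B using assms(1) by (simp add: bilinear_conv_bounded_bilinear)
  show ?thesis by (rule FDERIV[OF assms(2,3)])
qed

lemma bilinear_matrix_mult: "bilinear (\<lambda>(A :: complex^'n^'n::finite) (B :: complex^'n^'n). A ** B)"
  by (auto simp: bilinear_def intro!: linearI matrix_distribs matrix_scaleR_left matrix_scaleR_right)

lemma scaleR_vec_scale: "r *\<^sub>R v = complex_of_real r *s v" for v :: "complex^'n"
  by (simp add: vec_eq_iff scaleR_conv_of_real[where 'a = complex])

lemma bilinear_matrix_vector_mult: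
  "bilinear (\<lambda>(A :: complex^'n^'n::finite) (x :: complex^'n). A *v x)"
  by (auto simp: bilinear_def vec_eq_iff matrix_vector_mult_def scaleR_sum_right algebra_simps sum.distrib
      intro!: linearI)

lemma bilinear_outer: "bilinear (outer :: complex^'n::finite \<Rightarrow> complex^'n \<Rightarrow> complex^'n^'n)"
  by (auto simp: bilinear_def outer_def vec_eq_iff algebra_simps intro!: linearI)

lemma bilinear_cdot: "bilinear (cdot :: complex^'n::finite \<Rightarrow> complex^'n \<Rightarrow> complex)"
  by (auto simp: bilinear_def cdot_def algebra_simps sum.distrib scaleR_sum_right intro!: linearI)

lemma linear_hadj: "linear (hadj :: complex^'n^'n::finite \<Rightarrow> complex^'n^'n)"
  by (auto intro!: linearI simp: hadj_add hadj_scaleR)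

lemma linear_cconj: "linear (cconj :: complex^'n::finite \<Rightarrow> complex^'n)"
  by (auto intro!: linearI simp: cconj_add) (simp add: cconj_def vec_eq_iff)

lemma linear_trace: "linear (trace :: complex^'n^'n::finite \<Rightarrow> complex)"
  by (auto intro!: linearI simp: trace_def sum.distrib scaleR_sum_right)

lemmas has_derivative_matrix_mult [derivative_intros] = bilinear_imp_has_derivative[OF bilinear_matrix_mult]
lemmas has_derivative_matrix_vector_mult [derivative_intros] = bilinear_imp_has_derivative[OF bilinear_matrix_vector_mult]
lemmas has_derivative_outer [derivative_intros] = bilinear_imp_has_derivative[OF bilinear_outer]
lemmas has_derivative_cdot [derivative_intros] = bilinear_imp_has_derivative[OF bilinear_cdot]
lemmas has_derivative_hadj [derivative_intros] =
  bounded_linear.has_derivative[OF linear_conv_bounded_linear[THEN iffD1, OF linear_hadj]]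
lemmas has_derivative_cconj [derivative_intros] =
  bounded_linear.has_derivative[OF linear_conv_bounded_linear[THEN iffD1, OF linear_cconj]]
text \<open>
  The derivative of the cofactor matrix by the product rule. The explicit formula shows that it
  depends continuously on \<open>N\<close>, also at singular matrices.
\<close>

definition cofactor_deriv :: "complex^'n^'n::finite \<Rightarrow> complex^'n^'n \<Rightarrow> complex^'n^'n" where
  "cofactor_deriv N X = (\<chi> b a. 1 / fact (CARD('n) - 1) *
     (\<Sum>f\<in>{f. f first_slot = a}. \<Sum>g\<in>{g. g first_slot = b}. levi_civita f * levi_civita g *
        (\<Sum>s\<in>UNIV - {first_slot}. X $ f s $ g s * (\<Prod>r\<in>UNIV - {first_slot} - {s}. N $ f r $ g r))))"

lemma has_derivative_nth [derivative_intros]: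
  "(f has_derivative f') F \<Longrightarrow> ((\<lambda>x. f x $ i) has_derivative (\<lambda>h. f' h $ i)) F"
  by (rule bounded_linear.has_derivative[OF bounded_linear_vec_nth])

lemma has_derivative_eps_cofactor_id: "(eps_cofactor has_derivative cofactor_deriv N) (at N)"
  for N :: "complex^'n^'n::finite"
proof -
  have "((\<lambda>N::complex^'n^'n. \<chi> b a. 1 / fact (CARD('n) - 1) *
     (\<Sum>f\<in>{f. f first_slot = a}. \<Sum>g\<in>{g. g first_slot = b}.
        levi_civita f * levi_civita g * (\<Prod>s\<in>UNIV - {first_slot}. N $ f s $ g s)))
      has_derivative cofactor_deriv N) (at N)"
    unfolding cofactor_deriv_def
    by (rule derivative_eq_intros has_derivative_vec_lambda | rule refl | simp)+
  thus ?thesis by (simp add: eps_cofactor_def[abs_def])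
qed

definition det_deriv :: "complex^'n^'n::finite \<Rightarrow> complex^'n^'n \<Rightarrow> complex" where
  "det_deriv N X = (\<Sum>p\<in>{p. p permutes UNIV}. of_int (sign p) *
     (\<Sum>s\<in>UNIV. X $ s $ p s * (\<Prod>r\<in>UNIV - {s}. N $ r $ p r)))"

lemma has_derivative_det_at: "(det has_derivative det_deriv N) (at N)"
  for N :: "complex^'n^'n::finite"
  unfolding det_def[abs_def] det_deriv_def
  by (rule derivative_eq_intros | rule refl | simp)+

lemma det_deriv_mat_1: "det_deriv (mat 1) X = trace X" for X :: "complex^'n^'n::finite"
proof -
  have z: "(\<Prod>r\<in>UNIV - {s}. (mat 1 :: complex^'n^'n) $ r $ p r) = (if p = id then 1 else 0)"
    if p: "p permutes UNIV" for p s
  proof (cases "p = id")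
    case False
    have "\<exists>r. r \<noteq> s \<and> p r \<noteq> r"
    proof (rule ccontr)
      assume "\<not> ?thesis"
      hence *: "\<And>r. r \<noteq> s \<Longrightarrow> p r = r" by auto
      have "p s = s" using * permutes_inj[OF p] by (metis inj_eq)
      with * False show False by (metis eq_id_iff)
    qed
    then obtain r where "r \<noteq> s" "p r \<noteq> r" by auto
    thus ?thesis using False by (auto simp: mat_def intro!: bexI[of _ r])
  qed (simp add: mat_def)
  have "det_deriv (mat 1) X = (\<Sum>p\<in>{p. p permutes UNIV}. of_int (sign p) *
     (\<Sum>s\<in>UNIV. X $ s $ p s * (if p = id then 1 else 0)))"
    unfolding det_deriv_def by (intro sum.cong refl arg_cong2[where f = "(*)"] z) auto
  also have "\<dots> = (\<Sum>p\<in>{id}. of_int (sign p) * (\<Sum>s\<in>UNIV. X $ s $ p s))"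
    by (intro sum.mono_neutral_cong_right) (auto simp: permutes_id)
  finally show ?thesis by (simp add: trace_def)
qed

text \<open>
  Jacobi's formula. Multiplicativity of the determinant moves an invertible \<open>N\<close> to the identity
  matrix, and both sides are continuous in \<open>N\<close>.
\<close>

lemma det_deriv_eq_trace: "det_deriv N X = trace (eps_cofactor N ** X)" for N X :: "complex^'n^'n::finite"
proof (rule eq_if_eq_on_invertible[where N = N])
  fix N :: "complex^'n^'n" assume d: "det N \<noteq> 0"
  let ?I = "mat (inverse (det N)) ** eps_cofactor N"
  have I: "?I ** N = mat 1" using d
    by (simp add: matrix_mul_assoc[symmetric] eps_cofactor_mult_matrix mat_mult_mat)
  hence I': "N ** ?I = mat 1" by (simp add: matrix_left_right_inverse)
  have "((\<lambda>M. det N * det (?I ** M)) has_derivative (\<lambda>X. det N * det_deriv (?I ** N) (?I ** X))) (at N)"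
    by (rule derivative_eq_intros refl has_derivative_compose[OF _ has_derivative_det_at] | simp)+
  moreover have "det N * det (?I ** M) = det M" for M
    using I' by (simp add: det_mul[symmetric] matrix_mul_assoc)
  ultimately have "(det has_derivative (\<lambda>X. det N * trace (?I ** X))) (at N)"
    by (simp add: I det_deriv_mat_1)
  hence "det_deriv N = (\<lambda>X. det N * trace (?I ** X))"
    using has_derivative_det_at has_derivative_unique by blast
  thus "det_deriv N X = trace (eps_cofactor N ** X)" using d
    by (simp add: trace_mat_mult flip: matrix_mul_assoc)
next
  show "continuous_on UNIV (\<lambda>N. det_deriv N X)" unfolding det_deriv_def by (intro continuous_intros)
  show "continuous_on UNIV (\<lambda>N. trace (eps_cofactor N ** X))" unfolding trace_def by (intro continuous_intros)
qed

lemma has_derivative_det [derivative_intros]: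
  fixes f :: "'a::real_normed_vector \<Rightarrow> complex^'n^'n::finite"
  assumes "(f has_derivative f') (at x within S)"
  shows "((\<lambda>x. det (f x)) has_derivative (\<lambda>h. trace (eps_cofactor (f x) ** f' h))) (at x within S)"
  using has_derivative_compose[OF assms has_derivative_det_at] by (simp add: det_deriv_eq_trace)

lemma has_derivative_eps_cofactor [derivative_intros]:
  fixes f :: "'a::real_normed_vector \<Rightarrow> complex^'n^'n::finite"
  assumes "(f has_derivative f') (at x within S)"
  shows "((\<lambda>x. eps_cofactor (f x)) has_derivative (\<lambda>h. cofactor_deriv (f x) (f' h))) (at x within S)"
  by (rule has_derivative_compose[OF assms has_derivative_eps_cofactor_id])

lemma continuous_on_cofactor_deriv [continuous_intros]:
  fixes f :: "'a::topological_space \<Rightarrow> complex^'n^'n::finite"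
  assumes "continuous_on S f" "continuous_on S g" shows "continuous_on S (\<lambda>x. cofactor_deriv (f x) (g x))"
  unfolding cofactor_deriv_def by (intro continuous_on_vec_lambda continuous_intros assms)

text \<open>
  The derivative of the identity \<open>N cof(N) = det N\<close>.
\<close>

lemma mult_cofactor_deriv: "N ** cofactor_deriv N X = mat (trace (eps_cofactor N ** X)) - X ** eps_cofactor N"
  for N :: "complex^'n^'n::finite"
proof -
  have "((\<lambda>N. N ** eps_cofactor N) has_derivative (\<lambda>X. N ** cofactor_deriv N X + X ** eps_cofactor N)) (at N)"
    by (rule derivative_eq_intros has_derivative_eps_cofactor_id refl)+
  moreover have "((\<lambda>N. mat (det N)) has_derivative (\<lambda>X. mat (trace (eps_cofactor N ** X)))) (at N)"
    by (intro has_derivative_mat has_derivative_det[of "\<lambda>N. N" "\<lambda>X. X", simplified])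
  ultimately have "(\<lambda>X. N ** cofactor_deriv N X + X ** eps_cofactor N) = (\<lambda>X. mat (trace (eps_cofactor N ** X)))"
    unfolding matrix_mult_eps_cofactor by (rule has_derivative_unique)
  from fun_cong[OF this, of X] show ?thesis by (simp add: algebra_simps)
qed

lemma det_mult_cofactor_deriv:
  fixes N :: "complex^'n^'n::finite"
  shows "mat (det N) ** cofactor_deriv N X = mat (trace (eps_cofactor N ** X)) ** eps_cofactor N
      - eps_cofactor N ** X ** eps_cofactor N"
proof -
  have "mat (det N) ** cofactor_deriv N X = eps_cofactor N ** (N ** cofactor_deriv N X)"
    by (simp add: matrix_mul_assoc eps_cofactor_mult_matrix)
  also have "\<dots> = eps_cofactor N ** mat (trace (eps_cofactor N ** X)) - eps_cofactor N ** X ** eps_cofactor N"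
    by (simp add: mult_cofactor_deriv matrix_diff_ldistrib matrix_mul_assoc)
  finally show ?thesis by (simp only: mat_commute[of "eps_cofactor N"])
qed

section \<open>Symmetry of second derivatives\<close>

text \<open>
  The mean value theorem in the direction \<open>v\<close> turns the second difference into a difference of first
  derivatives at two points near \<open>x\<close>, which is evaluated by differentiability of the derivative at \<open>x\<close>
  alone.
\<close>

lemma second_difference_quotient:
  fixes f :: "'a::real_normed_vector \<Rightarrow> real"
  assumes S: "open S" "x \<in> S" and f: "\<And>y. y \<in> S \<Longrightarrow> (f has_derivative F y) (at y)"
    and D: "((\<lambda>y. F y v) has_derivative D) (at x)"
  shows "((\<lambda>t. (f (x + t *\<^sub>R v + t *\<^sub>R w) - f (x + t *\<^sub>R v) - f (x + t *\<^sub>R w) + f x) / t\<^sup>2)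
    \<longlongrightarrow> D w) (at_right 0)"
proof (rule tendstoI)
  fix e :: real assume e: "e > 0"
  define k where "k = norm v + norm w + 1"
  have k: "k > 0" by (simp add: k_def add_nonneg_pos)
  obtain r where r: "r > 0" "ball x r \<subseteq> S" using S openE by blast
  have lin: "linear D" using D by (rule has_derivative_linear)
  have "e / (4 * k) > 0" using e k by simp
  with D obtain d where d: "d > 0" "\<And>y. norm (y - x) < d \<Longrightarrow>
      norm (F y v - F x v - D (y - x)) \<le> e / (4 * k) * norm (y - x)"
    unfolding has_derivative_at_alt by meson
  define \<delta> where "\<delta> = min r d / k"
  have \<delta>: "\<delta> > 0" using r d k by (simp add: \<delta>_def)
  have "dist ((f (x + t *\<^sub>R v + t *\<^sub>R w) - f (x + t *\<^sub>R v) - f (x + t *\<^sub>R w) + f x) / t\<^sup>2) (D w) < e"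
    if t: "0 < t" "t < \<delta>" for t
  proof -
    have tk: "t * k < r" "t * k < d"
      using t k by (simp_all add: \<delta>_def field_simps min_def split: if_splits)
    have near: "norm (s *\<^sub>R v + u *\<^sub>R w) \<le> t * k" if "0 \<le> s" "s \<le> t" "0 \<le> u" "u \<le> t" for s u
    proof -
      have "norm (s *\<^sub>R v + u *\<^sub>R w) \<le> s * norm v + u * norm w"
        using norm_triangle_ineq[of "s *\<^sub>R v" "u *\<^sub>R w"] that by simp
      also have "\<dots> \<le> t * norm v + t * norm w"
        using that by (intro add_mono mult_right_mono) auto
      also have "\<dots> \<le> t * k" using t by (simp add: k_def algebra_simps)
      finally show ?thesis .
    qed
    have dist_add: "dist y (y + z) = norm z" for y z :: 'a
      using dist_norm[of "y + z" y] by (simp add: dist_commute)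
    have inS: "x + (s *\<^sub>R v + u *\<^sub>R w) \<in> S" if "0 \<le> s" "s \<le> t" "0 \<le> u" "u \<le> t" for s u
    proof -
      have "norm (s *\<^sub>R v + u *\<^sub>R w) < r" using near[OF that] tk by simp
      hence "x + (s *\<^sub>R v + u *\<^sub>R w) \<in> ball x r"
        using dist_add[of x] by simp
      thus ?thesis using r by blast
    qed
    \<comment> \<open>\<open>\<phi> t - \<phi> 0\<close> is the second difference.\<close>
    define \<phi> where "\<phi> s = f (x + (s *\<^sub>R v + t *\<^sub>R w)) - f (x + (s *\<^sub>R v + 0 *\<^sub>R w))" for s
    have path: "((\<lambda>s. f (x + (s *\<^sub>R v + u *\<^sub>R w))) has_derivative (\<lambda>h. F (x + (s *\<^sub>R v + u *\<^sub>R w)) (h *\<^sub>R v))) (at s)"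
      if "0 \<le> s" "s \<le> t" "0 \<le> u" "u \<le> t" for s u
    proof -
      have "((\<lambda>s. x + (s *\<^sub>R v + u *\<^sub>R w)) has_derivative (\<lambda>h. h *\<^sub>R v)) (at s)"
        by (auto intro!: derivative_eq_intros)
      from has_derivative_compose[OF this f[OF inS[OF that]]] show ?thesis .
    qed
    have d\<phi>: "(\<phi> has_derivative (\<lambda>h. F (x + (s *\<^sub>R v + t *\<^sub>R w)) (h *\<^sub>R v) - F (x + (s *\<^sub>R v + 0 *\<^sub>R w)) (h *\<^sub>R v))) (at s)"
      if "0 \<le> s" "s \<le> t" for s
      unfolding \<phi>_def using path[of s t] path[of s 0] that t by (intro has_derivative_diff) auto
    then obtain s where s: "0 < s" "s < t" "\<phi> t - \<phi> 0 =
        F (x + (s *\<^sub>R v + t *\<^sub>R w)) ((t - 0) *\<^sub>R v) - F (x + (s *\<^sub>R v + 0 *\<^sub>R w)) ((t - 0) *\<^sub>R v)"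
      using mvt_simple[of 0 t \<phi>, OF t(1) has_derivative_at_withinI[OF d\<phi>]] by auto
    let ?p = "s *\<^sub>R v + t *\<^sub>R w" and ?q = "s *\<^sub>R v + 0 *\<^sub>R w"
    have sc: "F y (t *\<^sub>R v) = t * F y v" if "y \<in> S" for y
      using linear_cmul[OF has_derivative_linear[OF f[OF that]]] by simp
    have \<phi>t: "\<phi> t - \<phi> 0 = t * (F (x + ?p) v - F (x + ?q) v)"
      using s t sc[OF inS, of s t] sc[OF inS, of s 0] by (simp add: algebra_simps)
    have b: "norm (F (x + y) v - F x v - D y) \<le> e / 4 * t" if y: "norm y \<le> t * k" for y
    proof -
      have "norm (F (x + y) v - F x v - D y) \<le> e / (4 * k) * norm y" using d(2)[of "x + y"] y tk by simp
      also have "\<dots> \<le> e / (4 * k) * (t * k)" using e k y by (intro mult_left_mono) auto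
      finally show ?thesis using k by simp
    qed
    have "D ?p - D ?q = t * D w" using lin by (simp add: linear_add linear_cmul)
    hence "\<bar>(F (x + ?p) v - F (x + ?q) v) - t * D w\<bar> \<le> e / 4 * t + e / 4 * t"
      using b[OF near[of s t]] b[OF near[of s 0]] s t
      unfolding real_norm_def abs_le_iff by linarith
    hence "\<bar>(F (x + ?p) v - F (x + ?q) v) - t * D w\<bar> < e * t" using mult_pos_pos[OF e t(1)] by linarith
    hence "\<bar>((F (x + ?p) v - F (x + ?q) v) - t * D w) / t\<bar> < e"
      using t by (simp add: field_simps)
    moreover have "(f (x + t *\<^sub>R v + t *\<^sub>R w) - f (x + t *\<^sub>R v) - f (x + t *\<^sub>R w) + f x) / t\<^sup>2 - D w
       = ((F (x + ?p) v - F (x + ?q) v) - t * D w) / t"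
    proof -
      have num: "f (x + t *\<^sub>R v + t *\<^sub>R w) - f (x + t *\<^sub>R v) - f (x + t *\<^sub>R w) + f x = t * (F (x + ?p) v - F (x + ?q) v)"
        unfolding \<phi>t[symmetric] by (simp add: \<phi>_def add.assoc)
      have "t * K / t\<^sup>2 - D w = (K - t * D w) / t" for K
        using t by (simp add: field_simps power2_eq_square)
      thus ?thesis unfolding num .
    qed
    ultimately show ?thesis by (simp add: dist_real_def)
  qed
  thus "\<forall>\<^sub>F t in at_right 0. dist ((f (x + t *\<^sub>R v + t *\<^sub>R w) - f (x + t *\<^sub>R v) - f (x + t *\<^sub>R w) + f x) / t\<^sup>2) (D w) < e"
    using \<delta> eventually_at_right[of 0 1] by (auto simp: eventually_at_right intro!: exI[of _ \<delta>])
qed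

text \<open>
  The second difference quotient is symmetric in the two directions.
\<close>

lemma second_derivative_symmetric:
  fixes f :: "'a::real_normed_vector \<Rightarrow> 'b::euclidean_space"
  assumes S: "open S" "x \<in> S" and f: "\<And>y. y \<in> S \<Longrightarrow> (f has_derivative F y) (at y)"
    and Dv: "((\<lambda>y. F y v) has_derivative Dv) (at x)"
    and Dw: "((\<lambda>y. F y w) has_derivative Dw) (at x)"
  shows "Dv w = Dw v"
proof (rule euclidean_eqI)
  fix b :: 'b
  let ?f = "\<lambda>y. f y \<bullet> b"
  have f': "(?f has_derivative (\<lambda>h. F y h \<bullet> b)) (at y)" if "y \<in> S" for y
    by (intro has_derivative_inner_left f that)
  have "((\<lambda>t. (?f (x + t *\<^sub>R v + t *\<^sub>R w) - ?f (x + t *\<^sub>R v) - ?f (x + t *\<^sub>R w) + ?f x) / t\<^sup>2)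
    \<longlongrightarrow> Dv w \<bullet> b) (at_right 0)"
    by (rule second_difference_quotient[OF S f' has_derivative_inner_left[OF Dv]])
  moreover have "((\<lambda>t. (?f (x + t *\<^sub>R w + t *\<^sub>R v) - ?f (x + t *\<^sub>R w) - ?f (x + t *\<^sub>R v) + ?f x) / t\<^sup>2)
    \<longlongrightarrow> Dw v \<bullet> b) (at_right 0)"
    by (rule second_difference_quotient[OF S f' has_derivative_inner_left[OF Dw]])
  moreover have "?f (x + t *\<^sub>R v + t *\<^sub>R w) - ?f (x + t *\<^sub>R v) - ?f (x + t *\<^sub>R w)
     = ?f (x + t *\<^sub>R w + t *\<^sub>R v) - ?f (x + t *\<^sub>R w) - ?f (x + t *\<^sub>R v)" for t
    by (simp add: add_ac)
  ultimately show "Dv w \<bullet> b = Dw v \<bullet> b"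
    by (simp add: tendsto_unique[OF trivial_limit_at_right_real])
qed

section \<open>Complex types\<close>

text \<open>
  Multiplication of the arguments by \<open>\<i>\<close> acts on the four summands by four different pairs of signs,
  so a sum of terms of types \<open>(2,0)\<close>, \<open>(0,2)\<close> and of the two mixed types vanishes only if each of them
  does.
\<close>

lemma type_decomposition:
  fixes a b c d :: "complex^'n \<Rightarrow> complex^'n \<Rightarrow> complex^'m^'k"
  assumes "\<And>w v. a w v + b w v + c w v + d w v = 0"
    and a: "\<And>w v. a (\<i> *s w) v = mat \<i> ** a w v" "\<And>w v. a w (\<i> *s v) = mat \<i> ** a w v"
    and b: "\<And>w v. b (\<i> *s w) v = - (mat \<i> ** b w v)" "\<And>w v. b w (\<i> *s v) = - (mat \<i> ** b w v)"
    and c: "\<And>w v. c (\<i> *s w) v = - (mat \<i> ** c w v)" "\<And>w v. c w (\<i> *s v) = mat \<i> ** c w v"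
    and d: "\<And>w v. d (\<i> *s w) v = mat \<i> ** d w v" "\<And>w v. d w (\<i> *s v) = - (mat \<i> ** d w v)"
  shows "a w v = 0" "c w v = 0"
proof -
  have m: "(mat \<i> ** X) $ i $ j = \<i> * X $ i $ j" for X :: "complex^'m^'k" and i j
    by (simp add: matrix_matrix_mult_def mat_def mult_delta_left)
  have e: "a w v $ i $ j + b w v $ i $ j + c w v $ i $ j + d w v $ i $ j = 0" for w v i j
    using arg_cong[OF assms(1), of "\<lambda>X. X $ i $ j"] by simp
  have "a w v $ i $ j = 0 \<and> c w v $ i $ j = 0" for i j
  proof -
    define p q r s where pq: "p = a w v $ i $ j" "q = b w v $ i $ j" "r = c w v $ i $ j" "s = d w v $ i $ j"
    have 1: "p + q + r + s = 0" using e[of w v i j] by (simp add: pq)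
    have 2: "\<i> * p - \<i> * q - \<i> * r + \<i> * s = 0"
      using e[of "\<i> *s w" v i j] by (simp add: pq a b c d m)
    have 3: "\<i> * p - \<i> * q + \<i> * r - \<i> * s = 0"
      using e[of w "\<i> *s v" i j] by (simp add: pq a b c d m)
    have 4: "- p - q + r + s = 0"
      using e[of "\<i> *s w" "\<i> *s v" i j] by (simp add: pq a b c d m matrix_minus_right flip: mult.assoc)
    have "\<i> * (p - q - r + s) = 0" "\<i> * (p - q + r - s) = 0" using 2 3 by (simp_all add: algebra_simps)
    hence 2: "p - q - r + s = 0" and 3: "p - q + r - s = 0" by simp_all
    have "4 * p = (p + q + r + s) + (p - q - r + s) + (p - q + r - s) - (- p - q + r + s)" by simp
    hence "p = 0" unfolding 1 2 3 4 by simp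
    moreover have "4 * r = (p + q + r + s) - (p - q - r + s) + (p - q + r - s) + (- p - q + r + s)" by simp
    hence "r = 0" unfolding 1 2 3 4 by simp
    ultimately show ?thesis by (simp add: pq)
  qed
  thus "a w v = 0" "c w v = 0" by (simp_all add: vec_eq_iff)
qed

lemma complex_linear_matrix:
  fixes F :: "complex^'n::finite \<Rightarrow> complex^'m"
  assumes "linear F" "\<And>v. F (\<i> *s v) = \<i> *s F v"
  shows "F (c *s v) = c *s F v" "F v = matrix F *v v"
proof -
  interpret linear F by fact
  show sc: "F (c *s v) = c *s F v" for c v
  proof -
    have "c *s v = Re c *\<^sub>R v + Im c *\<^sub>R (\<i> *s v)"
      by (simp add: vec_eq_iff complex_eq_iff)
    hence "F (c *s v) = Re c *\<^sub>R F v + Im c *\<^sub>R (\<i> *s F v)"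
      by (simp add: add scale assms(2))
    also have "\<dots> = c *s F v" by (simp add: vec_eq_iff complex_eq_iff)
    finally show ?thesis .
  qed
  have "Vector_Spaces.linear (*s) (*s) F"
    by unfold_locales (simp_all add: add sc vec_eq_iff algebra_simps)
  thus "F v = matrix F *v v" by (simp add: matrix_works)
qed

section \<open>Inverse matrices\<close>

lemma matrix_inv_cofactor:
  fixes N :: "complex^'n^'n::finite"
  assumes "det N \<noteq> 0"
  shows "matrix_inv N = mat (inverse (det N)) ** eps_cofactor N"
    and "N ** matrix_inv N = mat 1" and "matrix_inv N ** N = mat 1"
proof -
  have "\<exists>X. N ** X = mat 1 \<and> X ** N = mat 1"
    using assms by (simp add: invertible_det_nz[symmetric] invertible_def)
  hence *: "N ** matrix_inv N = mat 1 \<and> matrix_inv N ** N = mat 1"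
    unfolding matrix_inv_def by (rule someI_ex)
  thus "N ** matrix_inv N = mat 1" "matrix_inv N ** N = mat 1" by auto
  have "mat (inverse (det N)) ** eps_cofactor N = mat (inverse (det N)) ** eps_cofactor N ** (N ** matrix_inv N)"
    using * by simp
  also have "\<dots> = mat (inverse (det N)) ** (eps_cofactor N ** N) ** matrix_inv N"
    by (simp add: matrix_mul_assoc)
  finally show "matrix_inv N = mat (inverse (det N)) ** eps_cofactor N"
    using assms by (simp add: eps_cofactor_mult_matrix mat_mult_mat)
qed

lemma mat_pull: "X ** (mat c ** Y) = mat c ** (X ** Y)" for X :: "complex^'n^'n::finite"
  by (simp only: matrix_mul_assoc mat_commute[of X])

lemma mat_minus: "mat (- c) ** X = - (mat c ** X)" for X :: "complex^'n^'n::finite"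
  by (simp add: mat_scal vec_eq_iff)

lemma hadj_mat_mult: "hadj (mat c ** X) = mat (cnj c) ** hadj X" for X :: "complex^'n^'n::finite"
  by (simp add: mat_scal hadj_def vec_eq_iff)

lemma transpose_add: "transpose (M + N) = transpose M + transpose N"
  by (simp add: transpose_def vec_eq_iff)
lemma transpose_mat_mult: "transpose (mat c ** X) = mat c ** transpose X" for X :: "complex^'n^'n::finite"
  by (simp add: mat_scal transpose_def vec_eq_iff)

lemma hadj_vector_cconj: "hadj M *v cconj v = cconj (transpose M *v v)"
  by (simp add: cconj_matrix hadj_def transpose_def)

lemma scaleR_matrix_vector: "(r *\<^sub>R M) *v x = r *\<^sub>R (M *v x)" for M :: "complex^'n^'m"
  by (simp add: matrix_vector_mult_def vec_eq_iff scaleR_sum_right)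

lemma outer_0 [simp]: "outer 0 v = 0" "outer u 0 = 0" by (simp_all add: outer_def vec_eq_iff)

lemma mat_i_i: "mat \<i> ** (mat \<i> ** X) = - X" for X :: "complex^'n^'n::finite"
  by (simp add: mat_scal vec_eq_iff)

lemma vec_scale_distribs: "c *s (u - v) = c *s u - c *s v" "c *s (- u) = - (c *s u)"
  for u :: "complex^'n"
  by (simp_all add: vec_eq_iff algebra_simps)

lemma eq_0_if_card_mult_eq:
  assumes "of_nat CARD('n::finite) * z = (z::complex)" "CARD('n) \<ge> 2" shows "z = 0"
proof -
  have "(of_nat CARD('n) - 1) * z = 0" using assms(1) by (simp add: algebra_simps)
  moreover have "of_nat CARD('n) \<noteq> (1::complex)" using assms(2) by (metis of_nat_eq_1_iff numeral_le_one_iff semiring_norm(69))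
  ultimately show ?thesis by simp
qed

lemma matrix_inv_herm:
  fixes N :: "complex^'n^'n::finite"
  assumes "hadj N = N" "det N \<noteq> 0" shows "hadj (matrix_inv N) = matrix_inv N"
proof -
  have "hadj (matrix_inv N) ** N = mat 1"
    using arg_cong[OF matrix_inv_cofactor(2)[OF assms(2)], of hadj] by (simp add: hadj_mult assms(1) hadj_mat)
  hence "hadj (matrix_inv N) ** N ** matrix_inv N = matrix_inv N" by simp
  thus ?thesis by (simp add: matrix_mul_assoc[symmetric] matrix_inv_cofactor(2)[OF assms(2)])
qed

lemma has_derivative_matrix_inv:
  fixes f :: "'a::real_normed_vector \<Rightarrow> complex^'n^'n::finite"
  assumes f: "(f has_derivative f') (at x)" and S: "open S" "x \<in> S" and inv: "\<And>y. y \<in> S \<Longrightarrow> det (f y) \<noteq> 0"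
  shows "((\<lambda>y. matrix_inv (f y)) has_derivative (\<lambda>v. - (matrix_inv (f x) ** f' v ** matrix_inv (f x)))) (at x)"
proof -
  note inv_deriv = Deriv.has_derivative_inverse[OF inv[OF S(2)] has_derivative_det[OF f]]
  have "\<exists>D. ((\<lambda>y. mat (inverse (det (f y))) ** eps_cofactor (f y)) has_derivative D) (at x)"
    using has_derivative_matrix_mult[OF has_derivative_mat[OF inv_deriv] has_derivative_eps_cofactor[OF f]] by blast
  then obtain D where "((\<lambda>y. mat (inverse (det (f y))) ** eps_cofactor (f y)) has_derivative D) (at x)" ..
  hence D: "((\<lambda>y. matrix_inv (f y)) has_derivative D) (at x)"
    by (rule has_derivative_transform_within_open[OF _ S]) (simp add: matrix_inv_cofactor inv)
  have "((\<lambda>y. f y ** matrix_inv (f y)) has_derivative (\<lambda>w. f x ** D w + f' w ** matrix_inv (f x))) (at x)"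
    by (intro has_derivative_matrix_mult f D)
  moreover have "((\<lambda>y. f y ** matrix_inv (f y)) has_derivative (\<lambda>w. 0)) (at x)"
    by (rule has_derivative_transform_within_open[OF has_derivative_const[of "mat 1"] S])
      (simp add: matrix_inv_cofactor(2) inv)
  ultimately have e: "f x ** D w + f' w ** matrix_inv (f x) = 0" for w
    using has_derivative_unique by (metis (no_types, lifting))
  have "D w = - (matrix_inv (f x) ** f' w ** matrix_inv (f x))" for w
  proof -
    have "D w = matrix_inv (f x) ** (f x ** D w + f' w ** matrix_inv (f x)) - matrix_inv (f x) ** f' w ** matrix_inv (f x)"
      by (simp add: matrix_add_ldistrib matrix_mul_assoc matrix_inv_cofactor(3)[OF inv[OF S(2)]])
    thus ?thesis unfolding e by simp
  qed
  with D show ?thesis using ext[of D] by metis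
qed

section \<open>A pencil in a chart\<close>

text \<open>
  The pencil in a chart, after \<open>\<eta>\<close> has been made parallel. \<open>g\<close> is the inverse metric,
  \<open>G x v\<close> is the transpose of the endomorphism \<open>w \<mapsto> \<Gamma>(v,w)\<close>, so \<open>G_sym\<close> expresses that the torsion vanishes,
  and \<open>g_deriv\<close> that \<open>g\<close> is parallel. \<open>A_deriv\<close> is the metrisability equation for \<open>A\<close>.
\<close>

locale local_pencil =
  fixes S :: "(complex^'n::finite) set"
    and g A :: "complex^'n \<Rightarrow> complex^'n^'n"
    and G :: "complex^'n \<Rightarrow> complex^'n \<Rightarrow> complex^'n^'n"
    and Lam :: "complex^'n \<Rightarrow> complex^'n"
  assumes dim: "CARD('n) \<ge> 2"
    and open_S: "open S"
    and g_herm: "\<And>x. x \<in> S \<Longrightarrow> hadj (g x) = g x"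
    and A_selfadj: "\<And>x. x \<in> S \<Longrightarrow> hadj (A x) ** g x = g x ** A x"
    and g_det: "\<And>x. x \<in> S \<Longrightarrow> det (g x) \<noteq> 0"
    and G_scale: "\<And>x c v. x \<in> S \<Longrightarrow> G x (c *s v) = mat c ** G x v"
    and G_add: "\<And>x v w. x \<in> S \<Longrightarrow> G x (v + w) = G x v + G x w"
    and G_sym: "\<And>x v w. x \<in> S \<Longrightarrow> transpose (G x v) *v w = transpose (G x w) *v v"
    and G_diff: "\<And>x v. x \<in> S \<Longrightarrow> (\<lambda>y. G y v) differentiable (at x)"
    and Lam_diff: "\<And>x. x \<in> S \<Longrightarrow> Lam differentiable (at x)"
    and g_deriv: "\<And>x. x \<in> S \<Longrightarrow>
       (g has_derivative (\<lambda>v. - (g x ** G x v) - hadj (G x v) ** g x)) (at x)"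
    and A_deriv: "\<And>x. x \<in> S \<Longrightarrow>
       (A has_derivative (\<lambda>v. G x v ** A x - A x ** G x v - outer (Lam x) v
          - outer (matrix_inv (g x) *v cconj v) (cconj (g x *v Lam x)))) (at x)"
begin

abbreviation h :: "complex^'n \<Rightarrow> complex^'n^'n" where "h x \<equiv> matrix_inv (g x)"

lemma gh: "x \<in> S \<Longrightarrow> g x ** h x = mat 1" and hg: "x \<in> S \<Longrightarrow> h x ** g x = mat 1"
  using matrix_inv_cofactor(2,3)[OF g_det] by auto

lemma hg_left: "x \<in> S \<Longrightarrow> h x ** (g x ** X) = X"
  by (simp add: matrix_mul_assoc hg)

lemma h_herm: "x \<in> S \<Longrightarrow> hadj (h x) = h x"
  by (rule matrix_inv_herm[OF g_herm g_det])

lemma A_h: assumes x: "x \<in> S" shows "A x ** h x = h x ** hadj (A x)"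
proof -
  have "h x ** hadj (A x) = h x ** (hadj (A x) ** g x) ** h x"
    by (simp add: matrix_mul_assoc[symmetric] gh[OF x])
  also have "\<dots> = A x ** h x" by (simp add: A_selfadj[OF x] hg_left[OF x])
  finally show ?thesis by simp
qed

lemma h_deriv:
  assumes x: "x \<in> S"
  shows "(h has_derivative (\<lambda>w. G x w ** h x + h x ** hadj (G x w))) (at x)"
  by (rule has_derivative_eq_rhs[OF has_derivative_matrix_inv[OF g_deriv[OF x] open_S x g_det]])
    (simp_all add: fun_eq_iff matrix_distribs matrix_mul_assoc[symmetric] hg_left[OF x] gh[OF x])

definition dG :: "complex^'n \<Rightarrow> complex^'n \<Rightarrow> complex^'n \<Rightarrow> complex^'n^'n" where
  "dG x v = frechet_derivative (\<lambda>y. G y v) (at x)"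

definition dLam :: "complex^'n \<Rightarrow> complex^'n \<Rightarrow> complex^'n" where
  "dLam x = frechet_derivative Lam (at x)"

lemma dG: "x \<in> S \<Longrightarrow> ((\<lambda>y. G y v) has_derivative dG x v) (at x)"
  unfolding dG_def using G_diff frechet_derivative_works by blast

lemma dLam: "x \<in> S \<Longrightarrow> (Lam has_derivative dLam x) (at x)"
  unfolding dLam_def using Lam_diff frechet_derivative_works by blast

lemma dG_linear: "x \<in> S \<Longrightarrow> linear (dG x v)"
  using dG has_derivative_linear by blast

lemma dG_scale: assumes x: "x \<in> S" shows "dG x (c *s v) w = mat c ** dG x v w"
proof -
  have "((\<lambda>y. mat c ** G y v) has_derivative (\<lambda>w. mat c ** dG x v w)) (at x)"
    using has_derivative_matrix_mult[OF has_derivative_const dG[OF x, of v], of "mat c"] by simp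
  hence "((\<lambda>y. G y (c *s v)) has_derivative (\<lambda>w. mat c ** dG x v w)) (at x)"
    by (rule has_derivative_transform_within_open[OF _ open_S x]) (simp add: G_scale)
  thus ?thesis using dG[OF x, of "c *s v"] has_derivative_unique by metis
qed

lemma dG_sym:
  assumes x: "x \<in> S"
  shows "transpose (dG x v w) *v u = transpose (dG x u w) *v v"
proof -
  have *: "((\<lambda>y. cdot e (transpose (G y v) *v u)) has_derivative (\<lambda>w. cdot (dG x v w *v e) u)) (at x)" for v u e
  proof -
    have "((\<lambda>y. cdot (G y v *v e) u) has_derivative (\<lambda>w. cdot (dG x v w *v e) u)) (at x)"
      by (rule derivative_eq_intros dG[OF x] refl)+ (simp add: cdot_def)
    thus ?thesis by (simp add: cdot_matrix)
  qed
  have "cdot e (transpose (dG x v w) *v u) = cdot e (transpose (dG x u w) *v v)" for e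
  proof -
    have "((\<lambda>y. cdot e (transpose (G y u) *v v)) has_derivative (\<lambda>w. cdot (dG x v w *v e) u)) (at x)"
      by (rule has_derivative_transform_within_open[OF *[of e v u] open_S x]) (simp add: G_sym)
    from has_derivative_unique[OF this *[of e u v]] show ?thesis by (metis cdot_matrix transpose_transpose)
  qed
  hence "cdot e (transpose (dG x v w) *v u - transpose (dG x u w) *v v) = 0" for e
    by (simp add: cdot_diff)
  hence "transpose (dG x v w) *v u - transpose (dG x u w) *v v = 0" by (rule cdot_eq_0D)
  thus ?thesis by simp
qed

text \<open>
  The parts of the derivative of \<open>G\<close> that are complex linear and complex antilinear in the direction of
  differentiation; in the argument of \<open>G\<close> both are complex linear.
\<close>

definition dG10 :: "complex^'n \<Rightarrow> complex^'n \<Rightarrow> complex^'n \<Rightarrow> complex^'n^'n" where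
  "dG10 x v w = (1/2) *\<^sub>R (dG x v w - mat \<i> ** dG x v (\<i> *s w))"
definition dG01 :: "complex^'n \<Rightarrow> complex^'n \<Rightarrow> complex^'n \<Rightarrow> complex^'n^'n" where
  "dG01 x v w = (1/2) *\<^sub>R (dG x v w + mat \<i> ** dG x v (\<i> *s w))"

lemma dG_split: "dG x v w = dG10 x v w + dG01 x v w"
  by (simp add: dG10_def dG01_def scaleR_add_right scaleR_diff_right flip: scaleR_left_distrib)

lemma half_i: "mat \<i> ** ((1/2) *\<^sub>R X) = (1/2) *\<^sub>R (mat \<i> ** X)" for X :: "complex^'n^'n"
  by (rule matrix_scaleR_right)

lemma dG_types_hom:
  assumes x: "x \<in> S"
  shows "dG10 x (\<i> *s v) w = mat \<i> ** dG10 x v w" "dG10 x v (\<i> *s w) = mat \<i> ** dG10 x v w"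
    "dG01 x (\<i> *s v) w = mat \<i> ** dG01 x v w" "dG01 x v (\<i> *s w) = - (mat \<i> ** dG01 x v w)"
  using linear_neg[OF dG_linear[OF x]]
  by (simp_all add: dG10_def dG01_def dG_scale[OF x] half_i matrix_distribs mat_i_i algebra_simps)

lemma dG01_sym: "x \<in> S \<Longrightarrow> transpose (dG01 x v w) *v u = transpose (dG01 x u w) *v v"
  using dG_sym[of x v w u] dG_sym[of x v "\<i> *s w" u]
  by (simp add: dG01_def transpose_scalar transpose_add transpose_mat_mult matrix_vector_mult_add_rdistrib
     matrix_vector_mul_assoc[symmetric] scaleR_matrix_vector)

text \<open>
  The curvature of the connection, up to sign and transposition.
\<close>

definition curv where "curv x v w = dG x v w - G x w ** G x v - (dG x w v - G x v ** G x w)"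

lemma hadj_G_sym: "x \<in> S \<Longrightarrow> hadj (G x v) *v cconj w = hadj (G x w) *v cconj v"
  by (simp add: hadj_vector_cconj G_sym)

text \<open>
  The antisymmetric part of the second derivative of the parallel tensor \<open>g\<close>: curvature
  preserves the metric.
\<close>

lemma curv_g:
  assumes x: "x \<in> S"
  shows "g x ** curv x v w + hadj (curv x v w) ** g x = 0"
proof -
  let ?g' = "\<lambda>v. - (g x ** G x v) - hadj (G x v) ** g x"
  define E where "E v w = - (g x ** dG x v w + ?g' w ** G x v) - (hadj (G x v) ** ?g' w + hadj (dG x v w) ** g x)"
    for v w
  have E: "((\<lambda>y. - (g y ** G y v) - hadj (G y v) ** g y) has_derivative E v) (at x)" for v
    unfolding E_def by (intro derivative_intros g_deriv dG x)
  have "E v w = E w v"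
    by (rule second_derivative_symmetric[OF open_S x g_deriv E E])
  moreover have "g x ** curv x v w + hadj (curv x v w) ** g x = E w v - E v w"
    by (simp add: E_def curv_def matrix_distribs hadj_distribs matrix_mul_assoc algebra_simps)
  ultimately show ?thesis by simp
qed

text \<open>
  The part of the curvature of type \<open>(2,0)\<close> is, by the preceding lemma, minus the adjoint of the part
  of type \<open>(0,2)\<close>, and there is no part of type \<open>(0,2)\<close> because \<open>G\<close> is complex linear in its argument.
\<close>

lemma curv_eq: assumes x: "x \<in> S" shows "curv x v w = dG01 x v w - dG01 x w v"
  and dG01_g: "g x ** dG01 x v w = hadj (dG01 x w v) ** g x"
proof -
  \<comment> \<open>\<open>Q\<close> is the part of type \<open>(2,0)\<close> of the curvature.\<close>
  define Q where "Q w v = dG10 x v w - G x w ** G x v - dG10 x w v + G x v ** G x w" for w v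
  let ?a = "\<lambda>w v. g x ** Q w v"
  let ?b = "\<lambda>w v. hadj (Q w v) ** g x"
  let ?c = "\<lambda>w v. g x ** dG01 x v w - hadj (dG01 x w v) ** g x"
  let ?d = "\<lambda>w v. hadj (dG01 x v w) ** g x - g x ** dG01 x w v"
  have T: "curv x v w = Q w v + dG01 x v w - dG01 x w v" for v w
    by (simp add: curv_def Q_def dG_split)
  have Q: "Q (\<i> *s w) v = mat \<i> ** Q w v" "Q w (\<i> *s v) = mat \<i> ** Q w v" for w v
    by (simp_all add: Q_def dG_types_hom[OF x] G_scale[OF x] matrix_distribs mat_pull flip: matrix_mul_assoc)
  have sum: "?a w v + ?b w v + ?c w v + ?d w v = 0" for w v
    using curv_g[OF x, of v w] by (simp add: T matrix_distribs hadj_distribs algebra_simps)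
  note hom = Q dG_types_hom[OF x] hadj_mat_mult mat_pull mat_minus matrix_distribs hadj_minus
  have a: "?a w v = 0" and c: "?c w v = 0" for w v
    by (rule type_decomposition[where a = ?a and b = ?b and c = ?c and d = ?d], rule sum;
        simp add: hom flip: matrix_mul_assoc)+
  have "Q w v = h x ** ?a w v" by (simp add: hg_left[OF x])
  thus "curv x v w = dG01 x v w - dG01 x w v" using a T by simp
  show "g x ** dG01 x v w = hadj (dG01 x w v) ** g x" using c by simp
qed

text \<open>
  The covariant derivative of the covector field \<open>Lam\<close>.
\<close>

definition covLam where "covLam x w = dLam x w - G x w *v Lam x"

lemma G_linear: assumes x: "x \<in> S" shows "linear (\<lambda>w. G x w *v Lam x)"
  by (auto intro!: linearI simp: G_add[OF x] scaleR_vec_scale G_scale[OF x] mat_mult_vector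
      matrix_vector_distribs simp flip: matrix_vector_mul_assoc)

lemma covLam_linear: assumes x: "x \<in> S" shows "linear (covLam x)"
proof -
  have "linear (dLam x)" using dLam[OF x] has_derivative_linear by blast
  thus ?thesis using G_linear[OF x] unfolding covLam_def[abs_def] by (rule linear_compose_sub)
qed

text \<open>
  The antisymmetric part of the second derivative of \<open>A\<close>. All terms with a first derivative of \<open>g\<close> or
  \<open>A\<close> cancel, as they do for a covariant derivative.
\<close>

lemma curv_A:
  assumes x: "x \<in> S"
  shows "curv x v w ** A x - A x ** curv x v w =
    outer (covLam x w) v - outer (covLam x v) w
    + outer (h x *v cconj v) (cconj (g x *v covLam x w)) - outer (h x *v cconj w) (cconj (g x *v covLam x v))"
proof -
  define g' where "g' v = - (g x ** G x v) - hadj (G x v) ** g x" for v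
  define A' where "A' v = G x v ** A x - A x ** G x v - outer (Lam x) v
          - outer (h x *v cconj v) (cconj (g x *v Lam x))" for v
  define h' where "h' w = G x w ** h x + h x ** hadj (G x w)" for w
  have g': "(g has_derivative g') (at x)" using g_deriv[OF x] by (simp add: g'_def[abs_def])
  have A': "(A has_derivative A') (at x)" using A_deriv[OF x] by (simp add: A'_def[abs_def])
  have h': "(h has_derivative h') (at x)" using h_deriv[OF x] by (simp add: h'_def[abs_def])
  define E where "E v w = G x v ** A' w + dG x v w ** A x - (A x ** dG x v w + A' w ** G x v)
     - outer (dLam x w) v
     - (outer (h x *v cconj v) (cconj (g x *v dLam x w + g' w *v Lam x))
        + outer (h' w *v cconj v) (cconj (g x *v Lam x)))" for v w
  have E: "((\<lambda>y. G y v ** A y - A y ** G y v - outer (Lam y) v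
          - outer (h y *v cconj v) (cconj (g y *v Lam y))) has_derivative E v) (at x)" for v
    unfolding E_def[abs_def]
    by (rule derivative_eq_intros g' A' h' dG[OF x] dLam[OF x] refl)+ (simp add: fun_eq_iff)
  have sym: "E v w = E w v"
    by (rule second_derivative_symmetric[OF open_S x A_deriv E E])
  have Gs: "transpose (G x w) *v v = transpose (G x v) *v w" by (rule G_sym[OF x])
  have hGs: "hadj (G x w) *v cconj v = hadj (G x v) *v cconj w" by (rule hadj_G_sym[OF x])
  have tc: "transpose (G x w) *v cconj u = cconj (hadj (G x w) *v u)" for w u
    by (simp add: cconj_matrix)
  have "curv x v w ** A x - A x ** curv x v w - (outer (covLam x w) v - outer (covLam x v) w
    + outer (h x *v cconj v) (cconj (g x *v covLam x w)) - outer (h x *v cconj w) (cconj (g x *v covLam x v)))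
    = E v w - E w v"
    unfolding E_def A'_def h'_def g'_def curv_def covLam_def
    by (simp add: matrix_distribs matrix_vector_distribs cconj_distribs outer_add outer_diff outer_minus
       matrix_mult_outer outer_mult_matrix Gs hGs tc matrix_mul_assoc[symmetric] matrix_vector_mul_assoc[symmetric] algebra_simps)
  thus ?thesis using sym by simp
qed

end

section \<open>The Hessian of the trace of the pencil endomorphism\<close>

context local_pencil
begin

definition covLam10 where "covLam10 x w = (1/2) *\<^sub>R (covLam x w - \<i> *s covLam x (\<i> *s w))"
definition covLam01 where "covLam01 x w = (1/2) *\<^sub>R (covLam x w + \<i> *s covLam x (\<i> *s w))"

lemma covLam_split: "covLam x w = covLam10 x w + covLam01 x w"
  by (simp add: covLam10_def covLam01_def scaleR_add_right scaleR_diff_right flip: scaleR_left_distrib)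

lemma i_scaleR: "\<i> *s (r *\<^sub>R v) = r *\<^sub>R (\<i> *s v)" for v :: "complex^'n"
  by (simp add: vec_eq_iff)

lemma covLam_types_hom:
  assumes x: "x \<in> S"
  shows "covLam10 x (\<i> *s w) = \<i> *s covLam10 x w" "covLam01 x (\<i> *s w) = - (\<i> *s covLam01 x w)"
  using linear_neg[OF covLam_linear[OF x]]
  by (simp_all add: covLam10_def covLam01_def i_scaleR vec_scale_distribs algebra_simps)

text \<open>
  The components of \<open>curv_A\<close> of types \<open>(1,1)\<close> and \<open>(2,0)\<close>.
\<close>

lemma dG01_A_and_covLam10:
  assumes x: "x \<in> S"
  shows "dG01 x v w ** A x - A x ** dG01 x v w
      = outer (covLam01 x w) v - outer (h x *v cconj w) (cconj (g x *v covLam01 x v))" (is ?th1)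
    and "outer (covLam10 x w) v = outer (covLam10 x v) w" (is ?th2)
proof -
  let ?a = "\<lambda>w v. outer (covLam10 x v) w - outer (covLam10 x w) v"
  let ?b = "\<lambda>w v. outer (h x *v cconj w) (cconj (g x *v covLam10 x v)) - outer (h x *v cconj v) (cconj (g x *v covLam10 x w))"
  let ?c = "\<lambda>w v. dG01 x v w ** A x - A x ** dG01 x v w - outer (covLam01 x w) v
       + outer (h x *v cconj w) (cconj (g x *v covLam01 x v))"
  let ?d = "\<lambda>w v. outer (covLam01 x v) w - outer (h x *v cconj v) (cconj (g x *v covLam01 x w))
       - (dG01 x w v ** A x - A x ** dG01 x w v)"
  have sum: "?a w v + ?b w v + ?c w v + ?d w v = 0" for w v
    using curv_A[OF x, of v w]
    by (simp add: curv_eq[OF x] covLam_split[of x w] covLam_split[of x v] matrix_distribs matrix_vector_distribs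
        cconj_distribs outer_add algebra_simps)
  note hom = covLam_types_hom[OF x] dG_types_hom[OF x] mat_pull mat_minus matrix_distribs cconj_distribs
    matrix_vector_distribs matrix_vector_scale outer_minus outer_scale
  have "?a w v = 0" and "?c w v = 0"
    by (rule type_decomposition[where a = ?a and b = ?b and c = ?c and d = ?d], rule sum;
        simp add: hom flip: matrix_mul_assoc)+
  thus ?th1 ?th2 by (simp_all add: algebra_simps)
qed

lemma covLam10_linear: "x \<in> S \<Longrightarrow> linear (covLam10 x)"
  unfolding covLam10_def[abs_def]
  using covLam_linear[of x]
  by (auto intro!: linearI simp: linear_add linear_cmul i_scaleR vec_scale_distribs algebra_simps
      scalar_mult_eq_scaleR)

lemma covLam01_linear: "x \<in> S \<Longrightarrow> linear (covLam01 x)"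
  unfolding covLam01_def[abs_def]
  using covLam_linear[of x]
  by (auto intro!: linearI simp: linear_add linear_cmul i_scaleR vec_scale_distribs algebra_simps
      scalar_mult_eq_scaleR)

text \<open>
  \<open>N(w) v\<^sup>T = N(v) w\<^sup>T\<close> for all \<open>v, w\<close> forces \<open>N = 0\<close> in dimension at least 2: contracting \<open>v\<close> with the second
  index gives \<open>n N = N\<close>.
\<close>

lemma covLam10_0: assumes x: "x \<in> S" shows "covLam10 x w = 0"
proof -
  have "covLam10 x w $ i = 0" for i
  proof -
    have F: "covLam10 x v = matrix (covLam10 x) *v v" for v
      by (rule complex_linear_matrix(2)[OF covLam10_linear[OF x] covLam_types_hom(1)[OF x]])
    have "of_nat CARD('n) * covLam10 x w $ i = (\<Sum>j\<in>UNIV. outer (covLam10 x w) (axis j 1) $ i $ j)"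
      by (simp add: outer_def)
    also have "\<dots> = (\<Sum>j\<in>UNIV. outer (covLam10 x (axis j 1)) w $ i $ j)"
      by (simp only: dG01_A_and_covLam10(2)[OF x])
    also have "\<dots> = covLam10 x w $ i"
      by (simp add: F[of w]) (simp add: outer_def matrix_vector_mult_def matrix_def)
    finally show ?thesis using dim by (rule eq_0_if_card_mult_eq)
  qed
  thus ?thesis by (simp add: vec_eq_iff)
qed

text \<open>
  The complex antilinear part of the covariant derivative of \<open>Lam\<close> as a matrix. Up to sign this is
  the mixed Hessian of the trace of \<open>A\<close>.
\<close>

definition Hess where "Hess x = matrix (\<lambda>u. covLam01 x (cconj u))"

lemma covLam01_Hess: assumes x: "x \<in> S" shows "covLam01 x w = Hess x *v cconj w"
proof -
  have "linear (\<lambda>u. covLam01 x (cconj u))"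
    using linear_compose[OF linear_cconj covLam01_linear[OF x]] by (simp add: o_def)
  moreover have "covLam01 x (cconj (\<i> *s v)) = \<i> *s covLam01 x (cconj v)" for v
  proof -
    have "cconj (\<i> *s v) = - (\<i> *s cconj v)" by (simp add: cconj_def vec_eq_iff)
    thus ?thesis using linear_neg[OF covLam01_linear[OF x]] by (simp add: covLam_types_hom[OF x])
  qed
  ultimately have "covLam01 x (cconj u) = Hess x *v u" for u
    unfolding Hess_def by (rule complex_linear_matrix(2))
  from this[of "cconj w"] show ?thesis by simp
qed

lemma dLam_eq: "x \<in> S \<Longrightarrow> dLam x w = G x w *v Lam x + Hess x *v cconj w"
  using covLam_split[of x w] covLam10_0[of x w] covLam01_Hess[of x w] by (simp add: covLam_def diff_eq_eq add.commute)

lemma hg_vec: assumes x: "x \<in> S" shows "h x *v (g x *v u) = u" "g x *v (h x *v u) = u"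
  by (simp_all add: matrix_vector_mul_assoc hg[OF x] gh[OF x])

text \<open>
  The commutator on the left of the \<open>(1,1)\<close> equation has trace zero.
\<close>

lemma Hess_herm: assumes x: "x \<in> S" shows "hadj (Hess x) = Hess x"
proof -
  have "cdot v (Hess x *v u) = cdot v (hadj (Hess x) *v u)" for u v
  proof -
    have "trace (dG01 x v (cconj u) ** A x) - trace (A x ** dG01 x v (cconj u)) = 0"
      using trace_mul_sym[of "A x" "dG01 x v (cconj u)"] by simp
    also have "trace (dG01 x v (cconj u) ** A x) - trace (A x ** dG01 x v (cconj u))
       = cdot v (Hess x *v u) - cdot (cconj (g x *v (Hess x *v cconj v))) (h x *v u)"
      unfolding trace_sub[symmetric] dG01_A_and_covLam10(1)[OF x]
      by (simp add: trace_sub trace_outer covLam01_Hess[OF x] cdot_commute[of "Hess x *v u"] cdot_commute[of "h x *v u"])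
    also have "cdot (cconj (g x *v (Hess x *v cconj v))) (h x *v u) = cnj (cdot (cconj u) (Hess x *v cconj v))"
      using cdot_hadj[of "g x *v (Hess x *v cconj v)" "h x" u] by (simp add: h_herm[OF x] hg_vec[OF x])
    also have "\<dots> = cdot v (hadj (Hess x) *v u)"
      using cdot_hadj[of "cconj v" "hadj (Hess x)" u] by simp
    finally show ?thesis by simp
  qed
  hence "cdot v (Hess x *v u - hadj (Hess x) *v u) = 0" for u v by (simp add: cdot_diff)
  hence "Hess x *v u - hadj (Hess x) *v u = 0" for u by (rule cdot_eq_0D)
  thus ?thesis by (simp add: matrix_eq)
qed

text \<open>
  The curvature tensor with all indices lowered: \<open>a\<close> and \<open>f\<close> stand for barred indices,
  \<open>v\<close> and \<open>e\<close> for unbarred ones. As for every Kaehler metric it is symmetric in each of the two pairs.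
\<close>

definition \<sigma> where "\<sigma> x a v e f = cdot e (dG01 x v (cconj a) *v (h x *v f))"

lemma sigma_sym1: "x \<in> S \<Longrightarrow> \<sigma> x a v e f = \<sigma> x a e v f"
  by (simp add: \<sigma>_def cdot_matrix dG01_sym[of x v])

lemma sigma_cnj: assumes x: "x \<in> S"
  shows "\<sigma> x a v e f = cnj (\<sigma> x (cconj v) (cconj a) (cconj f) (cconj e))"
proof -
  have "dG01 x v w ** h x = h x ** hadj (dG01 x w v)" for w
  proof -
    have "dG01 x v w ** h x = h x ** (g x ** dG01 x v w) ** h x" by (simp add: matrix_mul_assoc hg[OF x])
    also have "\<dots> = h x ** hadj (dG01 x w v)"
      unfolding dG01_g[OF x] by (simp add: matrix_mul_assoc[symmetric] gh[OF x])
    finally show ?thesis .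
  qed
  hence "\<sigma> x a v e f = cdot e ((h x ** hadj (dG01 x (cconj a) v)) *v f)"
    by (simp add: \<sigma>_def matrix_vector_mul_assoc)
  also have "\<dots> = cnj (cdot (cconj f) (dG01 x (cconj a) v *v (h x *v cconj e)))"
    using cdot_hadj[of "cconj e" "h x ** hadj (dG01 x (cconj a) v)" f]
    by (simp add: hadj_mult h_herm[OF x] matrix_vector_mul_assoc)
  finally show ?thesis by (simp add: \<sigma>_def)
qed

lemma sigma_sym2: "x \<in> S \<Longrightarrow> \<sigma> x a v e f = \<sigma> x f v e a"
  using sigma_cnj[of x a v e f] sigma_cnj[of x f v e a] sigma_sym1[of x "cconj v" "cconj a" "cconj f" "cconj e"]
  by simp

text \<open>
  The \<open>(1,1)\<close> equation in terms of the curvature tensor.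
\<close>

lemma sigma_A:
  assumes x: "x \<in> S"
  shows "\<sigma> x a v e (hadj (A x) *v f) - \<sigma> x a v (transpose (A x) *v e) f
     = cdot e (Hess x *v a) * cdot v (h x *v f) - cdot e (h x *v a) * cdot v (Hess x *v f)"
proof -
  have "\<sigma> x a v e (hadj (A x) *v f) - \<sigma> x a v (transpose (A x) *v e) f
      = cdot e ((dG01 x v (cconj a) ** A x - A x ** dG01 x v (cconj a)) *v (h x *v f))"
    by (simp add: \<sigma>_def matrix_vector_mul_assoc A_h[OF x, symmetric] cdot_matrix[symmetric]
       matrix_vector_mult_diff_rdistrib cdot_diff matrix_mul_assoc matrix_diff_rdistrib)
  also have "\<dots> = cdot v (h x *v f) * cdot e (Hess x *v a)
      - cdot (cconj (g x *v (Hess x *v cconj v))) (h x *v f) * cdot e (h x *v a)"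
    unfolding dG01_A_and_covLam10(1)[OF x]
    by (simp add: covLam01_Hess[OF x] matrix_vector_mult_diff_rdistrib outer_mult_vector cdot_diff cdot_scale)
  also have "cdot (cconj (g x *v (Hess x *v cconj v))) (h x *v f) = cnj (cdot (cconj f) (Hess x *v cconj v))"
    using cdot_hadj[of "g x *v (Hess x *v cconj v)" "h x" f] by (simp add: h_herm[OF x] hg_vec[OF x])
  also have "\<dots> = cdot v (Hess x *v f)"
    using cdot_hadj[of "cconj v" "Hess x" f] Hess_herm[OF x] by simp
  finally show ?thesis by simp
qed

text \<open>
  By the symmetries of the curvature tensor, \<open>sigma_A\<close> may be applied to either of the barred indices \<open>a\<close> and
  \<open>f\<close>. The two operations commute, and comparing the results of applying both gives
  \<open>(e \<cdot> C a) (v \<cdot> h f) = (e \<cdot> C f) (v \<cdot> h a)\<close> for the commutator \<open>C\<close>, which vanishes in dimension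
  at least 2.
\<close>

lemma Hess_A: assumes x: "x \<in> S" shows "Hess x ** hadj (A x) = A x ** Hess x"
proof -
  define C where "C = Hess x ** hadj (A x) - A x ** Hess x"
  have Aha: "cdot (transpose (A x) *v e) (h x *v a) = cdot e (h x *v (hadj (A x) *v a))" for e a
    by (simp add: cdot_matrix[symmetric] matrix_vector_mul_assoc A_h[OF x])
  have C: "cdot e (C *v a) = cdot e (Hess x *v (hadj (A x) *v a)) - cdot (transpose (A x) *v e) (Hess x *v a)" for e a
    by (simp add: C_def matrix_vector_mult_diff_rdistrib cdot_diff cdot_matrix[symmetric] matrix_vector_mul_assoc)
  have main: "cdot e (C *v a) * cdot v (h x *v f) = cdot e (C *v f) * cdot v (h x *v a)" for a v e f
  proof -
    let ?H = "\<lambda>u. hadj (A x) *v u" and ?T = "\<lambda>u. transpose (A x) *v u"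
    have sw: "\<sigma> x (?H a) v e f - \<sigma> x a v (?T e) f
       = cdot e (Hess x *v f) * cdot v (h x *v a) - cdot e (h x *v f) * cdot v (Hess x *v a)" for a e f
      using sigma_A[OF x, of f v e a] by (simp add: sigma_sym2[OF x, of f v])
    note e = sigma_A[OF x, of "?H a" v e f] sigma_A[OF x, of a v "?T e" f]
        sw[of a e "?H f"] sw[of a "?T e" f]
    have "(cdot e (Hess x *v ?H a) * cdot v (h x *v f) - cdot e (h x *v ?H a) * cdot v (Hess x *v f))
       - (cdot (?T e) (Hess x *v a) * cdot v (h x *v f) - cdot (?T e) (h x *v a) * cdot v (Hess x *v f))
      = (cdot e (Hess x *v ?H f) * cdot v (h x *v a) - cdot e (h x *v ?H f) * cdot v (Hess x *v a))
       - (cdot (?T e) (Hess x *v f) * cdot v (h x *v a) - cdot (?T e) (h x *v f) * cdot v (Hess x *v a))"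
      unfolding e[symmetric] by simp
    thus ?thesis by (simp add: C Aha algebra_simps)
  qed
  have "cdot e (C *v a) = 0" for e a
  proof -
    \<comment> \<open>Contract \<open>v \<otimes> f\<close> with \<open>g\<close>, for which \<open>\<Sum> v \<cdot> h f = n\<close>.\<close>
    have "of_nat CARD('n) * cdot e (C *v a)
        = (\<Sum>i\<in>(UNIV::'n set). cdot e (C *v a) * cdot (axis i 1) (h x *v (g x *v axis i 1)))"
      by (simp add: hg_vec[OF x] cdot_def axis_def mult_delta_left)
    also have "\<dots> = (\<Sum>i\<in>(UNIV::'n set). cdot e (C *v (g x *v axis i 1)) * cdot (axis i 1) (h x *v a))"
      by (simp only: main)
    also have "\<dots> = cdot (transpose (g x) *v (transpose C *v e)) (h x *v a)"
      by (simp add: cdot_matrix[of e C] cdot_matrix[of "transpose C *v e" "g x"])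
        (simp add: cdot_def axis_def mult_delta_left mult_delta_right)
    also have "\<dots> = cdot e (C *v a)"
      by (simp add: cdot_matrix[symmetric] hg_vec[OF x])
    finally show ?thesis using dim by (rule eq_0_if_card_mult_eq)
  qed
  hence "C *v a = 0" for a by (rule cdot_eq_0D)
  hence "C = 0" by (simp add: matrix_eq)
  thus ?thesis by (simp add: C_def)
qed

lemma Hess_g_A: assumes x: "x \<in> S" shows "Hess x ** g x ** A x = A x ** (Hess x ** g x)"
proof -
  have "Hess x ** g x ** A x = Hess x ** hadj (A x) ** g x"
    by (simp add: matrix_mul_assoc[symmetric] A_selfadj[OF x])
  thus ?thesis by (simp add: Hess_A[OF x] matrix_mul_assoc)
qed

end

section \<open>Resolvents\<close>

lemma det_hadj: "det (hadj N) = cnj (det N)" for N :: "complex^'n^'n::finite"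
proof -
  have "det (hadj N) = det (transpose (hadj N))" by simp
  also have "\<dots> = cnj (det N)"
    by (simp add: det_def hadj_def transpose_def)
  finally show ?thesis .
qed

lemma hadj_eps_cofactor: "hadj (eps_cofactor N) = eps_cofactor (hadj N)" for N :: "complex^'n^'n::finite"
proof -
  have "cnj (levi_civita f) = levi_civita f" for f :: "'n \<Rightarrow> 'n" by (simp add: levi_civita_def)
  hence "hadj (eps_cofactor N) $ i $ j = eps_cofactor (hadj N) $ i $ j" for i j
    by (simp add: hadj_def eps_cofactor_def) (subst sum.swap, simp add: mult_ac)
  thus ?thesis by (simp add: vec_eq_iff)
qed

text \<open>
  Insert \<open>(X - s) - (X - t) = t - s\<close> between the two cofactor matrices.
\<close>

lemma resolvent_identity:
  fixes X :: "complex^'n^'n::finite"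
  defines "B \<equiv> \<lambda>t. eps_cofactor (X - mat (complex_of_real t))"
    and "d \<equiv> \<lambda>t. det (X - mat (complex_of_real t))"
  shows "mat (of_real (t - s)) ** (B t ** B s) = mat (d s) ** B t - mat (d t) ** B s"
proof -
  have "mat (of_real (t - s)) ** (B t ** B s)
     = B t ** ((X - mat (of_real s)) - (X - mat (of_real t))) ** B s"
  proof -
    have "(X - mat (of_real s)) - (X - mat (of_real t)) = (mat (of_real (t - s)) :: complex^'n^'n)"
      by (simp add: mat_def vec_eq_iff)
    thus ?thesis by (simp only: mat_pull mat_commute[of "B t"] matrix_mul_assoc)
  qed
  also have "\<dots> = B t ** ((X - mat (of_real s)) ** B s) - (B t ** (X - mat (of_real t))) ** B s"
    by (simp add: matrix_diff_ldistrib matrix_diff_rdistrib matrix_mul_assoc)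
  also have "\<dots> = mat (d s) ** B t - mat (d t) ** B s"
    by (simp only: B_def d_def matrix_mult_eps_cofactor eps_cofactor_mult_matrix
        mat_commute[of "eps_cofactor (X - mat (of_real t))" "det (X - mat (of_real s))"])
  finally show ?thesis .
qed

lemma eps_cofactor_commute:
  fixes X :: "complex^'n^'n::finite"
  assumes "X ** Y = Y ** X"
  shows "eps_cofactor X ** Y = Y ** eps_cofactor X"
proof -
  let ?X = "\<lambda>t::real. X - mat (of_real t)"
  let ?f = "\<lambda>t. eps_cofactor (?X t) ** Y - Y ** eps_cofactor (?X t)"
  have "?f 0 = 0"
  proof (rule continuous_eq_off_finite[OF _ finite_real_eigenvalues[of X]])
    show "continuous_on UNIV ?f" by (intro continuous_intros)
    fix t assume t: "t \<notin> {t. det (?X t) = 0}"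
    have XY: "?X t ** Y = Y ** ?X t"
      using assms by (simp add: matrix_distribs mat_commute[of Y])
    have "mat (det (?X t)) ** (eps_cofactor (?X t) ** Y) = eps_cofactor (?X t) ** (Y ** ?X t) ** eps_cofactor (?X t)"
      by (simp only: matrix_mul_assoc[symmetric] matrix_mult_eps_cofactor mat_commute[of Y] mat_pull)
    also have "\<dots> = mat (det (?X t)) ** (Y ** eps_cofactor (?X t))"
      by (simp only: XY[symmetric] matrix_mul_assoc eps_cofactor_mult_matrix)
    finally show "?f t = 0" using t by (simp add: mat_scal vec_eq_iff)
  qed
  moreover have "mat (of_real 0) = (0 :: complex^'n^'n)" by (simp add: mat_def vec_eq_iff)
  ultimately show ?thesis by simp
qed

text \<open>
  At an invertible matrix the derivative of the cofactor matrix involves only the cofactor matrix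
  itself. All bracket computations below rest on this formula.
\<close>

lemma cofactor_deriv_vector:
  fixes N :: "complex^'n^'n::finite"
  assumes "det N \<noteq> 0"
  shows "cofactor_deriv N X *v q = inverse (det N) *s
    (trace (eps_cofactor N ** X) *s (eps_cofactor N *v q) - eps_cofactor N *v (X *v (eps_cofactor N *v q)))"
proof -
  have "det N *s (cofactor_deriv N X *v q) = (mat (det N) ** cofactor_deriv N X) *v q"
    by (simp add: mat_mult_vector flip: matrix_vector_mul_assoc)
  also have "\<dots> = trace (eps_cofactor N ** X) *s (eps_cofactor N *v q) - eps_cofactor N *v (X *v (eps_cofactor N *v q))"
    by (simp add: det_mult_cofactor_deriv matrix_vector_mult_diff_rdistrib mat_mult_vector flip: matrix_vector_mul_assoc)
  finally have "inverse (det N) *s (det N *s (cofactor_deriv N X *v q)) = inverse (det N) *s \<dots>" by simp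
  thus ?thesis using assms by simp
qed

text \<open>
  The canonical Poisson bracket of functions \<open>F\<close> and \<open>G\<close> is the derivative of \<open>F\<close> along the fibre gradient
  of \<open>G\<close> minus the derivative of \<open>G\<close> along the fibre gradient of \<open>F\<close>.
\<close>

lemma sum_basis_bracket:
  fixes a b :: "'a::euclidean_space"
  assumes "linear p" "linear q"
  shows "(\<Sum>i\<in>Basis. p i * (i \<bullet> b) - (i \<bullet> a) * q i) = p b - q a"
proof -
  have rep: "f u = (\<Sum>i\<in>Basis. f i * (i \<bullet> u))" if "linear f" for f :: "'a \<Rightarrow> real" and u
  proof -
    have "f u = f (\<Sum>i\<in>Basis. (u \<bullet> i) *\<^sub>R i)" by (simp add: euclidean_representation)
    thus ?thesis by (simp add: linear_sum[OF that] linear_cmul[OF that] inner_commute mult.commute)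
  qed
  show ?thesis by (simp add: rep[OF assms(1), of b] rep[OF assms(2), of a] sum_subtractf mult.commute)
qed

lemmas continuous_on_cdot [continuous_intros] =
  bounded_bilinear.continuous_on[OF bilinear_conv_bounded_bilinear[THEN iffD1, OF bilinear_cdot]]
lemmas continuous_on_cconj [continuous_intros] =
  bounded_linear.continuous_on[OF linear_conv_bounded_linear[THEN iffD1, OF linear_cconj]]

lemma continuous_on_vscale [continuous_intros]:
  fixes f :: "'a::topological_space \<Rightarrow> complex" and g :: "'a \<Rightarrow> complex^'n"
  assumes "continuous_on S f" "continuous_on S g" shows "continuous_on S (\<lambda>x. f x *s g x)"
  unfolding vector_scalar_mult_def by (intro continuous_on_vec_lambda continuous_intros assms)

lemma zero_if_generically_zero:
  fixes \<phi> :: "real \<Rightarrow> real \<Rightarrow> real"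
  assumes Z: "finite Z" and 0: "\<And>t s. t \<notin> Z \<Longrightarrow> s \<notin> Z \<Longrightarrow> t \<noteq> s \<Longrightarrow> \<phi> t s = 0"
    and c1: "\<And>s. continuous_on UNIV (\<lambda>t. \<phi> t s)" and c2: "\<And>t. continuous_on UNIV (\<phi> t)"
  shows "\<phi> t s = 0"
proof -
  have 1: "\<phi> t s = 0" if "s \<notin> Z" for s t
    by (rule continuous_eq_off_finite[OF c1, of "insert s Z"]) (use Z 0 that in auto)
  show ?thesis
    by (rule continuous_eq_off_finite[OF c2 Z]) (use 1 in auto)
qed

section \<open>The integrals in a chart\<close>

context local_pencil
begin

definition At where "At x t = A x - mat (complex_of_real t)"
definition B where "B x t = eps_cofactor (At x t)"
definition d where "d x t = det (At x t)"
definition b where "b x t = g x *v (B x t *v Lam x)"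

definition dA where "dA x v = G x v ** A x - A x ** G x v - outer (Lam x) v
   - outer (h x *v cconj v) (cconj (g x *v Lam x))"
definition dg where "dg x v = - (g x ** G x v) - hadj (G x v) ** g x"

lemma dA: "x \<in> S \<Longrightarrow> (A has_derivative dA x) (at x)" using A_deriv by (simp add: dA_def[abs_def])
lemma dg: "x \<in> S \<Longrightarrow> (g has_derivative dg x) (at x)" using g_deriv by (simp add: dg_def[abs_def])

lemma B_deriv: "x \<in> S \<Longrightarrow> ((\<lambda>y. B y t) has_derivative (\<lambda>v. cofactor_deriv (At x t) (dA x v))) (at x)"
  unfolding B_def At_def by (rule derivative_eq_intros dA | assumption | simp)+

lemma At_selfadj: "x \<in> S \<Longrightarrow> hadj (At x t) ** g x = g x ** At x t"
  by (simp add: At_def hadj_diff hadj_mat matrix_distribs A_selfadj mat_commute[of "g x"])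

lemma d_real: assumes x: "x \<in> S" shows "cnj (d x t) = d x t"
proof -
  have "det (hadj (At x t)) * det (g x) = det (g x) * det (At x t)"
    using arg_cong[OF At_selfadj[OF x], of det] by (simp add: det_mul)
  thus ?thesis using g_det[OF x] by (simp add: det_hadj d_def)
qed

lemma B_selfadj: assumes x: "x \<in> S" shows "hadj (B x t) ** g x = g x ** B x t"
proof -
  let ?c = "eps_cofactor (g x)"
  have "?c ** hadj (B x t) = B x t ** ?c"
    unfolding B_def hadj_eps_cofactor eps_cofactor_mult[symmetric] At_selfadj[OF x] ..
  hence "g x ** (?c ** hadj (B x t)) ** g x = g x ** (B x t ** ?c) ** g x" by simp
  hence "mat (det (g x)) ** (hadj (B x t) ** g x) = g x ** B x t ** (?c ** g x)"
    by (simp only: matrix_mul_assoc matrix_mult_eps_cofactor)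
  hence "mat (det (g x)) ** (hadj (B x t) ** g x) = mat (det (g x)) ** (g x ** B x t)"
    by (simp only: eps_cofactor_mult_matrix mat_commute)
  thus ?thesis using g_det[OF x] by (simp add: mat_scal vec_eq_iff)
qed

lemma B_h: assumes x: "x \<in> S" shows "B x t ** h x = h x ** hadj (B x t)"
proof -
  have "h x ** hadj (B x t) = h x ** (hadj (B x t) ** g x) ** h x"
    by (simp add: matrix_mul_assoc[symmetric] gh[OF x])
  also have "\<dots> = B x t ** h x" by (simp add: B_selfadj[OF x] hg_left[OF x])
  finally show ?thesis by simp
qed

lemma B_commute: "B x t ** B x s = B x s ** B x t"
proof -
  have "At x t ** At x s = At x s ** At x t"
    by (simp add: At_def matrix_distribs mat_commute[of "A x"] mat_mult_mat mult.commute)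
  hence "B x t ** At x s = At x s ** B x t" unfolding B_def by (rule eps_cofactor_commute)
  thus ?thesis unfolding B_def by (metis eps_cofactor_commute)
qed

lemma B_Hess_g: assumes x: "x \<in> S" shows "B x t ** (Hess x ** g x) = (Hess x ** g x) ** B x t"
  unfolding B_def by (rule eps_cofactor_commute)
    (simp add: At_def matrix_diff_ldistrib matrix_diff_rdistrib mat_commute Hess_g_A[OF x])

lemma resolvent: "of_real (t - s) *s (B x t *v (B x s *v q)) = d x s *s (B x t *v q) - d x t *s (B x s *v q)"
  using arg_cong[OF resolvent_identity[of t s "A x"], of "\<lambda>X. X *v q"]
  by (simp add: B_def At_def d_def mat_mult_vector matrix_vector_mult_diff_rdistrib flip: matrix_vector_mul_assoc)

lemma B_g_vec: "x \<in> S \<Longrightarrow> hadj (B x t) *v (g x *v u) = g x *v (B x t *v u)"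
  by (simp add: matrix_vector_mul_assoc B_selfadj)
lemma h_B_vec: "x \<in> S \<Longrightarrow> h x *v (hadj (B x t) *v u) = B x t *v (h x *v u)"
  by (simp add: matrix_vector_mul_assoc B_h)
lemma B_commute_vec: "B x t *v (B x s *v u) = B x s *v (B x t *v u)"
  by (simp add: matrix_vector_mul_assoc B_commute)

lemma dA_At: "dA x v = G x v ** At x t - At x t ** G x v - outer (Lam x) v
    - outer (h x *v cconj v) (cconj (g x *v Lam x))"
  by (simp add: dA_def At_def matrix_distribs mat_commute[of "G x v"])

lemma B_At: "B x t ** At x t = mat (d x t)" "At x t ** B x t = mat (d x t)"
  by (simp_all add: B_def d_def eps_cofactor_mult_matrix matrix_mult_eps_cofactor)

text \<open>
  The derivative of \<open>det (A - t)\<close>: the commutator with \<open>G\<close> has no effect, and the term of type \<open>(0,1)\<close>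
  contributes the conjugate of the term of type \<open>(1,0)\<close>.
\<close>

lemma trace_B_dA:
  assumes x: "x \<in> S"
  shows "trace (B x t ** dA x v) = - cdot v (B x t *v Lam x) - cnj (cdot v (B x t *v Lam x))"
proof -
  let ?B = "B x t" and ?N = "At x t" and ?G = "G x v"
  have "hadj (?B ** h x) *v (g x *v Lam x) = ?B *v Lam x"
    by (simp add: hadj_mult h_herm[OF x] h_B_vec[OF x] hg_vec[OF x] flip: matrix_vector_mul_assoc)
  hence "cdot (cconj (g x *v Lam x)) ((?B ** h x) *v cconj v) = cnj (cdot v (?B *v Lam x))"
    using cdot_hadj[of "g x *v Lam x" "?B ** h x" "cconj v"] by simp
  hence tr2: "cdot (cconj (g x *v Lam x)) (?B *v (h x *v cconj v)) = cnj (cdot v (?B *v Lam x))"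
    by (simp flip: matrix_vector_mul_assoc)
  have tr1: "trace (?B ** (?G ** ?N)) = trace (?B ** (?N ** ?G))"
  proof -
    have "trace (?B ** (?G ** ?N)) = trace (?N ** ?B ** ?G)"
      using trace_mul_sym[of "?B ** ?G" ?N] by (simp add: matrix_mul_assoc)
    thus ?thesis by (simp add: B_At matrix_mul_assoc)
  qed
  show ?thesis
    by (simp add: dA_At[of x v t] matrix_diff_ldistrib trace_sub tr1 tr2 trace_mult_outer)
qed

lemma cofactor_deriv_dA:
  assumes x: "x \<in> S" and d: "d x t \<noteq> 0"
  shows "cofactor_deriv (At x t) (dA x v) *v q = G x v *v (B x t *v q) - B x t *v (G x v *v q)
    - inverse (d x t) *s (cdot v (B x t *v Lam x) *s (B x t *v q) - cdot v (B x t *v q) *s (B x t *v Lam x))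
    - inverse (d x t) *s (cnj (cdot v (B x t *v Lam x)) *s (B x t *v q)
        - cdot (cconj (g x *v Lam x)) (B x t *v q) *s (B x t *v (h x *v cconj v)))"
proof -
  have B_At_vec: "B x t *v (At x t *v u) = d x t *s u" "At x t *v (B x t *v u) = d x t *s u" for u
    by (simp_all add: matrix_vector_mul_assoc B_At mat_mult_vector)
  show ?thesis
    unfolding cofactor_deriv_vector[OF d[unfolded d_def]] B_def[symmetric] d_def[symmetric] trace_B_dA[OF x]
    using d
    by (simp add: dA_At[of x v t] matrix_vector_mult_diff_rdistrib matrix_vector_mul_assoc[symmetric] outer_mult_vector
      matrix_vector_mult_diff_distrib B_At_vec matrix_vector_scale)
qed

text \<open>
  \<open>Iloc\<close> and \<open>Lloc\<close> are \<open>I\<^sub>t\<close> and \<open>L\<^sub>t\<close> on the cotangent bundle of the chart; \<open>DI\<close> and \<open>DL\<close> are their derivatives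
  in the direction \<open>v\<close> of the base, \<open>velI\<close> and \<open>velL\<close> their gradients along the fibre. \<open>velL\<close> is the vector
  field \<open>K\<^sub>t\<close>.
\<close>

definition DI where "DI t x \<xi> v = 1/2 * Re (cdot \<xi> (g x *v (cofactor_deriv (At x t) (dA x v) *v cconj \<xi>)
     + dg x v *v (B x t *v cconj \<xi>)))"
definition db where "db t x v = g x *v (B x t *v dLam x v + cofactor_deriv (At x t) (dA x v) *v Lam x)
     + dg x v *v (B x t *v Lam x)"
definition DL where "DL t x \<xi> v = Re (\<i> * cdot \<xi> (db t x v))"
definition velI where "velI t x \<xi> = transpose (g x ** B x t) *v \<xi>"
definition velL where "velL t x = cconj (\<i> *s b x t)"

definition Iloc where "Iloc t z = 1/2 * Re (cdot (snd z) (g (fst z) *v (B (fst z) t *v cconj (snd z))))"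
definition Lloc where "Lloc t z = Re (\<i> * cdot (snd z) (b (fst z) t))"

lemma gB_herm: "x \<in> S \<Longrightarrow> hadj (g x ** B x t) = g x ** B x t"
  by (simp add: hadj_mult g_herm B_selfadj)

lemma Iloc_deriv:
  assumes x: "x \<in> S"
  shows "(Iloc t has_derivative (\<lambda>z. DI t x \<xi> (fst z) + snd z \<bullet> velI t x \<xi>)) (at (x, \<xi>))"
proof -
  have f: "(fst has_derivative fst) (at (x, \<xi>))" "(snd has_derivative snd) (at (x, \<xi>))"
    by (auto intro!: derivative_eq_intros)
  have gx: "((\<lambda>z. g (fst z)) has_derivative (\<lambda>z. dg x (fst z))) (at (x, \<xi>))"
    using has_derivative_compose[OF f(1), of g "dg x"] dg[OF x] by simp
  have Bx: "((\<lambda>z. B (fst z) t) has_derivative (\<lambda>z. cofactor_deriv (At x t) (dA x (fst z)))) (at (x, \<xi>))"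
    using has_derivative_compose[OF f(1), of "\<lambda>y. B y t" "\<lambda>v. cofactor_deriv (At x t) (dA x v)"] B_deriv[OF x, of t] by simp
  have herm: "cdot \<xi> (g x *v (B x t *v cconj w)) = cnj (cdot w (g x *v (B x t *v cconj \<xi>)))" for w
    using cdot_hadj[of "cconj \<xi>" "g x ** B x t" "cconj w"]
    by (simp add: gB_herm[OF x] matrix_vector_mul_assoc)
  have velI: "w \<bullet> velI t x \<xi> = Re (cdot w (g x *v (B x t *v cconj \<xi>)))" for w
    using gB_herm[OF x, of t]
    by (simp add: inner_eq_cdot velI_def cconj_matrix matrix_vector_mul_assoc)
      (metis hadj_vector_cconj cconj_matrix cconj_cconj)
  show ?thesis unfolding Iloc_def[abs_def]
    by (rule derivative_eq_intros gx Bx f refl)+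
       (simp add: fun_eq_iff DI_def velI cdot_add matrix_vector_distribs herm)
qed

lemma Lloc_deriv:
  assumes x: "x \<in> S"
  shows "(Lloc t has_derivative (\<lambda>z. DL t x \<xi> (fst z) + snd z \<bullet> velL t x)) (at (x, \<xi>))"
proof -
  have f: "(fst has_derivative fst) (at (x, \<xi>))" "(snd has_derivative snd) (at (x, \<xi>))"
    by (auto intro!: derivative_eq_intros)
  have bx: "((\<lambda>y. b y t) has_derivative db t x) (at x)"
    unfolding b_def db_def[abs_def] by (rule derivative_eq_intros dg[OF x] B_deriv[OF x] dLam[OF x] refl)+
  have bz: "((\<lambda>z. b (fst z) t) has_derivative (\<lambda>z. db t x (fst z))) (at (x, \<xi>))"
    using has_derivative_compose[OF f(1), of "\<lambda>y. b y t" "db t x"] bx by simp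
  have velL: "w \<bullet> velL t x = Re (\<i> * cdot w (b x t))" for w
    by (simp add: inner_eq_cdot velL_def cdot_scale)
  show ?thesis unfolding Lloc_def[abs_def]
    by (rule derivative_eq_intros bz f refl)+
       (simp add: fun_eq_iff DL_def velL algebra_simps)
qed

end

section \<open>Brackets in a chart\<close>

context local_pencil
begin

definition q where "q x \<xi> t = cdot \<xi> (g x *v (B x t *v cconj \<xi>))"
definition a where "a x \<xi> t = cdot \<xi> (b x t)"
definition c where "c x t = cdot (cconj (g x *v Lam x)) (B x t *v Lam x)"

lemma q_real: "x \<in> S \<Longrightarrow> cnj (q x \<xi> t) = q x \<xi> t"
  using cdot_hadj[of "cconj \<xi>" "g x ** B x t" "cconj \<xi>"]
  by (simp add: q_def gB_herm matrix_vector_mul_assoc)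

lemma cdot_gLam_B: assumes x: "x \<in> S"
  shows "cdot (cconj (g x *v (B x s *v Lam x))) u = cdot (cconj (g x *v Lam x)) (B x s *v u)"
proof -
  have "cdot (cconj (g x *v Lam x)) (B x s *v u) = cdot (cconj (hadj (B x s) *v (g x *v Lam x))) u"
    by (simp add: cdot_matrix cconj_matrix)
  thus ?thesis by (simp add: B_g_vec[OF x])
qed

lemma cdot_gLam: assumes x: "x \<in> S"
  shows "cdot (cconj (g x *v Lam x)) (B x t *v cconj \<xi>) = cnj (a x \<xi> t)"
  using cdot_hadj[of "g x *v Lam x" "B x t" "cconj \<xi>"]
  by (simp add: a_def b_def B_g_vec[OF x])

lemma c_real: assumes x: "x \<in> S" shows "cnj (c x t) = c x t"
proof -
  have "c x t = cdot (cconj (Lam x)) ((g x ** B x t) *v Lam x)"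
  proof -
    have "cconj (g x *v Lam x) = transpose (g x) *v cconj (Lam x)"
      by (simp only: cconj_matrix g_herm[OF x])
    thus ?thesis
      unfolding c_def matrix_vector_mul_assoc[symmetric]
      by (simp only: cdot_matrix[of "cconj (Lam x)" "g x"])
  qed
  thus ?thesis using cdot_hadj[of "Lam x" "g x ** B x t" "Lam x"] gB_herm[OF x, of t] by metis
qed

lemma cdot_velI: "cdot (velI t x \<xi>) u = cdot \<xi> (g x *v (B x t *v u))"
  by (simp add: velI_def cdot_matrix[symmetric] matrix_vector_mul_assoc)

lemma cdot_velL: "cdot (velL t x) u = - \<i> * cdot (cconj (b x t)) u"
  by (simp add: velL_def cconj_scale cdot_scale cdot_minus)

lemma resolvent_cdot:
  "of_real (t - s) * cdot p (g x *v (B x t *v (B x s *v u)))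
   = d x s * cdot p (g x *v (B x t *v u)) - d x t * cdot p (g x *v (B x s *v u))"
  using arg_cong[OF resolvent[of t s x u], of "\<lambda>v. cdot p (g x *v v)"]
  by (simp add: matrix_vector_scale matrix_vector_mult_diff_distrib cdot_scale cdot_diff del: of_real_diff)

lemma G_quadratic_sym: assumes x: "x \<in> S"
  shows "cdot u (G x v *v w) = cdot v (G x u *v w)"
  by (simp add: cdot_matrix G_sym[OF x, of v u])

lemma DI_generic:
  assumes x: "x \<in> S" and d: "d x t \<noteq> 0"
  shows "DI t x \<xi> v = - Re (cdot (velI t x \<xi>) (G x v *v cconj \<xi>)
     + inverse (d x t) * (cdot v (B x t *v Lam x) * q x \<xi> t - a x \<xi> t * cdot v (B x t *v cconj \<xi>)))"
proof -
  let ?r = "inverse (d x t)" and ?B = "B x t"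
  define k where "k = cdot \<xi> (g x *v (?B *v (G x v *v cconj \<xi>)))"
  define l where "l = cdot v (?B *v Lam x)"
  define m where "m = cdot v (?B *v cconj \<xi>)"
  have kc: "cdot \<xi> (hadj (G x v) *v (g x *v (?B *v cconj \<xi>))) = cnj k"
  proof -
    have "hadj (hadj (G x v) ** (g x ** ?B)) = g x ** ?B ** G x v"
      by (simp add: hadj_mult[of "hadj (G x v)"] gB_herm[OF x])
    thus ?thesis using cdot_hadj[of "cconj \<xi>" "hadj (G x v) ** (g x ** ?B)" "cconj \<xi>"]
      by (simp add: k_def flip: matrix_vector_mul_assoc)
  qed
  have mc: "cdot \<xi> (g x *v (?B *v (h x *v cconj v))) = cnj m"
  proof -
    have "hadj (g x ** ?B ** h x) *v cconj \<xi> = ?B *v cconj \<xi>"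
      by (simp add: hadj_mult[of _ "h x"] gB_herm[OF x] h_herm[OF x] hg_vec[OF x] flip: matrix_vector_mul_assoc)
    thus ?thesis using cdot_hadj[of "cconj \<xi>" "g x ** ?B ** h x" "cconj v"]
      by (simp add: m_def flip: matrix_vector_mul_assoc)
  qed
  have "cdot \<xi> (g x *v (cofactor_deriv (At x t) (dA x v) *v cconj \<xi>) + dg x v *v (?B *v cconj \<xi>))
     = - (k + ?r * (l * q x \<xi> t - a x \<xi> t * m)) - (cnj k + ?r * (cnj l * q x \<xi> t - cnj (a x \<xi> t) * cnj m))"
    unfolding cofactor_deriv_dA[OF x d] dg_def
    by (simp add: matrix_vector_distribs matrix_vector_scale cdot_distribs cdot_gLam[OF x] kc mc
       flip: matrix_vector_mul_assoc)
       (simp add: k_def l_def m_def q_def a_def b_def algebra_simps)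
  also have "cnj k + ?r * (cnj l * q x \<xi> t - cnj (a x \<xi> t) * cnj m) = cnj (k + ?r * (l * q x \<xi> t - a x \<xi> t * m))"
    by (simp add: q_real[OF x] d_real[OF x])
  finally have "2 * DI t x \<xi> v = Re (- (k + ?r * (l * q x \<xi> t - a x \<xi> t * m)) - cnj (k + ?r * (l * q x \<xi> t - a x \<xi> t * m)))"
    by (simp add: DI_def)
  also have "\<dots> = - 2 * Re (k + ?r * (l * q x \<xi> t - a x \<xi> t * m))"
    unfolding minus_complex.simps uminus_complex.simps cnj.simps by simp
  finally show ?thesis by (simp add: k_def l_def m_def cdot_velI)
qed

text \<open>
  The derivative of \<open>b\<close> is complex antilinear in the direction: this is the holomorphy of \<open>K\<^sub>t\<close>, the
  conjugate of \<open>\<i> b\<close>. The term of the derivative of \<open>A\<close> that is linear in \<open>v\<close> has no effect, since it is a multiple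
  of \<open>Lam\<close> from the left and is applied to \<open>Lam\<close>.
\<close>

lemma db_generic:
  assumes x: "x \<in> S" and d: "d x t \<noteq> 0"
  shows "db t x v = - (hadj (G x v) *v b x t)
    - inverse (d x t) *s (cnj (cdot v (B x t *v Lam x)) *s b x t - c x t *s (g x *v (B x t *v (h x *v cconj v))))
    + g x *v (B x t *v (Hess x *v cconj v))"
  unfolding db_def cofactor_deriv_dA[OF x d] dg_def dLam_eq[OF x]
  by (simp add: matrix_vector_distribs matrix_vector_scale b_def c_def vec_scale_distribs
     flip: matrix_vector_mul_assoc)

text \<open>
  After multiplication by \<open>t - s\<close>, the resolvent identity cancels the factors \<open>d\<close> in front of the terms
  that are not manifestly symmetric in \<open>t\<close> and \<open>s\<close>.
\<close>

lemma II_generic: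
  assumes x: "x \<in> S" and dt: "d x t \<noteq> 0" "d x s \<noteq> 0" and ts: "t \<noteq> s"
  shows "DI t x \<xi> (velI s x \<xi>) - DI s x \<xi> (velI t x \<xi>) = 0"
proof -
  define k where "k = cdot (velI t x \<xi>) (G x (velI s x \<xi>) *v cconj \<xi>)"
  define \<delta> where "\<delta> = complex_of_real (t - s)"
  have nz: "\<delta> \<noteq> 0" using ts by (simp add: \<delta>_def)
  define l m where "l = cdot \<xi> (g x *v (B x t *v (B x s *v Lam x)))"
    and "m = cdot \<xi> (g x *v (B x t *v (B x s *v cconj \<xi>)))"
  have l: "\<delta> * l = d x s * a x \<xi> t - d x t * a x \<xi> s"
    unfolding l_def \<delta>_def resolvent_cdot by (simp add: a_def b_def)
  have m: "\<delta> * m = d x s * q x \<xi> t - d x t * q x \<xi> s"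
    unfolding m_def \<delta>_def resolvent_cdot by (simp add: q_def)
  have t: "DI t x \<xi> (velI s x \<xi>) = - Re (k + inverse (d x t) * (l * q x \<xi> t - a x \<xi> t * m))"
    unfolding DI_generic[OF x dt(1)] k_def[symmetric]
    by (simp add: cdot_velI B_commute_vec[of x s t] l_def m_def)
  have s: "DI s x \<xi> (velI t x \<xi>) = - Re (k + inverse (d x s) * (l * q x \<xi> s - a x \<xi> s * m))"
    unfolding DI_generic[OF x dt(2)] G_quadratic_sym[OF x, of "velI s x \<xi>"] k_def[symmetric]
    by (simp add: cdot_velI l_def m_def)
  have "inverse (d x t) * (\<delta> * l * q x \<xi> t - a x \<xi> t * (\<delta> * m))
      = inverse (d x s) * (\<delta> * l * q x \<xi> s - a x \<xi> s * (\<delta> * m))"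
    unfolding l m using dt by (simp add: field_simps)
  hence "\<delta> * (inverse (d x t) * (l * q x \<xi> t - a x \<xi> t * m)) = \<delta> * (inverse (d x s) * (l * q x \<xi> s - a x \<xi> s * m))"
    by (simp add: algebra_simps)
  hence "inverse (d x t) * (l * q x \<xi> t - a x \<xi> t * m) = inverse (d x s) * (l * q x \<xi> s - a x \<xi> s * m)"
    using nz by simp
  thus ?thesis unfolding t s by simp
qed

text \<open>
  Here the derivatives of the vectors \<open>b\<close> agree before they are paired with \<open>\<xi>\<close>: the fields \<open>K\<^sub>t\<close> and \<open>K\<^sub>s\<close>
  commute.
\<close>

lemma LL_generic:
  assumes x: "x \<in> S" and dt: "d x t \<noteq> 0" "d x s \<noteq> 0" and ts: "t \<noteq> s"
  shows "DL t x \<xi> (velL s x) - DL s x \<xi> (velL t x) = 0"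
proof -
  define \<delta> where "\<delta> = complex_of_real (t - s)"
  have nz: "\<delta> \<noteq> 0" using ts by (simp add: \<delta>_def)
  define w where "w = g x *v (B x t *v (B x s *v Lam x))"
  define k where "k = cdot (cconj (g x *v Lam x)) (B x t *v (B x s *v Lam x))"
  have w: "\<delta> *s w = d x s *s b x t - d x t *s b x s"
    using arg_cong[OF resolvent[of t s x "Lam x"], of "\<lambda>v. g x *v v"]
    by (simp add: w_def b_def \<delta>_def matrix_vector_scale matrix_vector_mult_diff_distrib del: of_real_diff)
  have k: "\<delta> * k = d x s * c x t - d x t * c x s"
    unfolding k_def \<delta>_def cdot_scale(2)[symmetric] resolvent
    by (simp add: c_def cdot_scale cdot_diff)
  have kr: "cnj k = k"
  proof -
    have "\<delta> * cnj k = cnj (\<delta> * k)" by (simp add: \<delta>_def)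
    also have "\<dots> = \<delta> * k" unfolding k by (simp add: d_real[OF x] c_real[OF x])
    finally have "\<delta> * cnj k = \<delta> * k" .
    thus ?thesis using nz by simp
  qed
  have yL_conj: "cconj (velL t x) = \<i> *s b x t" for t by (simp add: velL_def)
  have hyL: "h x *v cconj (velL t x) = \<i> *s (B x t *v Lam x)" for t
    by (simp add: yL_conj b_def matrix_vector_scale hg_vec[OF x])
  have kt: "cdot (velL s x) (B x t *v Lam x) = - \<i> * k"
    by (simp add: cdot_velL b_def cdot_gLam_B[OF x] B_commute_vec[of x s t] k_def)
  have ks: "cdot (velL t x) (B x s *v Lam x) = - \<i> * k"
    by (simp add: cdot_velL b_def cdot_gLam_B[OF x] k_def)
  have Gs: "hadj (G x (velL s x)) *v b x t = hadj (G x (velL t x)) *v b x s"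
  proof -
    have "hadj (G x (velL s x)) *v (\<i> *s b x t) = hadj (G x (velL t x)) *v (\<i> *s b x s)"
      using hadj_G_sym[OF x, of "velL s x" "velL t x"] by (simp add: yL_conj)
    thus ?thesis by (simp add: matrix_vector_scale)
  qed
  have Ms: "g x *v (B x t *v (Hess x *v b x s)) = g x *v (B x s *v (Hess x *v b x t))"
  proof -
    have "B x t *v (Hess x *v (g x *v (B x s *v Lam x))) = B x s *v (Hess x *v (g x *v (B x t *v Lam x)))"
      by (simp add: matrix_vector_mul_assoc)
         (metis B_Hess_g[OF x] B_commute matrix_mul_assoc)
    thus ?thesis by (simp add: b_def)
  qed
  have e: "inverse (d x t) *s (k *s b x t - c x t *s w) = inverse (d x s) *s (k *s b x s - c x s *s w)"
  proof -
    have "inverse (d x t) *s ((\<delta> * k) *s b x t - c x t *s (\<delta> *s w)) = inverse (d x s) *s ((\<delta> * k) *s b x s - c x s *s (\<delta> *s w))"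
      unfolding w k using dt by (simp add: vec_eq_iff field_simps)
    hence "\<delta> *s (inverse (d x t) *s (k *s b x t - c x t *s w)) = \<delta> *s (inverse (d x s) *s (k *s b x s - c x s *s w))"
      by (simp add: vec_eq_iff algebra_simps)
    thus ?thesis using nz unfolding vector_mul_lcancel by blast
  qed
  have t: "db t x (velL s x) = - (hadj (G x (velL s x)) *v b x t)
     - \<i> *s (inverse (d x t) *s (k *s b x t - c x t *s w)) + \<i> *s (g x *v (B x t *v (Hess x *v b x s)))"
    unfolding db_generic[OF x dt(1)] hyL kt
    by (simp add: yL_conj matrix_vector_scale w_def kr vec_eq_iff algebra_simps)
  have s: "db s x (velL t x) = - (hadj (G x (velL t x)) *v b x s)
     - \<i> *s (inverse (d x s) *s (k *s b x s - c x s *s w)) + \<i> *s (g x *v (B x s *v (Hess x *v b x t)))"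
    unfolding db_generic[OF x dt(2)] hyL ks
    by (simp add: yL_conj matrix_vector_scale w_def B_commute_vec[of x s t] kr vec_eq_iff algebra_simps)
  have "db t x (velL s x) = db s x (velL t x)" unfolding t s Gs Ms e ..
  thus ?thesis by (simp add: DL_def)
qed

text \<open>
  The term with the Hessian is real because \<open>Hess x ** g x\<close> and \<open>B\<close> commute, and so are the terms with \<open>c\<close> and
  \<open>q\<close>; they do not contribute to the real part of \<open>\<i>\<close> times them. The remaining ones are products of \<open>a\<close> at \<open>t\<close> and \<open>s\<close> and
  their conjugates; they cancel by the resolvent identity.
\<close>

lemma LI_generic:
  assumes x: "x \<in> S" and dt: "d x t \<noteq> 0" "d x s \<noteq> 0" and ts: "t \<noteq> s"
  shows "DL t x \<xi> (velI s x \<xi>) - DI s x \<xi> (velL t x) = 0"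
proof -
  define \<delta> where "\<delta> = complex_of_real (t - s)"
  have nz: "\<delta> \<noteq> 0" using ts by (simp add: \<delta>_def)
  define l where "l = cdot \<xi> (g x *v (B x t *v (B x s *v Lam x)))"
  define n where "n = cdot \<xi> (g x *v (B x t *v (B x s *v cconj \<xi>)))"
  define mm where "mm = cdot \<xi> (g x *v (B x t *v (Hess x *v (g x *v (B x s *v cconj \<xi>)))))"
  define p where "p = cdot (cconj (b x t)) (B x s *v Lam x)"
  define k where "k = cdot (velI s x \<xi>) (G x (cconj (b x t)) *v cconj \<xi>)"
  have l: "\<delta> * l = d x s * a x \<xi> t - d x t * a x \<xi> s"
    unfolding l_def \<delta>_def resolvent_cdot by (simp add: a_def b_def)
  have n: "\<delta> * n = d x s * q x \<xi> t - d x t * q x \<xi> s"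
    unfolding n_def \<delta>_def resolvent_cdot by (simp add: q_def)
  have \<delta>r: "cnj \<delta> = \<delta>" by (simp add: \<delta>_def)
  have nr: "cnj n = n"
  proof -
    have "\<delta> * cnj n = cnj (\<delta> * n)" by (simp add: \<delta>r)
    also have "\<dots> = \<delta> * n" unfolding n by (simp add: d_real[OF x] q_real[OF x])
    finally have "\<delta> * cnj n = \<delta> * n" .
    thus ?thesis using nz by simp
  qed
  have pr: "cnj p = p"
  proof -
    have p: "\<delta> * p = d x s * c x t - d x t * c x s"
      unfolding p_def \<delta>_def b_def cdot_gLam_B[OF x] cdot_scale(2)[symmetric] resolvent
      by (simp add: c_def cdot_scale cdot_diff)
    have "\<delta> * cnj p = cnj (\<delta> * p)" by (simp add: \<delta>r)
    also have "\<dots> = \<delta> * p" unfolding p by (simp add: d_real[OF x] c_real[OF x])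
    finally have "\<delta> * cnj p = \<delta> * p" .
    thus ?thesis using nz by simp
  qed
  have mr: "cnj mm = mm"
  proof -
    have "hadj (g x ** B x t ** (Hess x ** (g x ** B x s))) = g x ** B x t ** (Hess x ** (g x ** B x s))"
    proof -
      have "hadj (g x ** B x t ** (Hess x ** (g x ** B x s))) = g x ** (B x s ** (Hess x ** g x) ** B x t)"
        unfolding hadj_mult[of "g x ** B x t"] hadj_mult[of "Hess x"] gB_herm[OF x] Hess_herm[OF x]
        by (simp only: matrix_mul_assoc)
      also have "B x s ** (Hess x ** g x) ** B x t = B x t ** (Hess x ** g x) ** B x s"
        by (metis B_Hess_g[OF x] B_commute matrix_mul_assoc)
      finally show ?thesis by (simp add: matrix_mul_assoc)
    qed
    from cdot_hadj[of "cconj \<xi>" "g x ** B x t ** (Hess x ** (g x ** B x s))" "cconj \<xi>", unfolded this]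
    show ?thesis by (simp add: mm_def matrix_vector_mul_assoc matrix_mul_assoc)
  qed
  have yconj: "cconj (velI s x \<xi>) = g x *v (B x s *v cconj \<xi>)"
    by (simp add: velI_def cconj_matrix gB_herm[OF x] matrix_vector_mul_assoc)
       (metis gB_herm[OF x] hadj_vector_cconj cconj_matrix cconj_cconj)
  have Gt: "cdot \<xi> (hadj (G x (velI s x \<xi>)) *v b x t) = cnj k"
    using cdot_hadj[of "cconj \<xi>" "hadj (G x (velI s x \<xi>))" "b x t"]
    by (simp add: k_def G_quadratic_sym[OF x, of "velI s x \<xi>"])
  have L: "cdot \<xi> (db t x (velI s x \<xi>)) = - cnj k - inverse (d x t) * (cnj l * a x \<xi> t - c x t * n) + mm"
    unfolding db_generic[OF x dt(1)] yconj hg_vec[OF x] cdot_velI B_commute_vec[of x s t]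
    by (simp add: cdot_distribs Gt l_def n_def mm_def a_def right_diff_distrib)
  have yLG: "G x (velL t x) = mat (- \<i>) ** G x (cconj (b x t))"
    by (simp add: velL_def cconj_scale G_scale[OF x, symmetric])
  have "cdot (cconj (b x t)) (B x s *v cconj \<xi>) = cnj l"
    using cdot_hadj[of "b x t" "B x s" "cconj \<xi>"] by (simp add: b_def B_g_vec[OF x] l_def B_commute_vec[of x s t])
  hence I: "DI s x \<xi> (velL t x) = - Re (- \<i> * k + inverse (d x s) * (- \<i> * p * q x \<xi> s + \<i> * a x \<xi> s * cnj l))"
    unfolding DI_generic[OF x dt(2)] cdot_velL yLG
    by (simp add: p_def k_def mat_mult_vector cdot_scale cdot_minus flip: matrix_vector_mul_assoc)
  \<comment> \<open>From here on, a computation with real and imaginary parts.\<close>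
  define r where "r t = Re (d x t)" for t
  have dr: "d x t = of_real (r t)" for t using d_real[OF x, of t] by (simp add: r_def complex_eq_iff)
  have rnz: "r t \<noteq> 0" "r s \<noteq> 0" using dt by (simp_all add: dr)
  have cr: "Im (c x t) = 0" for t using c_real[OF x, of t] by (simp add: complex_eq_iff)
  have qr: "Im (q x \<xi> t) = 0" for t using q_real[OF x, of \<xi> t] by (simp add: complex_eq_iff)
  have r0: "Im n = 0" "Im mm = 0" "Im p = 0" using nr mr pr by (simp_all add: complex_eq_iff)
  define \<epsilon> where "\<epsilon> = t - s"
  have \<epsilon>: "\<epsilon> \<noteq> 0" "\<delta> = of_real \<epsilon>" using ts by (simp_all add: \<epsilon>_def \<delta>_def)
  have l': "\<epsilon> * Re l = r s * Re (a x \<xi> t) - r t * Re (a x \<xi> s)" "\<epsilon> * Im l = r s * Im (a x \<xi> t) - r t * Im (a x \<xi> s)"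
    using arg_cong[OF l, of Re] arg_cong[OF l, of Im] by (simp_all add: dr \<epsilon>)
  have E: "DL t x \<xi> (velI s x \<xi>) - DI s x \<xi> (velL t x)
     = (Im (cnj l * a x \<xi> t)) / r t - Im (a x \<xi> s * cnj l) / r s"
    unfolding DL_def L I by (simp add: dr cr qr r0 of_real_inverse[symmetric] field_simps del: of_real_inverse)
      (simp add: diff_divide_distrib)
  have "\<epsilon> * (DL t x \<xi> (velI s x \<xi>) - DI s x \<xi> (velL t x))
     = ((\<epsilon> * Re l) * Im (a x \<xi> t) - (\<epsilon> * Im l) * Re (a x \<xi> t)) / r t
       - (Im (a x \<xi> s) * (\<epsilon> * Re l) - Re (a x \<xi> s) * (\<epsilon> * Im l)) / r s"
    unfolding E using rnz by (simp add: field_simps)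
  also have "\<dots> = 0" unfolding l' using rnz by (simp add: field_simps)
  finally show ?thesis using \<epsilon> by simp
qed

lemma lin_cont: assumes "(f has_derivative f') (at x)" "continuous_on UNIV u" shows "continuous_on UNIV (\<lambda>t. f' (u t))"
  using bounded_linear.continuous_on[OF has_derivative_bounded_linear[OF assms(1)] assms(2)] .

lemma cont:
  assumes x: "x \<in> S" and u: "continuous_on UNIV u"
  shows "continuous_on UNIV (\<lambda>t::real. DI s x \<xi> (u t))" "continuous_on UNIV (\<lambda>t::real. DL s x \<xi> (u t))"
    "continuous_on UNIV (\<lambda>t. DI t x \<xi> v)" "continuous_on UNIV (\<lambda>t. DL t x \<xi> v)"
    "continuous_on UNIV (\<lambda>t. velI t x \<xi>)" "continuous_on UNIV (\<lambda>t. velL t x)"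
proof -
  have B: "continuous_on UNIV (B x)" unfolding B_def[abs_def] At_def by (intro continuous_intros)
  have At: "continuous_on UNIV (At x)" unfolding At_def[abs_def] by (intro continuous_intros)
  note c = continuous_intros B At lin_cont[OF dA[OF x] u] lin_cont[OF dg[OF x] u] lin_cont[OF dLam[OF x] u]
  show "continuous_on UNIV (\<lambda>t. DI s x \<xi> (u t))" unfolding DI_def by (intro c)
  show "continuous_on UNIV (\<lambda>t. DL s x \<xi> (u t))" unfolding DL_def db_def by (intro c)
  show "continuous_on UNIV (\<lambda>t. DI t x \<xi> v)" unfolding DI_def by (intro continuous_intros B At)
  show "continuous_on UNIV (\<lambda>t. DL t x \<xi> v)" unfolding DL_def db_def by (intro continuous_intros B At)
  have "velI t x \<xi> = \<xi> v* (g x ** B x t)" for t by (simp add: velI_def transpose_matrix_vector)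
  thus "continuous_on UNIV (\<lambda>t. velI t x \<xi>)"
    by (simp add: vector_matrix_mult_def) (intro continuous_on_vec_lambda continuous_intros B)
  show "continuous_on UNIV (\<lambda>t. velL t x)" unfolding velL_def b_def by (intro continuous_intros B)
qed

lemma brackets_vanish:
  assumes x: "x \<in> S"
  shows "DI t x \<xi> (velI s x \<xi>) - DI s x \<xi> (velI t x \<xi>) = 0"
    and "DL t x \<xi> (velL s x) - DL s x \<xi> (velL t x) = 0"
    and "DL t x \<xi> (velI s x \<xi>) - DI s x \<xi> (velL t x) = 0"
proof -
  have Z: "finite {t. d x t = 0}" unfolding d_def At_def by (rule finite_real_eigenvalues)
  have y: "continuous_on UNIV (\<lambda>t. velI t x \<xi>)" "continuous_on UNIV (\<lambda>t. velL t x)"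
    using cont(5,6)[OF x continuous_on_const] by auto
  note c = cont(1,2)[OF x y(1)] cont(1,2)[OF x y(2)] cont(3,4)[OF x y(1)]
  show "DI t x \<xi> (velI s x \<xi>) - DI s x \<xi> (velI t x \<xi>) = 0"
    by (rule zero_if_generically_zero[OF Z], rule II_generic[OF x], simp, simp, assumption)
       (intro continuous_on_diff c)+
  show "DL t x \<xi> (velL s x) - DL s x \<xi> (velL t x) = 0"
    by (rule zero_if_generically_zero[OF Z], rule LL_generic[OF x], simp, simp, assumption)
       (intro continuous_on_diff c)+
  show "DL t x \<xi> (velI s x \<xi>) - DI s x \<xi> (velL t x) = 0"
    by (rule zero_if_generically_zero[OF Z], rule LI_generic[OF x], simp, simp, assumption)
       (intro continuous_on_diff c)+
qed

end

section \<open>The metrisability equation in a chart\<close>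

lemma smooth_on_differentiable:
  assumes "smooth_on S f" "open S" "x \<in> S" shows "f differentiable (at x)"
proof -
  have "Ck_on (Suc 0) S f" using assms(1) by (simp only: smooth_on_def)
  hence "f differentiable_on S" by simp
  thus ?thesis using assms(2,3) by (simp add: differentiable_on_eq_differentiable_at)
qed

lemma chartD:
  assumes "complex_atlas \<A>" "c \<in> \<A>"
  shows "open (fst c)" "open (snd c ` fst c)" "continuous_on (fst c) (snd c)"
    and "\<And>p. p \<in> fst c \<Longrightarrow> inv_into (fst c) (snd c) (snd c p) = p"
    and "continuous_on (snd c ` fst c) (inv_into (fst c) (snd c))"
proof -
  have "is_chart c" using assms by (auto simp: complex_atlas_def)
  hence "open (fst c)" "open (snd c ` fst c)"
    and h: "homeomorphism (fst c) (snd c ` fst c) (snd c) (inv_into (fst c) (snd c))"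
    by (auto simp: is_chart_def)
  thus "open (fst c)" "open (snd c ` fst c)" by auto
  show "continuous_on (fst c) (snd c)" "\<And>p. p \<in> fst c \<Longrightarrow> inv_into (fst c) (snd c) (snd c p) = p"
    "continuous_on (snd c ` fst c) (inv_into (fst c) (snd c))"
    using h by (auto simp: homeomorphism_def)
qed

lemma section_differentiable:
  assumes "complex_atlas \<A>" "c \<in> \<A>" "smooth_section \<A> \<sigma>" "x \<in> snd c ` fst c"
  shows "in_chart c (\<sigma> c) differentiable (at x)"
  using assms by (intro smooth_on_differentiable[OF _ chartD(2)[OF assms(1,2)]]) (auto simp: smooth_section_def)

lemma differentiable_vec_lambda:
  fixes f :: "'i::finite \<Rightarrow> 'a::real_normed_vector \<Rightarrow> 'b::euclidean_space"
  assumes "\<And>i. f i differentiable (at x)"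
  shows "(\<lambda>x. \<chi> i. f i x) differentiable (at x)"
proof -
  have "(f i has_derivative frechet_derivative (f i) (at x)) (at x)" for i
    using assms frechet_derivative_works by blast
  hence "((\<lambda>x. \<chi> i. f i x) has_derivative (\<lambda>h. \<chi> i. frechet_derivative (f i) (at x) h)) (at x)"
    by (rule has_derivative_vec_lambda)
  thus ?thesis by (auto simp: differentiable_def)
qed

lemma differentiable_matrix_vector_mult:
  fixes f :: "'a::real_normed_vector \<Rightarrow> complex^'n^'n::finite"
  shows "f differentiable (at x) \<Longrightarrow> g differentiable (at x) \<Longrightarrow> (\<lambda>x. f x *v g x) differentiable (at x)"
  unfolding differentiable_def using has_derivative_matrix_vector_mult by blast

lemma differentiable_cconj:
  "f differentiable (at x) \<Longrightarrow> (\<lambda>x. cconj (f x)) differentiable (at x)"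
  unfolding differentiable_def using has_derivative_cconj by blast

lemma differentiable_outer:
  fixes f :: "'a::real_normed_vector \<Rightarrow> complex^'n::finite"
  shows "f differentiable (at x) \<Longrightarrow> g differentiable (at x) \<Longrightarrow> (\<lambda>x. outer (f x) (g x)) differentiable (at x)"
  unfolding differentiable_def using has_derivative_outer by blast

lemma differentiable_mat_cdot:
  fixes f :: "'a::real_normed_vector \<Rightarrow> complex^'n::finite"
  assumes "f differentiable (at x)" shows "(\<lambda>x. mat (cdot (f x) v) :: complex^'n^'n) differentiable (at x)"
  using assms has_derivative_mat[OF has_derivative_cdot[OF _ has_derivative_const]]
  unfolding differentiable_def by blast

text \<open>
  The transpose of the endomorphism \<open>w \<mapsto> \<Gamma>(v,w)\<close> of \<open>T\<^sup>1\<^sup>,\<^sup>0M\<close>, so that it acts on the unbarred second index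
  of a Hermitian section by multiplication from the right.
\<close>

definition conn_matrix :: "('m, 'n::finite) connection \<Rightarrow> ('m, 'n) chart \<Rightarrow> 'm \<Rightarrow> complex^'n \<Rightarrow> complex^'n^'n" where
  "conn_matrix \<Gamma> c p v = transpose (matrix (\<Gamma> c p v))"

lemma complex_connectionD:
  assumes "complex_connection \<A> \<Gamma>" "c \<in> \<A>" "p \<in> fst c"
  shows "bilinear (\<Gamma> c p)" "\<Gamma> c p v w = \<Gamma> c p w v" "\<Gamma> c p v (\<i> *s w) = \<i> *s \<Gamma> c p v w"
    "\<Gamma> c p (\<i> *s v) w = \<i> *s \<Gamma> c p v w" "\<Gamma> c p v w = transpose (conn_matrix \<Gamma> c p v) *v w"
proof -
  show b: "bilinear (\<Gamma> c p)" and s: "\<And>v w. \<Gamma> c p v w = \<Gamma> c p w v"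
    and j: "\<And>v w. \<Gamma> c p v (\<i> *s w) = \<i> *s \<Gamma> c p v w"
    using assms by (auto simp: complex_connection_def affine_connection_def torsion_free_def
        preserves_J_def Jstr_def)
  show "\<Gamma> c p (\<i> *s v) w = \<i> *s \<Gamma> c p v w" by (simp only: s[of _ w] j)
  have "linear (\<Gamma> c p v)" using b by (simp add: bilinear_def)
  thus "\<Gamma> c p v w = transpose (conn_matrix \<Gamma> c p v) *v w"
    unfolding conn_matrix_def transpose_transpose by (rule complex_linear_matrix(2)[where F = "\<Gamma> c p v", OF _ j])
qed

lemma conn_matrix_scale:
  assumes "complex_connection \<A> \<Gamma>" "c \<in> \<A>" "p \<in> fst c"
  shows "conn_matrix \<Gamma> c p (z *s v) = mat z ** conn_matrix \<Gamma> c p v"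
    and "conn_matrix \<Gamma> c p (v + w) = conn_matrix \<Gamma> c p v + conn_matrix \<Gamma> c p w"
    and "transpose (conn_matrix \<Gamma> c p v) *v w = transpose (conn_matrix \<Gamma> c p w) *v v"
proof -
  note C = complex_connectionD[OF assms]
  have "linear (\<lambda>v. \<Gamma> c p v u)" for u using C(1) by (simp add: bilinear_def)
  note L = complex_linear_matrix(1)[OF this C(4)] linear_add[OF this]
  show "conn_matrix \<Gamma> c p (z *s v) = mat z ** conn_matrix \<Gamma> c p v"
    by (simp add: conn_matrix_def matrix_def mat_scal transpose_def vec_eq_iff L)
  show "conn_matrix \<Gamma> c p (v + w) = conn_matrix \<Gamma> c p v + conn_matrix \<Gamma> c p w"
    by (simp add: conn_matrix_def matrix_def transpose_def vec_eq_iff L)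
  show "transpose (conn_matrix \<Gamma> c p v) *v w = transpose (conn_matrix \<Gamma> c p w) *v v"
    unfolding C(5)[symmetric] by (rule C(2))
qed

lemma sum_Basis_vec:
  "(\<Sum>i\<in>(Basis :: (complex^'n::finite) set). f i) = (\<Sum>j\<in>UNIV. f (axis j 1) + f (axis j \<i>))"
proof -
  let ?h = "\<lambda>p. axis (fst p) (snd p) :: complex^'n"
  have B: "(Basis :: (complex^'n) set) = ?h ` (UNIV \<times> {1, \<i>})"
    by (force simp: Basis_vec_def Basis_complex_def)
  have "inj_on ?h (UNIV \<times> {1, \<i>})"
    by (auto simp: inj_on_def axis_eq_axis)
  hence "(\<Sum>i\<in>(Basis :: (complex^'n) set). f i) = (\<Sum>p\<in>UNIV \<times> {1, \<i>}. f (?h p))"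
    unfolding B by (simp only: sum.reindex o_def)
  thus ?thesis by (simp add: sum.cartesian_product')
qed

lemma axis_i: "axis j \<i> = \<i> *s axis j (1::complex)"
  by (simp add: axis_def vec_eq_iff)

lemma real_trace_connection:
  assumes "complex_connection \<A> \<Gamma>" "c \<in> \<A>" "p \<in> fst c"
  shows "(\<Sum>i\<in>Basis. \<Gamma> c p v i \<bullet> i) = 2 * Re (trace (conn_matrix \<Gamma> c p v))"
proof -
  have "\<Gamma> c p v (axis j \<i>) = \<i> *s \<Gamma> c p v (axis j 1)" for j
    by (simp only: axis_i complex_connectionD(3)[OF assms])
  hence "\<Gamma> c p v (axis j 1) \<bullet> axis j 1 + \<Gamma> c p v (axis j \<i>) \<bullet> axis j \<i> = 2 * Re (conn_matrix \<Gamma> c p v $ j $ j)" for j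
    by (simp add: inner_axis inner_complex_def conn_matrix_def transpose_def matrix_def)
  thus ?thesis by (simp add: sum_Basis_vec trace_def sum_distrib_left)
qed

lemma covd_matrix:
  fixes \<eta> :: "('m::topological_space, 'n::finite) herm_field"
  assumes "complex_connection \<A> \<Gamma>" "c \<in> \<A>" "p \<in> fst c"
  shows "covd \<Gamma> \<eta> c p v = dird c (\<eta> c) p v + hadj (conn_matrix \<Gamma> c p v) ** \<eta> c p
    + \<eta> c p ** conn_matrix \<Gamma> c p v
    - (2 * Re (trace (conn_matrix \<Gamma> c p v)) / (real CARD('n) + 1)) *\<^sub>R \<eta> c p"
  unfolding covd_def real_trace_connection[OF assms]
  by (simp add: vec_eq_iff matrix_matrix_mult_def hadj_def conn_matrix_def transpose_def matrix_def
      mult.commute scaleR_conv_of_real[where 'a = complex])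

lemma scaleR_real_mat: "r *\<^sub>R X = mat (of_real r) ** X" for X :: "complex^'n^'n::finite"
  by (simp add: mat_scal vec_eq_iff scaleR_conv_of_real[where 'a = complex])

lemma linear_conn_matrix:
  assumes "complex_connection \<A> \<Gamma>" "c \<in> \<A>" "p \<in> fst c"
  shows "linear (conn_matrix \<Gamma> c p)"
  by (auto intro!: linearI simp: conn_matrix_scale[OF assms] scaleR_vec_scale scaleR_real_mat)

text \<open>
  The two halves of the metrisability equation are the complex linear and the antilinear part of one
  equation for the derivative in the direction of a real vector. Both sides are real linear in this
  vector, so it is enough to compare them on the real coordinate basis.
\<close>

lemma metrisability_equation_real:
  fixes \<eta> :: "('m::topological_space, 'n::finite) herm_field"
  assumes con: "complex_connection \<A> \<Gamma>" "c \<in> \<A>" "p \<in> fst c"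
    and eq: "\<And>a b d. nabla10 \<Gamma> \<eta> c p a $ b $ d + (if a = d then cnj (X $ b) else 0) = 0"
      "\<And>a b d. nabla01 \<Gamma> \<eta> c p a $ b $ d + (if a = b then X $ d else 0) = 0"
    and lin: "linear (dird c (\<eta> c) p)"
  shows "covd \<Gamma> \<eta> c p v = - outer (cconj X) v - outer (cconj v) X"
proof -
  have "linear (covd \<Gamma> \<eta> c p)"
    by (auto intro!: linearI simp: covd_matrix[OF con] linear_add[OF lin] linear_cmul[OF lin]
        linear_add[OF linear_conn_matrix[OF con]] linear_cmul[OF linear_conn_matrix[OF con]]
        hadj_distribs matrix_distribs trace_add matrix_scaleR_left matrix_scaleR_right
        linear_cmul[OF linear_trace] algebra_simps add_divide_distrib)
  moreover have "linear (\<lambda>v. - outer (cconj X) v - outer (cconj v) X)"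
    by (auto intro!: linearI simp: outer_add cconj_add linear_cmul[OF linear_cconj])
      (simp add: outer_def vec_eq_iff algebra_simps)
  ultimately have "covd \<Gamma> \<eta> c p = (\<lambda>v. - outer (cconj X) v - outer (cconj v) X)"
  proof (rule linear_eq_stdbasis)
    fix i :: "complex^'n" assume "i \<in> Basis"
    then obtain a where a: "i = axis a 1 \<or> i = axis a \<i>" by (auto simp: Basis_vec_def Basis_complex_def)
    have 1: "covd \<Gamma> \<eta> c p (axis a 1) $ b $ d = nabla10 \<Gamma> \<eta> c p a $ b $ d + nabla01 \<Gamma> \<eta> c p a $ b $ d" for b d
      by (simp add: nabla10_def nabla01_def field_simps)
    have 2: "covd \<Gamma> \<eta> c p (axis a \<i>) $ b $ d = \<i> * (nabla10 \<Gamma> \<eta> c p a $ b $ d - nabla01 \<Gamma> \<eta> c p a $ b $ d)" for b d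
      by (simp add: nabla10_def nabla01_def field_simps)
    have e: "nabla10 \<Gamma> \<eta> c p a $ b $ d = - (if a = d then cnj (X $ b) else 0)"
      "nabla01 \<Gamma> \<eta> c p a $ b $ d = - (if a = b then X $ d else 0)" for b d
      using eq[of a b d] by (simp_all add: eq_neg_iff_add_eq_0)
    show "covd \<Gamma> \<eta> c p i = - outer (cconj X) i - outer (cconj i) X"
      using a
    proof
      assume i: "i = axis a 1"
      show ?thesis unfolding i by (simp add: vec_eq_iff 1 e outer_def cconj_def) (auto simp: axis_def)
    next
      assume i: "i = axis a \<i>"
      show ?thesis unfolding i
        by (simp add: vec_eq_iff 2 e outer_def cconj_def) (auto simp: axis_def algebra_simps)
    qed
  qed
  thus ?thesis by simp
qed

lemma cdot_complex_part:
  fixes U :: "complex^'n::finite \<Rightarrow> real"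
  assumes lin: "linear U"
  defines "u \<equiv> \<chi> j. (of_real (U (axis j 1)) - \<i> * of_real (U (axis j \<i>))) / 2"
  shows "cdot u v = (of_real (U v) - \<i> * of_real (U (\<i> *s v))) / 2"
proof -
  have rep: "U w = (\<Sum>j\<in>UNIV. Re (w $ j) * U (axis j 1) + Im (w $ j) * U (axis j \<i>))" for w
  proof -
    have "U w = U (\<Sum>i\<in>Basis. (w \<bullet> i) *\<^sub>R i)" by (simp add: euclidean_representation)
    also have "\<dots> = (\<Sum>j\<in>UNIV. Re (w $ j) * U (axis j 1) + Im (w $ j) * U (axis j \<i>))"
      by (simp add: linear_sum[OF lin] linear_cmul[OF lin] linear_add[OF lin] sum_Basis_vec inner_axis inner_complex_def)
    finally show ?thesis .
  qed
  have "Re (cdot u v) = U v / 2" unfolding rep[of v]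
    by (simp add: cdot_def u_def sum_divide_distrib) (intro sum.cong, auto simp: field_simps)
  moreover have "Im (cdot u v) = - U (\<i> *s v) / 2" unfolding rep[of "\<i> *s v"]
    by (simp add: cdot_def u_def sum_divide_distrib sum_negf[symmetric]) (intro sum.cong, auto simp: field_simps)
  ultimately show ?thesis by (simp add: complex_eq_iff)
qed

text \<open>
  A c-projective change is \<open>\<Gamma>\<^bsub>ab\<^esub>\<^sup>c + \<upsilon>\<^sub>a \<delta>\<^sub>b\<^sup>c + \<upsilon>\<^sub>b \<delta>\<^sub>a\<^sup>c\<close> where \<open>\<upsilon>\<close> is the \<open>(1,0)\<close>-part of the real one-form.
\<close>

lemma cproj_conn_matrix:
  fixes \<Gamma> \<Gamma>' :: "('m::topological_space, 'n::finite) connection"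
  assumes lin: "linear U"
    and eq: "\<And>X Y. \<Gamma>' c p X Y = \<Gamma> c p X Y +
        (1/2) *\<^sub>R (U X *\<^sub>R Y + U Y *\<^sub>R X - U (Jstr X) *\<^sub>R Jstr Y - U (Jstr Y) *\<^sub>R Jstr X)"
  defines "u \<equiv> \<chi> j. (of_real (U (axis j 1)) - \<i> * of_real (U (axis j \<i>))) / 2"
  shows "conn_matrix \<Gamma>' c p v = conn_matrix \<Gamma> c p v + mat (cdot u v) + outer u v"
proof -
  have "cdot u v = (of_real (U v) - \<i> * of_real (U (\<i> *s v))) / 2"
    unfolding u_def by (rule cdot_complex_part[OF lin])
  thus ?thesis
    by (simp add: vec_eq_iff conn_matrix_def matrix_def transpose_def eq Jstr_def axis_i[symmetric] mat_def outer_def u_def)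
      (auto simp: axis_def complex_eq_iff field_simps)
qed

text \<open>
  C-projective invariance of the metrisability equation: on a section of weight \<open>(-1,-1)\<close> the term
  \<open>cdot \<upsilon> v\<close> cancels against the change of the weight, and the remaining change is absorbed by \<open>w\<close>.
\<close>

lemma gauge_change:
  fixes K :: "complex^'n^'n::finite" and T :: "complex^'n^'n"
  assumes T: "hadj T = T" and G: "G = K + mat (cdot \<upsilon> v) + outer \<upsilon> v"
  shows "(2 * Re (trace K) / (real CARD('n) + 1)) *\<^sub>R T - T ** K - hadj K ** T - outer w v - outer (cconj v) (cconj w)
     = (2 * Re (trace G) / (real CARD('n) + 1)) *\<^sub>R T - T ** G - hadj G ** T
      - outer (w - T *v \<upsilon>) v - outer (cconj v) (cconj (w - T *v \<upsilon>))"
proof -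
  define z where "z = cdot \<upsilon> v"
  have "Re (trace G) / (real CARD('n) + 1) = Re (trace K) / (real CARD('n) + 1) + Re z"
    by (simp add: G trace_add trace_outer z_def[symmetric] field_simps) (simp add: trace_def mat_def algebra_simps)
  hence tr: "2 * Re (trace G) / (real CARD('n) + 1) = 2 * Re (trace K) / (real CARD('n) + 1) + 2 * Re z"
    by simp
  have "complex_of_real (2 * Re z) = z + cnj z" by (simp add: complex_add_cnj)
  hence zz: "(2 * Re z) *\<^sub>R T = mat z ** T + mat (cnj z) ** T"
    unfolding scaleR_real_mat by (simp add: mat_scal vec_eq_iff algebra_simps)
  have Tw: "cconj (T *v \<upsilon>) = transpose T *v cconj \<upsilon>" by (simp add: cconj_matrix T)
  show ?thesis
    unfolding tr scaleR_left_distrib zz unfolding G z_def[symmetric]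
    by (simp add: hadj_add hadj_mat hadj_outer matrix_distribs mat_commute[of T]
            outer_mult_matrix matrix_mult_outer cconj_diff outer_diff Tw algebra_simps)
qed

text \<open>
  The two solutions of a pencil may satisfy the metrisability equation for different connections of
  the class. Referring both to the same connection is possible because only the right hand side \<open>u\<close>
  is affected.
\<close>

lemma solution_in_chart:
  fixes \<A> :: "('m::{t2_space, second_countable_topology}, 'n::finite) chart set"
  assumes atlas: "complex_atlas \<A>" and c: "c \<in> \<A>" and con: "complex_connection \<A> \<Gamma>\<^sub>0"
    and P: "\<P> = {\<Gamma>'. complex_connection \<A> \<Gamma>' \<and> cproj_equiv \<A> \<Gamma>\<^sub>0 \<Gamma>'}"
    and sol: "metrisability_solution \<A> \<P> \<eta>"
  obtains u where "\<And>x. x \<in> snd c ` fst c \<Longrightarrow> u differentiable (at x)"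
    and "\<And>x. x \<in> snd c ` fst c \<Longrightarrow> (in_chart c (\<eta> c) has_derivative (\<lambda>v.
        let E = in_chart c (\<eta> c) x; K = in_chart c (\<lambda>p. conn_matrix \<Gamma>\<^sub>0 c p v) x in
        (2 * Re (trace K) / (real CARD('n) + 1)) *\<^sub>R E - E ** K - hadj K ** E
        - outer (u x) v - outer (cconj v) (cconj (u x)))) (at x)"
proof -
  let ?S = "snd c ` fst c"
  let ?E = "in_chart c (\<eta> c)"
  from sol P obtain \<Gamma> where her: "real_herm_section \<A> \<eta>" and con': "complex_connection \<A> \<Gamma>"
    and eqv: "cproj_equiv \<A> \<Gamma>\<^sub>0 \<Gamma>" and met: "metrisability_equation \<A> \<Gamma> \<eta>"
    by (auto simp: metrisability_solution_def)
  from eqv obtain \<Upsilon> where U: "real_one_form \<A> \<Upsilon>"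
    and Gamma: "\<And>p X Y. p \<in> fst c \<Longrightarrow> \<Gamma> c p X Y = \<Gamma>\<^sub>0 c p X Y +
        (1/2) *\<^sub>R (\<Upsilon> c p X *\<^sub>R Y + \<Upsilon> c p Y *\<^sub>R X
                 - \<Upsilon> c p (Jstr X) *\<^sub>R Jstr Y - \<Upsilon> c p (Jstr Y) *\<^sub>R Jstr X)"
    using c by (auto simp: cproj_equiv_def)
  from met obtain X where X: "weighted_vector_section \<A> X"
    and eqs: "\<And>p a b d. p \<in> fst c \<Longrightarrow> nabla10 \<Gamma> \<eta> c p a $ b $ d + (if a = d then cnj (X c p $ b) else 0) = 0"
      "\<And>p a b d. p \<in> fst c \<Longrightarrow> nabla01 \<Gamma> \<eta> c p a $ b $ d + (if a = b then X c p $ d else 0) = 0"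
    using c by (auto simp: metrisability_equation_def)
  define \<upsilon> where "\<upsilon> p = (\<chi> j. (complex_of_real (\<Upsilon> c p (axis j 1)) - \<i> * of_real (\<Upsilon> c p (axis j \<i>))) / 2)" for p
  define u where "u x = cconj (in_chart c (X c) x) + ?E x *v in_chart c \<upsilon> x" for x
  have Ed: "?E differentiable (at x)" if "x \<in> ?S" for x
    using her that by (intro section_differentiable[OF atlas c]) (auto simp: real_herm_section_def)
  have Xd: "in_chart c (X c) differentiable (at x)" if "x \<in> ?S" for x
    using X that by (intro section_differentiable[OF atlas c]) (auto simp: weighted_vector_section_def)
  have Ud: "in_chart c (\<lambda>p. \<Upsilon> c p w) differentiable (at x)" if "x \<in> ?S" for x w
    using section_differentiable[OF atlas c, of "\<lambda>c p. \<Upsilon> c p w" x] U that by (auto simp: real_one_form_def)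
  have \<upsilon>d: "in_chart c \<upsilon> differentiable (at x)" if x: "x \<in> ?S" for x
  proof -
    have "(\<lambda>x. \<chi> j. (complex_of_real (in_chart c (\<lambda>p. \<Upsilon> c p (axis j 1)) x)
        - \<i> * of_real (in_chart c (\<lambda>p. \<Upsilon> c p (axis j \<i>)) x)) / 2) differentiable (at x)"
    proof (rule differentiable_vec_lambda)
      fix j :: 'n
      note D = Ud[OF x, of "axis j 1", THEN frechet_derivative_works[THEN iffD1]]
        Ud[OF x, of "axis j \<i>", THEN frechet_derivative_works[THEN iffD1]]
      show "(\<lambda>x. (complex_of_real (in_chart c (\<lambda>p. \<Upsilon> c p (axis j 1)) x)
        - \<i> * of_real (in_chart c (\<lambda>p. \<Upsilon> c p (axis j \<i>)) x)) / 2) differentiable (at x)"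
        unfolding differentiable_def
        by (rule exI) (rule derivative_intros has_derivative_of_real D | simp)+
    qed
    thus ?thesis by (simp add: \<upsilon>_def in_chart_def)
  qed
  show thesis
  proof
    fix x assume x: "x \<in> ?S"
    show "u differentiable (at x)"
      unfolding u_def[abs_def]
      by (intro differentiable_add differentiable_cconj differentiable_matrix_vector_mult Ed Xd \<upsilon>d x)
    let ?p = "inv_into (fst c) (snd c) x"
    have p: "?p \<in> fst c" using x by (rule inv_into_into)
    have xp: "snd c ?p = x" using x by (rule f_inv_into_f)
    have D: "(?E has_derivative dird c (\<eta> c) ?p) (at x)"
      using Ed[OF x] frechet_derivative_works unfolding dird_def[abs_def] xp by blast
    have lin: "linear (dird c (\<eta> c) ?p)" using D has_derivative_linear by blast
    have "cnj (\<eta> c ?p $ b $ d) = \<eta> c ?p $ d $ b" for b d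
      using her c p unfolding real_herm_section_def by blast
    hence Eh: "hadj (?E x) = ?E x" by (simp add: hadj_def vec_eq_iff in_chart_def)
    have Ul: "linear (\<Upsilon> c ?p)" using U c p by (simp add: real_one_form_def)
    have dird: "dird c (\<eta> c) ?p v = (let E = in_chart c (\<eta> c) x; K = in_chart c (\<lambda>p. conn_matrix \<Gamma>\<^sub>0 c p v) x in
        (2 * Re (trace K) / (real CARD('n) + 1)) *\<^sub>R E - E ** K - hadj K ** E
        - outer (u x) v - outer (cconj v) (cconj (u x)))" for v
    proof -
      define K where "K = conn_matrix \<Gamma>\<^sub>0 c ?p v"
      define w where "w = \<upsilon> ?p"
      have K': "conn_matrix \<Gamma> c ?p v = K + mat (cdot w v) + outer w v"
        unfolding K_def w_def \<upsilon>_def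
        by (rule cproj_conn_matrix[where U = "\<Upsilon> c ?p" and \<Gamma>' = \<Gamma> and \<Gamma> = \<Gamma>\<^sub>0 and c = c and p = ?p,
              OF Ul Gamma[OF p]])
      have u: "u x - ?E x *v w = cconj (X c ?p)"
        by (simp add: u_def w_def in_chart_def)
      have "dird c (\<eta> c) ?p v = (2 * Re (trace (K + mat (cdot w v) + outer w v)) / (real CARD('n) + 1)) *\<^sub>R ?E x
          - ?E x ** (K + mat (cdot w v) + outer w v) - hadj (K + mat (cdot w v) + outer w v) ** ?E x
          - outer (cconj (X c ?p)) v - outer (cconj v) (X c ?p)"
        using metrisability_equation_real[OF con' c p eqs[OF p] lin, of v]
        unfolding covd_matrix[OF con' c p] K' by (simp add: in_chart_def algebra_simps)
      also have "\<dots> = (2 * Re (trace K) / (real CARD('n) + 1)) *\<^sub>R ?E x - ?E x ** K - hadj K ** ?E x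
        - outer (u x) v - outer (cconj v) (cconj (u x))"
        using gauge_change[OF Eh refl, where K = K and \<upsilon> = w and v = v and w = "u x"] unfolding u by simp
      finally show ?thesis by (simp add: Let_def K_def in_chart_def)
    qed
    show "(?E has_derivative (\<lambda>v.
        let E = in_chart c (\<eta> c) x; K = in_chart c (\<lambda>p. conn_matrix \<Gamma>\<^sub>0 c p v) x in
        (2 * Re (trace K) / (real CARD('n) + 1)) *\<^sub>R E - E ** K - hadj K ** E
        - outer (u x) v - outer (cconj v) (cconj (u x)))) (at x)"
      using D unfolding ext[of "dird c (\<eta> c) ?p", OF dird] .
  qed
qed

section \<open>Making the nondegenerate solution parallel\<close>

lemma matrix_inv_scaleR:
  fixes N :: "complex^'n^'n::finite"
  assumes "det N \<noteq> 0" "r \<noteq> 0"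
  shows "matrix_inv (r *\<^sub>R N) = inverse r *\<^sub>R matrix_inv N" "det (r *\<^sub>R N) \<noteq> 0"
proof -
  have "(r *\<^sub>R N) ** (inverse r *\<^sub>R matrix_inv N) = mat 1"
    using assms by (simp add: matrix_scaleR_left matrix_scaleR_right matrix_inv_cofactor(2))
  hence "det (r *\<^sub>R N) * det (inverse r *\<^sub>R matrix_inv N) = 1" by (metis det_I det_mul)
  thus d: "det (r *\<^sub>R N) \<noteq> 0" by auto
  have "matrix_inv (r *\<^sub>R N) = matrix_inv (r *\<^sub>R N) ** ((r *\<^sub>R N) ** (inverse r *\<^sub>R matrix_inv N))"
    using assms by (simp add: matrix_scaleR_left matrix_scaleR_right matrix_inv_cofactor(2))
  thus "matrix_inv (r *\<^sub>R N) = inverse r *\<^sub>R matrix_inv N"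
    by (simp add: matrix_mul_assoc matrix_inv_cofactor(3)[OF d])
qed

lemma det_herm_real: "hadj N = N \<Longrightarrow> det N = of_real (Re (det N))" for N :: "complex^'n^'n::finite"
  using det_hadj[of N] by (simp add: complex_eq_iff)

lemma trace_hadj: "trace (hadj X) = cnj (trace X)" for X :: "complex^'n^'n::finite"
  by (simp add: trace_def hadj_def)

text \<open>
  The shift by \<open>\<upsilon> = E\<^sup>-\<^sup>1 u\<close> removes the right hand side of the equation for the nondegenerate solution \<open>E\<close>. It
  is carried out in the chart, on the level of the matrices \<open>K\<close>. The factor \<open>det E\<close> has the weight that
  cancels the weight of \<open>E\<close>, so the product is parallel.
\<close>

lemma local_pencilI:
  fixes S :: "(complex^'n::finite) set"
  assumes dim: "CARD('n) \<ge> 2" and S: "open S"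
    and E_herm: "\<And>x. x \<in> S \<Longrightarrow> hadj (E x) = E x" and T_herm: "\<And>x. x \<in> S \<Longrightarrow> hadj (T x) = T x"
    and E_det: "\<And>x. x \<in> S \<Longrightarrow> det (E x) \<noteq> 0"
    and K_scale: "\<And>x c v. x \<in> S \<Longrightarrow> K x (c *s v) = mat c ** K x v"
    and K_add: "\<And>x v w. x \<in> S \<Longrightarrow> K x (v + w) = K x v + K x w"
    and K_sym: "\<And>x v w. x \<in> S \<Longrightarrow> transpose (K x v) *v w = transpose (K x w) *v v"
    and K_diff: "\<And>x v. x \<in> S \<Longrightarrow> (\<lambda>y. K y v) differentiable (at x)"
    and u_diff: "\<And>x. x \<in> S \<Longrightarrow> u differentiable (at x)" and w_diff: "\<And>x. x \<in> S \<Longrightarrow> w differentiable (at x)"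
    and E_deriv: "\<And>x. x \<in> S \<Longrightarrow> (E has_derivative (\<lambda>v.
        (2 * Re (trace (K x v)) / (real CARD('n) + 1)) *\<^sub>R E x - E x ** K x v - hadj (K x v) ** E x
        - outer (u x) v - outer (cconj v) (cconj (u x)))) (at x)"
    and T_deriv: "\<And>x. x \<in> S \<Longrightarrow> (T has_derivative (\<lambda>v.
        (2 * Re (trace (K x v)) / (real CARD('n) + 1)) *\<^sub>R T x - T x ** K x v - hadj (K x v) ** T x
        - outer (w x) v - outer (cconj v) (cconj (w x)))) (at x)"
  shows "\<exists>G Lam. local_pencil S (\<lambda>x. det_eta (E x) *\<^sub>R E x) (\<lambda>x. matrix_inv (E x) ** T x) G Lam"
proof (intro exI)
  \<comment> \<open>\<open>y\<close> and \<open>Lam\<close> are the right hand side for \<open>T\<close> after the shift, without and with an index lowered by \<open>E\<close>.\<close>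
  define \<upsilon> where "\<upsilon> x = matrix_inv (E x) *v u x" for x
  define G where "G x v = K x v + mat (cdot (\<upsilon> x) v) + outer (\<upsilon> x) v" for x v
  define y where "y x = w x - T x *v \<upsilon> x" for x
  define Lam where "Lam x = matrix_inv (E x) *v y x" for x
  define \<kappa> where "\<kappa> x v = 2 * Re (trace (G x v)) / (real CARD('n) + 1)" for x v
  define r where "r x = det_eta (E x)" for x
  have inv: "E x ** matrix_inv (E x) = mat 1" "matrix_inv (E x) ** E x = mat 1" if "x \<in> S" for x
    using matrix_inv_cofactor(2,3)[OF E_det[OF that]] .
  have E\<upsilon>: "E x *v \<upsilon> x = u x" if "x \<in> S" for x
    by (simp add: \<upsilon>_def matrix_vector_mul_assoc inv[OF that])
  have E': "(E has_derivative (\<lambda>v. \<kappa> x v *\<^sub>R E x - E x ** G x v - hadj (G x v) ** E x)) (at x)" if x: "x \<in> S" for x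
    using E_deriv[OF x] unfolding gauge_change[OF E_herm[OF x] G_def] \<kappa>_def[symmetric] by (simp add: E\<upsilon>[OF x])
  have T': "(T has_derivative (\<lambda>v. \<kappa> x v *\<^sub>R T x - T x ** G x v - hadj (G x v) ** T x
      - outer (y x) v - outer (cconj v) (cconj (y x)))) (at x)" if x: "x \<in> S" for x
    using T_deriv[OF x] unfolding gauge_change[OF T_herm[OF x] G_def] \<kappa>_def[symmetric] y_def[symmetric] .
  have r: "det (E x) = of_real (r x)" "r x \<noteq> 0" if "x \<in> S" for x
    using det_herm_real[OF E_herm[OF that]] E_det[OF that] by (auto simp: r_def det_eta_eq_Re_det)
  have r': "(r has_derivative (\<lambda>v. - \<kappa> x v * r x)) (at x)" if x: "x \<in> S" for x
  proof -
    let ?c = "eps_cofactor (E x)"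
    have tr1: "trace (?c ** (E x ** X)) = of_real (r x) * trace X" for X
      by (simp add: matrix_mul_assoc eps_cofactor_mult_matrix trace_mat_mult r[OF x])
    have tr2: "trace (?c ** (X ** E x)) = of_real (r x) * trace X" for X
    proof -
      have "trace (?c ** (X ** E x)) = trace (E x ** ?c ** X)"
        using trace_mul_sym[of "?c ** X" "E x"] by (simp add: matrix_mul_assoc)
      thus ?thesis by (simp add: matrix_mult_eps_cofactor trace_mat_mult r[OF x])
    qed
    have tr3: "trace (?c ** E x) = of_nat CARD('n) * of_real (r x)"
      by (simp add: eps_cofactor_mult_matrix r[OF x]) (simp add: trace_def mat_def)
    have "((\<lambda>x. Re (det (E x))) has_derivative (\<lambda>v. Re (trace (?c ** (\<kappa> x v *\<^sub>R E x - E x ** G x v - hadj (G x v) ** E x))))) (at x)"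
      by (intro derivative_intros has_derivative_Re E' x)
    moreover have "Re (trace (?c ** (\<kappa> x v *\<^sub>R E x - E x ** G x v - hadj (G x v) ** E x))) = - \<kappa> x v * r x" for v
    proof -
      have tr: "trace (?c ** (\<kappa> x v *\<^sub>R E x - E x ** G x v - hadj (G x v) ** E x))
        = of_real (\<kappa> x v) * (of_nat CARD('n) * of_real (r x)) - of_real (r x) * trace (G x v) - of_real (r x) * cnj (trace (G x v))"
        by (simp add: matrix_diff_ldistrib trace_sub tr1 tr2 trace_hadj matrix_scaleR_right linear_cmul[OF linear_trace] tr3 scaleR_conv_of_real[where 'a = complex])
      have "Re (trace (?c ** (\<kappa> x v *\<^sub>R E x - E x ** G x v - hadj (G x v) ** E x))) = r x * (\<kappa> x v * real CARD('n) - 2 * Re (trace (G x v)))"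
        unfolding tr by (simp add: algebra_simps)
      also have "2 * Re (trace (G x v)) = \<kappa> x v * (real CARD('n) + 1)"
        by (simp add: \<kappa>_def add_nonneg_pos pos_add_strict)
      finally show ?thesis by (simp add: algebra_simps)
    qed
    ultimately show ?thesis by (simp add: r_def[abs_def] det_eta_eq_Re_det)
  qed
  have inv': "((\<lambda>y. matrix_inv (E y)) has_derivative
     (\<lambda>v. - (matrix_inv (E x) ** (\<kappa> x v *\<^sub>R E x - E x ** G x v - hadj (G x v) ** E x) ** matrix_inv (E x)))) (at x)" if x: "x \<in> S" for x
    by (rule has_derivative_matrix_inv[OF E'[OF x] S x E_det])
  have invd: "(\<lambda>y. matrix_inv (E y)) differentiable (at x)" if "x \<in> S" for x
    using inv'[OF that] by (auto simp: differentiable_def)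
  have \<upsilon>d: "\<upsilon> differentiable (at x)" if "x \<in> S" for x
    unfolding \<upsilon>_def[abs_def] by (intro differentiable_matrix_vector_mult invd u_diff that)
  have Td: "T differentiable (at x)" if "x \<in> S" for x
    using T_deriv[OF that] by (auto simp: differentiable_def)
  have gi: "matrix_inv (r x *\<^sub>R E x) = inverse (r x) *\<^sub>R matrix_inv (E x)" "det (r x *\<^sub>R E x) \<noteq> 0" if "x \<in> S" for x
    using matrix_inv_scaleR[OF E_det r(2)] that by auto
  have "local_pencil S (\<lambda>x. r x *\<^sub>R E x) (\<lambda>x. matrix_inv (E x) ** T x) G Lam"
  proof
    fix x assume x: "x \<in> S"
    show "hadj (r x *\<^sub>R E x) = r x *\<^sub>R E x" by (simp add: hadj_scaleR E_herm[OF x])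
    show "hadj (matrix_inv (E x) ** T x) ** (r x *\<^sub>R E x) = (r x *\<^sub>R E x) ** (matrix_inv (E x) ** T x)"
      by (simp add: hadj_mult T_herm[OF x] matrix_inv_herm[OF E_herm[OF x] E_det[OF x]] matrix_scaleR_left matrix_scaleR_right)
        (simp add: matrix_mul_assoc[symmetric] inv[OF x], simp add: matrix_mul_assoc inv[OF x])
    show "det (r x *\<^sub>R E x) \<noteq> 0" by (rule gi[OF x])
    show "G x (c *s v) = mat c ** G x v" for c v
      by (simp add: G_def K_scale[OF x] matrix_add_ldistrib cdot_scale outer_scale mat_mult_mat)
    show "G x (v + v') = G x v + G x v'" for v v'
    proof -
      have "mat (a + b) = mat a + (mat b :: complex^'n^'n)" for a b by (simp add: mat_def vec_eq_iff)
      thus ?thesis by (simp add: G_def K_add[OF x] cdot_add outer_add)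
    qed
    show "transpose (G x v) *v v' = transpose (G x v') *v v" for v v'
    proof -
      have "transpose (mat a) = (mat a :: complex^'n^'n)" for a by (simp add: mat_def transpose_def vec_eq_iff)
      thus ?thesis by (simp add: G_def transpose_add transpose_outer matrix_vector_mult_add_rdistrib
          K_sym[OF x, of v v'] outer_mult_vector mat_mult_vector)
    qed
    show "(\<lambda>y. G y v) differentiable (at x)" for v
      unfolding G_def by (intro differentiable_add differentiable_mat_cdot differentiable_outer K_diff \<upsilon>d x differentiable_const)
    show "Lam differentiable (at x)"
      unfolding Lam_def[abs_def] y_def
      by (intro differentiable_matrix_vector_mult differentiable_diff invd Td \<upsilon>d w_diff x)
    show "((\<lambda>x. r x *\<^sub>R E x) has_derivative (\<lambda>v. - ((r x *\<^sub>R E x) ** G x v) - hadj (G x v) ** (r x *\<^sub>R E x))) (at x)"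
      by (rule has_derivative_eq_rhs[OF has_derivative_scaleR[OF r'[OF x] E'[OF x]]])
        (simp add: fun_eq_iff matrix_scaleR_left matrix_scaleR_right scaleR_diff_right)
    show "((\<lambda>x. matrix_inv (E x) ** T x) has_derivative (\<lambda>v. G x v ** (matrix_inv (E x) ** T x)
        - matrix_inv (E x) ** T x ** G x v - outer (Lam x) v
        - outer (matrix_inv (r x *\<^sub>R E x) *v cconj v) (cconj ((r x *\<^sub>R E x) *v Lam x)))) (at x)"
    proof (rule has_derivative_eq_rhs[OF has_derivative_matrix_mult[OF inv'[OF x] T'[OF x]]], rule ext)
      fix v
      let ?I = "matrix_inv (E x)"
      have y: "E x *v Lam x = y x" by (simp add: Lam_def matrix_vector_mul_assoc inv[OF x])
      have o: "outer (matrix_inv (r x *\<^sub>R E x) *v cconj v) (cconj ((r x *\<^sub>R E x) *v Lam x)) = outer (?I *v cconj v) (cconj (y x))"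
        using r(2)[OF x]
        by (simp add: gi[OF x] scaleR_matrix_vector y linear_cmul[OF linear_cconj])
          (simp add: outer_def vec_eq_iff)
      have il: "?I ** (E x ** X) = X" "E x ** (?I ** X) = X" for X by (simp_all add: matrix_mul_assoc inv[OF x])
      show "?I ** (\<kappa> x v *\<^sub>R T x - T x ** G x v - hadj (G x v) ** T x - outer (y x) v - outer (cconj v) (cconj (y x)))
        + - (?I ** (\<kappa> x v *\<^sub>R E x - E x ** G x v - hadj (G x v) ** E x) ** ?I) ** T x
        = G x v ** (?I ** T x) - ?I ** T x ** G x v - outer (Lam x) v
        - outer (matrix_inv (r x *\<^sub>R E x) *v cconj v) (cconj ((r x *\<^sub>R E x) *v Lam x))"
        unfolding o
        by (simp add: matrix_distribs matrix_mul_assoc[symmetric] il matrix_scaleR_left matrix_scaleR_right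
            matrix_mult_outer Lam_def)
    qed
  qed (use dim S in auto)
  thus "local_pencil S (\<lambda>x. det_eta (E x) *\<^sub>R E x) (\<lambda>x. matrix_inv (E x) ** T x) G Lam"
    by (simp add: r_def)
qed

section \<open>Forms and covectors\<close>

lemma real_form_eq: "real_form m X Y = Re (cdot X (m *v cconj Y)) + Re (cdot Y (m *v cconj X))"
  for m :: "complex^'n^'n::finite"
proof -
  have "cdot X (m *v cconj Y) = (\<Sum>b\<in>UNIV. \<Sum>a\<in>UNIV. m $ b $ a * (X $ b * cnj (Y $ a)))" for X Y
    by (simp add: cdot_def matrix_vector_mult_def cconj_def sum_distrib_left mult_ac)
  thus ?thesis by (simp add: real_form_def distrib_left sum.distrib)
qed

lemma real_form_herm:
  fixes m :: "complex^'n^'n::finite"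
  assumes "hadj m = m" shows "real_form m X Y = 2 * Re (cdot X (m *v cconj Y))"
proof -
  have "cdot Y (m *v cconj X) = cnj (cdot X (m *v cconj Y))"
    using cdot_hadj[of "cconj Y" m "cconj X"] assms by simp
  thus ?thesis by (simp add: real_form_eq)
qed

lemma covec01_represents:
  fixes \<omega> :: "complex^'n::finite \<Rightarrow> real"
  assumes "linear \<omega>" shows "\<omega> v = 2 * Re (cdot (\<chi> a. covec01 \<omega> a) (cconj v))"
proof -
  have "cdot (\<chi> j. (of_real (\<omega> (axis j 1)) - \<i> * of_real (\<omega> (axis j \<i>))) / 2) v = cnj (cdot (\<chi> a. covec01 \<omega> a) (cconj v))"
    by (simp add: cdot_def covec01_def cconj_def)
  hence "2 * Re (cdot (\<chi> a. covec01 \<omega> a) (cconj v)) = 2 * Re ((of_real (\<omega> v) - \<i> * of_real (\<omega> (\<i> *s v))) / 2)"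
    unfolding cdot_complex_part[OF assms] by (metis cnj.sel(1))
  thus ?thesis by simp
qed

lemma raise_index_matrix: "raise_index k \<omega> = transpose k *v (\<chi> a. covec01 \<omega> a)"
  by (simp add: raise_index_def matrix_vector_mult_def transpose_def)

section \<open>Change of charts\<close>

lemma open_overlap:
  assumes "complex_atlas \<A>" "c \<in> \<A>" "c' \<in> \<A>" shows "open (snd c ` (fst c \<inter> fst c'))"
proof -
  have "snd c ` (fst c \<inter> fst c') = snd c ` fst c \<inter> inv_into (fst c) (snd c) -` fst c'"
    using chartD(4)[OF assms(1,2)] by force
  thus ?thesis
    using continuous_open_preimage[OF chartD(5)[OF assms(1,2)] chartD(2)[OF assms(1,2)] chartD(1)[OF assms(1,3)]]
    by simp
qed

lemma trans_map_deriv: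
  assumes "complex_atlas \<A>" "c \<in> \<A>" "c' \<in> \<A>" "p \<in> fst c" "p \<in> fst c'"
  shows "(trans_map c c' has_derivative jac c c' p) (at (snd c p))"
proof -
  have "trans_map c c' differentiable (at (snd c p))"
    using assms by (intro smooth_on_differentiable[OF _ open_overlap[OF assms(1-3)]]) (auto simp: complex_atlas_def)
  thus ?thesis unfolding jac_def[abs_def] using frechet_derivative_works by blast
qed

lemma jac_matrix:
  assumes "complex_atlas \<A>" "c \<in> \<A>" "c' \<in> \<A>" "p \<in> fst c" "p \<in> fst c'"
  shows "jac c c' p (z *s v) = z *s jac c c' p v" "jac c c' p v = cjac c c' p *v v" "linear (jac c c' p)"
proof -
  show l: "linear (jac c c' p)" using trans_map_deriv[OF assms] has_derivative_linear by blast
  have i: "jac c c' p (\<i> *s v) = \<i> *s jac c c' p v" for v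
    using assms by (auto simp: complex_atlas_def Jstr_def)
  show "jac c c' p (z *s v) = z *s jac c c' p v" by (rule complex_linear_matrix(1)[OF l i])
  show "jac c c' p v = cjac c c' p *v v" unfolding cjac_def by (rule complex_linear_matrix(2)[OF l i])
qed

lemma trans_map_point:
  "complex_atlas \<A> \<Longrightarrow> c \<in> \<A> \<Longrightarrow> p \<in> fst c \<Longrightarrow> trans_map c c' (snd c p) = snd c' p"
  by (simp add: trans_map_def in_chart_def chartD(4))

lemma jac_comp:
  assumes A: "complex_atlas \<A>" and c: "c \<in> \<A>" "c' \<in> \<A>" "c'' \<in> \<A>" and p: "p \<in> fst c" "p \<in> fst c'" "p \<in> fst c''"
  shows "jac c' c'' p (jac c c' p v) = jac c c'' p v"
proof -
  have "((\<lambda>x. trans_map c' c'' (trans_map c c' x)) has_derivative (\<lambda>v. jac c' c'' p (jac c c' p v))) (at (snd c p))"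
    by (rule has_derivative_compose[OF trans_map_deriv[OF A c(1,2) p(1,2)]])
      (use trans_map_deriv[OF A c(2,3) p(2,3)] in \<open>simp add: trans_map_point[OF A c(1) p(1)]\<close>)
  hence "(trans_map c c'' has_derivative (\<lambda>v. jac c' c'' p (jac c c' p v))) (at (snd c p))"
  proof (rule has_derivative_transform_within_open[OF _ open_overlap[OF A c(1,2)]])
    show "snd c p \<in> snd c ` (fst c \<inter> fst c')" using p by auto
    show "trans_map c' c'' (trans_map c c' y) = trans_map c c'' y" if "y \<in> snd c ` (fst c \<inter> fst c')" for y
      using that A c by (auto simp: trans_map_point) 
  qed
  thus ?thesis using trans_map_deriv[OF A c(1,3) p(1,3)] has_derivative_unique by metis
qed

lemma jac_id:
  assumes A: "complex_atlas \<A>" and c: "c \<in> \<A>" and p: "p \<in> fst c" shows "jac c c p v = v"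
proof -
  have "(trans_map c c has_derivative (\<lambda>v. v)) (at (snd c p))"
  proof (rule has_derivative_transform_within_open[OF has_derivative_ident chartD(2)[OF A c]])
    show "snd c p \<in> snd c ` fst c" using p by auto
    show "y = trans_map c c y" if "y \<in> snd c ` fst c" for y
      using that A c by (auto simp: trans_map_point)
  qed
  thus ?thesis using trans_map_deriv[OF A c c p p] has_derivative_unique by metis
qed

lemma dird_change:
  fixes f :: "('m::topological_space, 'n::finite) chart \<Rightarrow> 'm \<Rightarrow> real"
  assumes A: "complex_atlas \<A>" and c: "c \<in> \<A>" "c' \<in> \<A>" and p: "p \<in> fst c" "p \<in> fst c'"
    and eq: "\<And>q. q \<in> fst c \<Longrightarrow> q \<in> fst c' \<Longrightarrow> f c q = f c' q"
    and d: "in_chart c' (f c') differentiable (at (snd c' p))"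
  shows "dird c' (f c') p (jac c c' p v) = dird c (f c) p v"
proof -
  have D: "(in_chart c' (f c') has_derivative dird c' (f c') p) (at (snd c' p))"
    unfolding dird_def[abs_def] using d frechet_derivative_works by blast
  have "((\<lambda>x. in_chart c' (f c') (trans_map c c' x)) has_derivative (\<lambda>v. dird c' (f c') p (jac c c' p v))) (at (snd c p))"
    by (rule has_derivative_compose[OF trans_map_deriv[OF A c p]])
      (use D in \<open>simp add: trans_map_point[OF A c(1) p(1)]\<close>)
  hence "(in_chart c (f c) has_derivative (\<lambda>v. dird c' (f c') p (jac c c' p v))) (at (snd c p))"
  proof (rule has_derivative_transform_within_open[OF _ open_overlap[OF A c]])
    show "snd c p \<in> snd c ` (fst c \<inter> fst c')" using p by auto
    show "in_chart c' (f c') (trans_map c c' y) = in_chart c (f c) y" if "y \<in> snd c ` (fst c \<inter> fst c')" for y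
      using that A c eq by (auto simp: trans_map_point in_chart_def chartD(4))
  qed
  from frechet_derivative_at[OF this] show ?thesis unfolding dird_def[of c] by metis
qed

section \<open>Pencils on a manifold\<close>

locale kaehler_pencil =
  fixes \<A> :: "('m::{t2_space, second_countable_topology}, 'n::finite) chart set"
    and \<P> :: "('m, 'n) connection set"
    and \<eta> \<theta> :: "('m, 'n) herm_field"
  assumes atlas: "complex_atlas \<A>" and dim: "CARD('n) \<ge> 2"
    and cproj: "c_projective_structure \<A> \<P>"
    and pencil: "metrisability_pencil \<A> \<P> \<eta> \<theta>"
    and nondeg: "nondegenerate \<A> \<eta>"
begin

lemma real_sections: "real_herm_section \<A> \<eta>" "real_herm_section \<A> \<theta>"
  using pencil by (auto simp: metrisability_pencil_def metrisability_solution_def)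

lemma herm: assumes "c \<in> \<A>" "p \<in> fst c" shows "hadj (\<eta> c p) = \<eta> c p" "hadj (\<theta> c p) = \<theta> c p"
proof -
  have "\<forall>b d. cnj (\<eta> c p $ b $ d) = \<eta> c p $ d $ b" "\<forall>b d. cnj (\<theta> c p $ b $ d) = \<theta> c p $ d $ b"
    using real_sections assms unfolding real_herm_section_def by blast+
  thus "hadj (\<eta> c p) = \<eta> c p" "hadj (\<theta> c p) = \<theta> c p" by (simp_all add: hadj_def vec_eq_iff)
qed

lemma det_nz: "c \<in> \<A> \<Longrightarrow> p \<in> fst c \<Longrightarrow> det (\<eta> c p) \<noteq> 0"
  using nondeg by (auto simp: nondegenerate_def invertible_det_nz)

lemma local_pencil_in_chart:
  assumes c: "c \<in> \<A>"
  shows "\<exists>G Lam. local_pencil (snd c ` fst c) (in_chart c (metric_up \<eta> c)) (in_chart c (pencil_endo \<eta> \<theta> c)) G Lam"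
proof -
  let ?S = "snd c ` fst c"
  obtain \<Gamma> where con: "complex_connection \<A> \<Gamma>"
    and P: "\<P> = {\<Gamma>'. complex_connection \<A> \<Gamma>' \<and> cproj_equiv \<A> \<Gamma> \<Gamma>'}"
    using cproj by (auto simp: c_projective_structure_def)
  have sol: "metrisability_solution \<A> \<P> \<eta>" "metrisability_solution \<A> \<P> \<theta>"
    using pencil by (auto simp: metrisability_pencil_def)
  define K where "K x v = in_chart c (\<lambda>p. conn_matrix \<Gamma> c p v) x" for x v
  obtain u where u: "\<And>x. x \<in> ?S \<Longrightarrow> u differentiable (at x)"
    "\<And>x. x \<in> ?S \<Longrightarrow> (in_chart c (\<eta> c) has_derivative (\<lambda>v.
        (2 * Re (trace (K x v)) / (real CARD('n) + 1)) *\<^sub>R in_chart c (\<eta> c) x - in_chart c (\<eta> c) x ** K x v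
          - hadj (K x v) ** in_chart c (\<eta> c) x - outer (u x) v - outer (cconj v) (cconj (u x)))) (at x)"
    using solution_in_chart[OF atlas c con P sol(1)] unfolding Let_def K_def by blast
  obtain w where w: "\<And>x. x \<in> ?S \<Longrightarrow> w differentiable (at x)"
    "\<And>x. x \<in> ?S \<Longrightarrow> (in_chart c (\<theta> c) has_derivative (\<lambda>v.
        (2 * Re (trace (K x v)) / (real CARD('n) + 1)) *\<^sub>R in_chart c (\<theta> c) x - in_chart c (\<theta> c) x ** K x v
          - hadj (K x v) ** in_chart c (\<theta> c) x - outer (w x) v - outer (cconj v) (cconj (w x)))) (at x)"
    using solution_in_chart[OF atlas c con P sol(2)] unfolding Let_def K_def by blast
  have in_c: "inv_into (fst c) (snd c) x \<in> fst c" if "x \<in> ?S" for x using that by (rule inv_into_into)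
  have K_diff: "(\<lambda>y. K y v) differentiable (at x)" if x: "x \<in> ?S" for x v
  proof -
    have d: "in_chart c (\<lambda>p. \<Gamma> c p v (axis i 1)) differentiable (at x)" for i
      using section_differentiable[OF atlas c, of "\<lambda>c p. \<Gamma> c p v (axis i 1)" x] con x
      by (auto simp: complex_connection_def affine_connection_def)
    have "(\<lambda>y. K y v) = (\<lambda>y. \<chi> i j. in_chart c (\<lambda>p. \<Gamma> c p v (axis i 1)) y $ j)"
      by (simp add: K_def in_chart_def conn_matrix_def matrix_def transpose_def)
    thus ?thesis by (auto intro!: differentiable_vec_lambda d)
  qed
  have "\<exists>G Lam. local_pencil ?S (\<lambda>x. det_eta (in_chart c (\<eta> c) x) *\<^sub>R in_chart c (\<eta> c) x)
      (\<lambda>x. matrix_inv (in_chart c (\<eta> c) x) ** in_chart c (\<theta> c) x) G Lam"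
  proof (rule local_pencilI[where K = K and u = u and w = w])
    show "open ?S" by (rule chartD(2)[OF atlas c])
  qed (use dim herm[OF c] det_nz[OF c] conn_matrix_scale[OF con c] in_c K_diff u w in \<open>auto simp: in_chart_def K_def\<close>)
  thus ?thesis by (simp add: metric_up_def[abs_def] pencil_endo_def[abs_def] in_chart_def[abs_def])
qed

end

section \<open>The integrals on the tangent bundle\<close>

context kaehler_pencil
begin

abbreviation "gup \<equiv> metric_up \<eta>"
abbreviation "glow \<equiv> metric_low \<eta>"
abbreviation "endo \<equiv> pencil_endo \<eta> \<theta>"
abbreviation "cofA t c p \<equiv> eps_cofactor (endo c p - mat (complex_of_real t))"

lemma gup_facts:
  assumes c: "c \<in> \<A>" and p: "p \<in> fst c"
  shows "hadj (gup c p) = gup c p" "det (gup c p) \<noteq> 0" "hadj (glow c p) = glow c p"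
    "gup c p ** glow c p = mat 1" "glow c p ** gup c p = mat 1"
    "det_eta (\<eta> c p) \<noteq> 0" "det (\<eta> c p) = of_real (det_eta (\<eta> c p))"
    "glow c p = inverse (det_eta (\<eta> c p)) *\<^sub>R matrix_inv (\<eta> c p)"
proof -
  show d: "det (\<eta> c p) = of_real (det_eta (\<eta> c p))"
    using det_herm_real[OF herm(1)[OF c p]] by (simp add: det_eta_eq_Re_det)
  thus nz: "det_eta (\<eta> c p) \<noteq> 0" using det_nz[OF c p] by auto
  show h: "hadj (gup c p) = gup c p" by (simp add: metric_up_def hadj_scaleR herm(1)[OF c p])
  show dg: "det (gup c p) \<noteq> 0" unfolding metric_up_def by (rule matrix_inv_scaleR[OF det_nz[OF c p] nz])
  show "hadj (glow c p) = glow c p" unfolding metric_low_def by (rule matrix_inv_herm[OF h dg])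
  show "gup c p ** glow c p = mat 1" "glow c p ** gup c p = mat 1"
    unfolding metric_low_def by (rule matrix_inv_cofactor[OF dg])+
  show "glow c p = inverse (det_eta (\<eta> c p)) *\<^sub>R matrix_inv (\<eta> c p)"
    unfolding metric_low_def metric_up_def by (rule matrix_inv_scaleR[OF det_nz[OF c p] nz])
qed

lemma metric_eq: "c \<in> \<A> \<Longrightarrow> p \<in> fst c \<Longrightarrow> metric \<eta> c p X Y = 2 * Re (cdot X (glow c p *v cconj Y))"
  unfolding metric_def by (rule real_form_herm[OF gup_facts(3)])

text \<open>
  By the second formula, \<open>L\<^sub>t(X) = - d(det A(t))(J X)\<close>, which does not refer to the metric. This makes the
  independence of the chart evident.
\<close>

lemma metric_raise_index:
  assumes c: "c \<in> \<A>" and p: "p \<in> fst c" and lin: "linear \<omega>"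
  shows "metric \<eta> c p (raise_index (gup c p) \<omega>) v = \<omega> v"
    and "metric \<eta> c p (Jstr (raise_index (gup c p) \<omega>)) v = - \<omega> (\<i> *s v)"
proof -
  have *: "cdot (raise_index (gup c p) \<omega>) (glow c p *v cconj v) = cdot (\<chi> a. covec01 \<omega> a) (cconj v)"
    by (simp add: raise_index_matrix cdot_matrix[symmetric] matrix_vector_mul_assoc gup_facts(4)[OF c p])
  show "metric \<eta> c p (raise_index (gup c p) \<omega>) v = \<omega> v"
    by (simp add: metric_eq[OF c p] * covec01_represents[OF lin])
  have "cconj (\<i> *s v) = - \<i> *s cconj v" by (simp add: cconj_def vec_eq_iff)
  thus "metric \<eta> c p (Jstr (raise_index (gup c p) \<omega>)) v = - \<omega> (\<i> *s v)"
    by (simp add: metric_eq[OF c p] Jstr_def cdot_scale cdot_minus * covec01_represents[OF lin, of "\<i> *s v"])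
qed

lemma metric_nondegenerate:
  assumes c: "c \<in> \<A>" and p: "p \<in> fst c" and eq: "\<And>w. metric \<eta> c p X w = metric \<eta> c p Y w"
  shows "X = Y"
proof -
  have "metric \<eta> c p (X - Y) w = 0" for w
    using eq[of w] by (simp add: metric_eq[OF c p] cdot_diff)
  hence z: "Re (cdot (X - Y) (glow c p *v cconj w)) = 0" for w by (simp add: metric_eq[OF c p])
  have "Re (cdot u (X - Y)) = 0" for u
    using z[of "cconj (gup c p *v u)"]
    by (simp add: matrix_vector_mul_assoc gup_facts(5)[OF c p] cdot_commute)
  from this[of "cconj (X - Y)"] have "(X - Y) \<bullet> (X - Y) = 0" by (simp add: inner_eq_cdot cdot_commute)
  thus ?thesis by simp
qed

context
  fixes c c' p J
  assumes c: "c \<in> \<A>" and c': "c' \<in> \<A>" and p: "p \<in> fst c" and p': "p \<in> fst c'"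
  defines "J \<equiv> cjac c c' p"
begin

lemma det_J: "det J \<noteq> 0"
proof -
  have "cjac c' c p *v (J *v v) = v" for v
    using jac_comp[OF atlas c c' c p p' p, of v] jac_id[OF atlas c p, of v]
    by (simp add: J_def jac_matrix(2)[OF atlas c c' p p'] jac_matrix(2)[OF atlas c' c p' p])
  hence "cjac c' c p ** J = mat 1" by (simp add: matrix_eq matrix_vector_mul_assoc)
  hence "det (cjac c' c p) * det J = 1" by (metis det_I det_mul)
  thus ?thesis by auto
qed

lemma weight: "weight_trans c c' p > 0" "weight_trans c c' p ^ Suc CARD('n) = (cmod (det J))\<^sup>2"
proof -
  have pos: "(cmod (det J))\<^sup>2 > 0" using det_J by simp
  thus "weight_trans c c' p > 0" by (simp add: weight_trans_def J_def)
  have "weight_trans c c' p ^ Suc CARD('n) = weight_trans c c' p powr real (Suc CARD('n))"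
    using pos by (simp only: powr_realpow weight_trans_def J_def powr_gt_zero)
  also have "\<dots> = (cmod (det J))\<^sup>2"
    using pos by (simp add: weight_trans_def J_def powr_powr add.commute[of 1])
  finally show "weight_trans c c' p ^ Suc CARD('n) = (cmod (det J))\<^sup>2" .
qed

lemma herm_trans:
  assumes "real_herm_section \<A> \<sigma>"
  shows "\<sigma> c' p = inverse (weight_trans c c' p) *\<^sub>R (hadj (transpose J) ** \<sigma> c p ** transpose J)"
proof -
  have "\<sigma> c' p $ b $ d = complex_of_real (inverse (weight_trans c c' p)) *
          (\<Sum>e\<in>UNIV. \<Sum>f\<in>UNIV. cnj (J $ b $ e) * J $ d $ f * \<sigma> c p $ e $ f)" for b d
    using assms c c' p p' unfolding real_herm_section_def J_def by blast
  moreover have "(hadj (transpose J) ** \<sigma> c p ** transpose J) $ b $ d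
     = (\<Sum>e\<in>UNIV. \<Sum>f\<in>UNIV. cnj (J $ b $ e) * J $ d $ f * \<sigma> c p $ e $ f)" for b d
    by (simp add: matrix_matrix_mult_def hadj_def transpose_def sum_distrib_right sum_distrib_left mult_ac)
      (rule sum.swap)
  ultimately show ?thesis by (simp add: vec_eq_iff scaleR_conv_of_real[where 'a = complex])
qed

text \<open>
  The determinant of \<open>\<eta>\<close> transforms with the weight that compensates the weight of \<open>\<eta>\<close>.
\<close>

lemma gup_trans: "gup c' p = hadj (transpose J) ** gup c p ** transpose J"
proof -
  let ?w = "weight_trans c c' p"
  have sc: "det (r *\<^sub>R X) = of_real (r ^ CARD('n)) * det X" for r and X :: "complex^'n^'n"
  proof -
    have "r *\<^sub>R X = (\<chi> i. of_real r *s X $ i)" by (simp add: vec_eq_iff scaleR_conv_of_real[where 'a = complex])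
    thus ?thesis using det_rows_mul[of "\<lambda>i. of_real r" "\<lambda>i. X $ i"] by simp
  qed
  have "det (\<eta> c' p) = of_real (inverse ?w ^ CARD('n)) * (cnj (det J) * det (\<eta> c p) * det J)"
    unfolding herm_trans[OF real_sections(1)] sc by (simp add: det_mul det_hadj)
  also have "cnj (det J) * det (\<eta> c p) * det J = of_real ((cmod (det J))\<^sup>2 * det_eta (\<eta> c p))"
  proof -
    have "det J * cnj (det J) = of_real ((cmod (det J))\<^sup>2)" by (metis complex_norm_square)
    thus ?thesis by (simp add: gup_facts(7)[OF c p] mult_ac)
  qed
  finally have "complex_of_real (det_eta (\<eta> c' p)) = of_real (inverse ?w ^ CARD('n) * ((cmod (det J))\<^sup>2 * det_eta (\<eta> c p)))"
    unfolding gup_facts(7)[OF c' p'] by simp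
  hence "det_eta (\<eta> c' p) = inverse ?w ^ CARD('n) * ((cmod (det J))\<^sup>2 * det_eta (\<eta> c p))"
    unfolding of_real_eq_iff .
  hence "det_eta (\<eta> c' p) * inverse ?w = det_eta (\<eta> c p)"
    using weight(1) unfolding weight(2)[symmetric] by (simp add: field_simps)
  thus ?thesis
    unfolding metric_up_def herm_trans[OF real_sections(1)] scaleR_scaleR
    by (simp add: matrix_scaleR_left matrix_scaleR_right)
qed

lemma endo_trans: "transpose J ** endo c' p = endo c p ** transpose J"
proof -
  let ?w = "weight_trans c c' p" and ?P = "transpose J"
  have w: "?w \<noteq> 0" using weight(1) by simp
  have dP: "det (hadj ?P) \<noteq> 0" using det_J by (simp add: det_hadj)
  have ce: "\<eta> c p ** endo c p = \<theta> c p"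
    by (simp add: pencil_endo_def matrix_mul_assoc matrix_inv_cofactor(2)[OF det_nz[OF c p]])
  have ce': "\<eta> c' p ** endo c' p = \<theta> c' p"
    by (simp add: pencil_endo_def matrix_mul_assoc matrix_inv_cofactor(2)[OF det_nz[OF c' p']])
  have "inverse ?w *\<^sub>R (hadj ?P ** \<eta> c p ** ?P ** endo c' p) = inverse ?w *\<^sub>R (hadj ?P ** \<theta> c p ** ?P)"
    using ce' unfolding herm_trans[OF real_sections(1)] herm_trans[OF real_sections(2)] by (simp add: matrix_scaleR_left)
  hence "hadj ?P ** (\<eta> c p ** (?P ** endo c' p)) = hadj ?P ** (\<eta> c p ** (endo c p ** ?P))"
    using w by (simp add: matrix_mul_assoc ce[symmetric])
  hence "matrix_inv (\<eta> c p) ** (matrix_inv (hadj ?P) ** (hadj ?P ** (\<eta> c p ** (?P ** endo c' p))))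
      = matrix_inv (\<eta> c p) ** (matrix_inv (hadj ?P) ** (hadj ?P ** (\<eta> c p ** (endo c p ** ?P))))" by simp
  thus ?thesis by (simp add: matrix_mul_assoc matrix_inv_cofactor(3)[OF dP])
    (simp add: matrix_mul_assoc[symmetric], simp add: matrix_mul_assoc matrix_inv_cofactor(3)[OF det_nz[OF c p]])
qed

lemma glow_trans: "transpose J ** glow c' p ** hadj (transpose J) = glow c p"
proof -
  let ?P = "transpose J"
  have "glow c p = glow c p ** (matrix_inv (hadj ?P) ** (gup c' p ** glow c' p) ** hadj ?P)"
    using det_J by (simp add: gup_facts(4)[OF c' p'] matrix_inv_cofactor(3) det_hadj)
  also have "\<dots> = glow c p ** ((matrix_inv (hadj ?P) ** hadj ?P) ** gup c p ** ?P ** glow c' p ** hadj ?P)"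
    unfolding gup_trans by (simp add: matrix_mul_assoc)
  also have "\<dots> = (glow c p ** gup c p) ** ?P ** glow c' p ** hadj ?P"
    using det_J by (simp add: matrix_inv_cofactor(3) det_hadj matrix_mul_assoc)
  finally show ?thesis by (simp add: gup_facts(5)[OF c p])
qed

lemma endo_shift_trans:
  "transpose J ** (endo c' p - mat z) = (endo c p - mat z) ** transpose J"
  by (simp add: matrix_distribs endo_trans mat_commute[of "transpose J"])

lemma det_A_trans: "det_A \<eta> \<theta> t c' p = det_A \<eta> \<theta> t c p"
  using arg_cong[OF endo_shift_trans[of "of_real t"], of det] det_J by (simp add: det_A_def det_mul)

lemma cofA_trans: "transpose J ** cofA t c' p = cofA t c p ** transpose J"
proof -
  let ?P = "transpose J" and ?c = "eps_cofactor (transpose J)"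
  have "cofA t c' p ** ?c = ?c ** cofA t c p"
    using arg_cong[OF endo_shift_trans[of "of_real t"], of eps_cofactor] by (simp add: eps_cofactor_mult)
  hence "?P ** (cofA t c' p ** ?c) ** ?P = ?P ** (?c ** cofA t c p) ** ?P" by simp
  hence "?P ** cofA t c' p ** (?c ** ?P) = (?P ** ?c) ** (cofA t c p ** ?P)"
    by (simp only: matrix_mul_assoc)
  hence "mat (det J) ** (?P ** cofA t c' p) = mat (det J) ** (cofA t c p ** ?P)"
    by (simp only: matrix_mult_eps_cofactor eps_cofactor_mult_matrix mat_commute det_transpose)
  thus ?thesis using det_J by (simp add: mat_scal vec_eq_iff)
qed

lemma jac_J: "jac c c' p v = J *v v"
  unfolding J_def by (rule jac_matrix(2)[OF atlas c c' p p'])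

lemma cdot_jac: "cdot (jac c c' p v) (X *v cconj (jac c c' p w)) = cdot v ((transpose J ** X ** hadj (transpose J)) *v cconj w)"
  by (simp add: jac_J hadj_vector_cconj cdot_matrix[of v "transpose J"] flip: matrix_vector_mul_assoc)

lemma metric_trans: "metric \<eta> c' p (jac c c' p v) (jac c c' p w) = metric \<eta> c p v w"
  unfolding metric_eq[OF c p] metric_eq[OF c' p'] cdot_jac glow_trans ..

lemma quadratic_trans:
  "cdot (jac c c' p v) ((cofA t c' p ** glow c' p) *v cconj (jac c c' p v)) = cdot v ((cofA t c p ** glow c p) *v cconj v)"
proof -
  have "transpose J ** (cofA t c' p ** glow c' p) ** hadj (transpose J) = cofA t c p ** glow c p"
    by (simp only: matrix_mul_assoc cofA_trans) (simp only: matrix_mul_assoc[symmetric] glow_trans[unfolded matrix_mul_assoc[symmetric]])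
  thus ?thesis unfolding cdot_jac by simp
qed

end

lemma chart_at_in: "chart_at \<A> p \<in> charts_at \<A> p"
proof -
  have "p \<in> (\<Union>c\<in>\<A>. fst c)" using atlas unfolding complex_atlas_def by (metis UNIV_I)
  hence "\<exists>c. c \<in> charts_at \<A> p" unfolding charts_at_def by blast
  thus ?thesis unfolding chart_at_def by (rule someI_ex)
qed

lemma det_A_deriv:
  assumes "local_pencil (snd c ` fst c) (in_chart c (gup c)) (in_chart c (endo c)) G Lam" and x: "x \<in> snd c ` fst c"
  shows "(in_chart c (det_A \<eta> \<theta> t c) has_derivative
    (\<lambda>h. Re (trace (local_pencil.B (in_chart c (endo c)) x t
        ** local_pencil.dA (in_chart c (gup c)) (in_chart c (endo c)) G Lam x h)))) (at x)"
proof -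
  interpret lp: local_pencil "snd c ` fst c" "in_chart c (gup c)" "in_chart c (endo c)" G Lam by fact
  have "((\<lambda>x. Re (det (in_chart c (endo c) x - mat (of_real t)))) has_derivative
       (\<lambda>h. Re (trace (lp.B x t ** (lp.dA x h - 0))))) (at x)"
    unfolding lp.B_def lp.At_def
    by (intro has_derivative_Re has_derivative_det has_derivative_diff has_derivative_const lp.dA x)
  moreover have "in_chart c (det_A \<eta> \<theta> t c) = (\<lambda>x. Re (det (in_chart c (endo c) x - mat (of_real t))))"
    by (simp add: in_chart_def det_A_def)
  ultimately show ?thesis by simp
qed

lemma dird_det_A:
  assumes c: "c \<in> \<A>" and p: "p \<in> fst c"
  shows "(in_chart c (det_A \<eta> \<theta> t c) has_derivative dird c (det_A \<eta> \<theta> t c) p) (at (snd c p))"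
proof -
  have "in_chart c (det_A \<eta> \<theta> t c) differentiable (at (snd c p))"
    using local_pencil_in_chart[OF c] det_A_deriv[of c _ _ "snd c p"] p by (auto simp: differentiable_def)
  thus ?thesis unfolding dird_def[abs_def] using frechet_derivative_works by blast
qed

lemma tangent_bundleD:
  "(p, v) \<in> tangent_bundle \<A> \<Longrightarrow> c \<in> charts_at \<A> p \<Longrightarrow> c' \<in> charts_at \<A> p \<Longrightarrow> v c' = jac c c' p (v c)"
  unfolding tangent_bundle_def by blast

lemma L_fun_eq:
  assumes X: "(p, v) \<in> tangent_bundle \<A>" and c: "c \<in> charts_at \<A> p"
  shows "L_fun \<A> \<eta> \<theta> t (p, v) = - dird c (det_A \<eta> \<theta> t c) p (\<i> *s v c)"
proof -
  let ?c0 = "chart_at \<A> p"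
  have c0: "?c0 \<in> \<A>" "p \<in> fst ?c0" using chart_at_in by (auto simp: charts_at_def)
  have c': "c \<in> \<A>" "p \<in> fst c" using c by (auto simp: charts_at_def)
  have v: "v ?c0 = jac c ?c0 p (v c)" by (rule tangent_bundleD[OF X c chart_at_in])
  have "linear (dird ?c0 (det_A \<eta> \<theta> t ?c0) p)" using dird_det_A[OF c0] has_derivative_linear by blast
  hence "L_fun \<A> \<eta> \<theta> t (p, v) = - dird ?c0 (det_A \<eta> \<theta> t ?c0) p (\<i> *s v ?c0)"
    unfolding L_fun_def Let_def prod.case Kvec_def by (rule metric_raise_index(2)[OF c0])
  also have "\<i> *s v ?c0 = jac c ?c0 p (\<i> *s v c)" by (simp add: v jac_matrix(1)[OF atlas c'(1) c0(1) c'(2) c0(2)])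
  also have "dird ?c0 (det_A \<eta> \<theta> t ?c0) p (jac c ?c0 p (\<i> *s v c)) = dird c (det_A \<eta> \<theta> t c) p (\<i> *s v c)"
  proof (rule dird_change[OF atlas c'(1) c0(1) c'(2) c0(2)])
    show "det_A \<eta> \<theta> t c q = det_A \<eta> \<theta> t ?c0 q" if "q \<in> fst c" "q \<in> fst ?c0" for q
      using det_A_trans[OF c'(1) c0(1) that] by simp
    show "in_chart ?c0 (det_A \<eta> \<theta> t ?c0) differentiable (at (snd ?c0 p))"
      using dird_det_A[OF c0] by (auto simp: differentiable_def)
  qed
  finally show ?thesis .
qed

text \<open>
  Multiplicativity of the cofactor matrix, applied to \<open>\<theta> - t \<eta> = \<eta> (A - t)\<close>, shows that the weights cancel
  against \<open>\<tau>\<^sub>g\<^sup>-\<^sup>2\<close>. In this form every factor transforms by conjugation or as a Hermitian form.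
\<close>

lemma I_fun_eq:
  assumes X: "(p, v) \<in> tangent_bundle \<A>" and c: "c \<in> charts_at \<A> p"
  shows "I_fun \<A> \<eta> \<theta> t (p, v) = 2 * Re (cdot (v c) ((cofA t c p ** glow c p) *v cconj (v c)))"
proof -
  let ?c0 = "chart_at \<A> p"
  have c0: "?c0 \<in> \<A>" "p \<in> fst ?c0" using chart_at_in by (auto simp: charts_at_def)
  have c': "c \<in> \<A>" "p \<in> fst c" using c by (auto simp: charts_at_def)
  have v: "v ?c0 = jac c ?c0 p (v c)" by (rule tangent_bundleD[OF X c chart_at_in])
  let ?E = "\<eta> ?c0 p" let ?r = "det_eta ?E"
  have E: "det ?E \<noteq> 0" by (rule det_nz[OF c0])
  have "pencil \<eta> \<theta> t ?c0 p = ?E ** (endo ?c0 p - mat (of_real t))"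
    by (simp add: pencil_def pencil_endo_def matrix_diff_ldistrib matrix_mul_assoc matrix_inv_cofactor(2)[OF E]
      scaleR_real_mat mat_commute)
  hence "eps_cofactor (pencil \<eta> \<theta> t ?c0 p) = cofA t ?c0 p ** eps_cofactor ?E" by (simp add: eps_cofactor_mult)
  also have "eps_cofactor ?E = ?r *\<^sub>R matrix_inv ?E"
    using gup_facts(6,7)[OF c0] by (simp add: matrix_inv_cofactor(1)[OF E] scaleR_real_mat matrix_mul_assoc mat_mult_mat)
  also have "?r *\<^sub>R matrix_inv ?E = ?r\<^sup>2 *\<^sub>R glow ?c0 p"
    using gup_facts(6,8)[OF c0] by (simp add: power2_eq_square)
  finally have cof: "eps_cofactor (pencil \<eta> \<theta> t ?c0 p) = ?r\<^sup>2 *\<^sub>R (cofA t ?c0 p ** glow ?c0 p)"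
    by (simp add: matrix_scaleR_right)
  have sc: "cdot u (r *\<^sub>R y) = of_real r * cdot u y" for u y :: "complex^'n" and r by (simp add: scaleR_vec_scale cdot_scale)
  have "I_fun \<A> \<eta> \<theta> t (p, v) = 2 * Re (cdot (v ?c0) ((cofA t ?c0 p ** glow ?c0 p) *v cconj (v ?c0)))"
    unfolding I_fun_def Let_def prod.case cof real_form_eq
    using gup_facts(6)[OF c0] by (simp add: scaleR_matrix_vector sc)
  thus ?thesis unfolding v quadratic_trans[OF c'(1) c0(1) c'(2) c0(2)] .
qed

lemma tangent_bundle_outside: "(p, v) \<in> tangent_bundle \<A> \<Longrightarrow> c \<notin> charts_at \<A> p \<Longrightarrow> v c = 0"
  unfolding tangent_bundle_def by blast

lemma flat_inj: "inj_on (flat \<A> \<eta>) (tangent_bundle \<A>)"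
proof (rule inj_onI, clarify)
  fix p v q w
  assume v: "(p, v) \<in> tangent_bundle \<A>" and w: "(q, w) \<in> tangent_bundle \<A>"
    and eq: "flat \<A> \<eta> (p, v) = flat \<A> \<eta> (q, w)"
  have q: "q = p" using eq by (simp add: flat_def)
  have "v c = w c" for c
  proof (cases "c \<in> charts_at \<A> p")
    case True
    have "metric \<eta> c p (v c) = metric \<eta> c p (w c)"
    proof -
      have "snd (flat \<A> \<eta> (p, v)) c = snd (flat \<A> \<eta> (q, w)) c" by (simp only: eq)
      thus ?thesis using True by (simp add: flat_def q)
    qed
    thus ?thesis using True by (intro metric_nondegenerate[of c p]) (auto simp: charts_at_def)
  next
    case False
    thus ?thesis using tangent_bundle_outside[OF v] tangent_bundle_outside[OF w] q by simp
  qed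
  thus "p = q \<and> v = w" using q by auto
qed

definition tvec_of where
  "tvec_of c p v = (p, \<lambda>c'. if c' \<in> charts_at \<A> p then jac c c' p v else 0)"

lemma tvec_of_tangent:
  assumes "c \<in> \<A>" "p \<in> fst c" shows "tvec_of c p v \<in> tangent_bundle \<A>"
  using jac_comp[OF atlas assms(1) _ _ assms(2)] by (auto simp: tvec_of_def tangent_bundle_def charts_at_def)

text \<open>
  In the chart \<open>c\<close>, \<open>\<xi>\<close> has \<open>(0,1)\<close>-components \<open>\<xi>/2\<close>; raising the index gives half of \<open>g\<^sup>T \<xi>\<close>.
\<close>

lemma inv_flat_cotangent_point:
  assumes c: "c \<in> \<A>" and x: "x \<in> snd c ` fst c"
  defines "p \<equiv> inv_into (fst c) (snd c) x"
  shows "inv_into (tangent_bundle \<A>) (flat \<A> \<eta>) (cotangent_point \<A> c (x, \<xi>))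
     = tvec_of c p ((1/2) *\<^sub>R (transpose (gup c p) *v \<xi>))"
proof (rule inv_into_f_eq[OF flat_inj])
  have p: "p \<in> fst c" unfolding p_def using x by (rule inv_into_into)
  let ?v = "(1/2) *\<^sub>R (transpose (gup c p) *v \<xi>)"
  show "tvec_of c p ?v \<in> tangent_bundle \<A>" by (rule tvec_of_tangent[OF c p])
  have m: "metric \<eta> c p ?v w = \<xi> \<bullet> w" for w
    by (simp add: metric_eq[OF c p] scaleR_vec_scale cdot_scale inner_eq_cdot cdot_matrix[symmetric]
       matrix_vector_mul_assoc gup_facts(4)[OF c p])
  have "metric \<eta> c' p (jac c c' p ?v) w = \<xi> \<bullet> jac c' c p w" if "c' \<in> charts_at \<A> p" for c' w
  proof -
    have c': "c' \<in> \<A>" "p \<in> fst c'" using that by (auto simp: charts_at_def)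
    have "w = jac c c' p (jac c' c p w)"
      by (simp add: jac_comp[OF atlas c'(1) c c'(1) c'(2) p c'(2)] jac_id[OF atlas c'])
    thus ?thesis using metric_trans[OF c c'(1) p c'(2), of ?v "jac c' c p w"] m by simp
  qed
  hence "(if c' \<in> charts_at \<A> p then metric \<eta> c' p (if c' \<in> charts_at \<A> p then jac c c' p ?v else 0) else (\<lambda>_. 0))
      = (if c' \<in> charts_at \<A> p then (\<lambda>w. \<xi> \<bullet> jac c' c p w) else (\<lambda>_. 0))" for c'
    by (cases "c' \<in> charts_at \<A> p") (rule ext, simp_all)
  thus "flat \<A> \<eta> (tvec_of c p ?v) = cotangent_point \<A> c (x, \<xi>)"
    unfolding flat_def tvec_of_def cotangent_point_def Let_def prod.case p_def[symmetric] by presburger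
qed

text \<open>
  The functions of the theorem are evaluated in a chart that is chosen separately at each point; by
  \<open>I_fun_eq\<close> and \<open>L_fun_eq\<close> the choice does not matter, and near a given point a single chart can be used.
\<close>

lemma pullback_eq:
  assumes c: "c \<in> \<A>" and lp: "local_pencil (snd c ` fst c) (in_chart c (gup c)) (in_chart c (endo c)) G Lam"
    and x: "x \<in> snd c ` fst c"
  shows "(I_fun \<A> \<eta> \<theta> t \<circ> inv_into (tangent_bundle \<A>) (flat \<A> \<eta>)) (cotangent_point \<A> c (x, \<xi>))
      = local_pencil.Iloc (in_chart c (gup c)) (in_chart c (endo c)) t (x, \<xi>)"
    and "(L_fun \<A> \<eta> \<theta> t \<circ> inv_into (tangent_bundle \<A>) (flat \<A> \<eta>)) (cotangent_point \<A> c (x, \<xi>))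
      = local_pencil.Lloc (in_chart c (gup c)) (in_chart c (endo c)) Lam t (x, \<xi>)"
proof -
  interpret lp: local_pencil "snd c ` fst c" "in_chart c (gup c)" "in_chart c (endo c)" G Lam by fact
  define p where "p = inv_into (fst c) (snd c) x"
  have p: "p \<in> fst c" unfolding p_def using x by (rule inv_into_into)
  define v where "v = (1/2) *\<^sub>R (transpose (gup c p) *v \<xi>)"
  have cp: "c \<in> charts_at \<A> p" using c p by (simp add: charts_at_def)
  have tv: "tvec_of c p v = (p, snd (tvec_of c p v))" "snd (tvec_of c p v) c = v"
    using cp by (simp_all add: tvec_of_def jac_id[OF atlas c p])
  have tb: "(p, snd (tvec_of c p v)) \<in> tangent_bundle \<A>" using tvec_of_tangent[OF c p, of v] tv by simp
  note inv = inv_flat_cotangent_point[OF c x, of \<xi>, folded p_def, folded v_def]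
  have in_c: "in_chart c (gup c) x = gup c p" "in_chart c (endo c) x = endo c p"
    by (simp_all add: in_chart_def p_def)
  have loc: "in_chart c (gup c) x = gup c p" "in_chart c (endo c) x = endo c p" "lp.B x t = cofA t c p" "lp.h x = glow c p"
    by (simp_all only: in_c lp.B_def lp.At_def metric_low_def)
  have cv: "cconj v = (1/2) *\<^sub>R (gup c p *v cconj \<xi>)"
  proof -
    have "cconj (transpose (gup c p) *v \<xi>) = gup c p *v cconj \<xi>"
      using hadj_vector_cconj[of "gup c p" \<xi>] gup_facts(1)[OF c p] by simp
    thus ?thesis by (simp add: v_def linear_cmul[OF linear_cconj])
  qed
  have sc: "cdot u (r *\<^sub>R y) = of_real r * cdot u y" "cdot (r *\<^sub>R u) y = of_real r * cdot u y" for u y :: "complex^'n" and r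
    by (simp_all add: scaleR_vec_scale cdot_scale)
  have "I_fun \<A> \<eta> \<theta> t (tvec_of c p v) = 2 * Re (cdot v ((cofA t c p ** glow c p) *v cconj v))"
    using I_fun_eq[OF tb cp] tv by simp
  also have "\<dots> = lp.Iloc t (x, \<xi>)"
    unfolding cv lp.Iloc_def fst_conv snd_conv loc
    by (simp add: linear_cmul[OF matrix_vector_mul_linear] sc matrix_vector_mul_assoc[symmetric])
       (simp add: v_def sc cdot_matrix[symmetric] matrix_vector_mul_assoc gup_facts(5)[OF c p])
  finally show "(I_fun \<A> \<eta> \<theta> t \<circ> inv_into (tangent_bundle \<A>) (flat \<A> \<eta>)) (cotangent_point \<A> c (x, \<xi>)) = lp.Iloc t (x, \<xi>)"
    by (simp add: inv)
  have "L_fun \<A> \<eta> \<theta> t (tvec_of c p v) = - dird c (det_A \<eta> \<theta> t c) p (\<i> *s v)"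
    using L_fun_eq[OF tb cp] tv by simp
  also have "dird c (det_A \<eta> \<theta> t c) p (\<i> *s v) = - lp.Lloc t (x, \<xi>)"
  proof -
    have "snd c p = x" unfolding p_def using x by (rule f_inv_into_f)
    hence "dird c (det_A \<eta> \<theta> t c) p = (\<lambda>h. Re (trace (lp.B x t ** lp.dA x h)))"
      using has_derivative_unique[OF dird_det_A[OF c p, of t]] det_A_deriv[OF lp x] by simp
    hence "dird c (det_A \<eta> \<theta> t c) p (\<i> *s v) = - 2 * Re (cdot (\<i> *s v) (lp.B x t *v Lam x))"
      by (simp add: lp.trace_B_dA[OF x])
    also have "\<dots> = - lp.Lloc t (x, \<xi>)"
      unfolding lp.Lloc_def fst_conv snd_conv lp.b_def loc
      by (simp add: v_def sc cdot_scale cdot_matrix[symmetric])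
    finally show ?thesis .
  qed
  finally show "(L_fun \<A> \<eta> \<theta> t \<circ> inv_into (tangent_bundle \<A>) (flat \<A> \<eta>)) (cotangent_point \<A> c (x, \<xi>)) = lp.Lloc t (x, \<xi>)"
    by (simp add: inv)
qed

lemma poisson_bracket_chart:
  assumes X: "X \<in> tangent_bundle \<A>" and c: "c = chart_at \<A> (fst X)" and x: "x = snd c (fst X)"
    and F: "\<And>\<xi>. ((F \<circ> inv_into (tangent_bundle \<A>) (flat \<A> \<eta>) \<circ> cotangent_point \<A> c) has_derivative
         (\<lambda>z. f \<xi> (fst z) + snd z \<bullet> k \<xi>)) (at (x, \<xi>))"
    and G: "\<And>\<xi>. ((G \<circ> inv_into (tangent_bundle \<A>) (flat \<A> \<eta>) \<circ> cotangent_point \<A> c) has_derivative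
         (\<lambda>z. g \<xi> (fst z) + snd z \<bullet> l \<xi>)) (at (x, \<xi>))"
    and zero: "\<And>\<xi>. f \<xi> (l \<xi>) - g \<xi> (k \<xi>) = 0"
  shows "poisson_bracket \<A> \<eta> F G X = 0"
proof -
  obtain p v where pv: "X = (p, v)" by (cases X)
  have fx: "fst (flat \<A> \<eta> X) = p" by (simp add: flat_def pv)
  obtain \<xi> where z: "cotangent_coords c (flat \<A> \<eta> X) = (x, \<xi>)"
    using x fx by (auto simp: cotangent_coords_def flat_def pv)
  have c0: "chart_at \<A> (fst (flat \<A> \<eta> X)) = c" using c pv fx by simp
  note DF = frechet_derivative_at[OF F[of \<xi>], symmetric] and DG = frechet_derivative_at[OF G[of \<xi>], symmetric]
  have lin: "linear (f \<xi>)" "linear (g \<xi>)"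
  proof -
    have "linear (\<lambda>h::complex^'n. (h, 0::complex^'n))" by (auto intro!: linearI)
    note comp = linear_compose[OF this]
    show "linear (f \<xi>)" using comp[OF has_derivative_linear[OF F[of \<xi>]]] by (simp add: o_def)
    show "linear (g \<xi>)" using comp[OF has_derivative_linear[OF G[of \<xi>]]] by (simp add: o_def)
  qed
  have "poisson_bracket \<A> \<eta> F G X = (\<Sum>i\<in>Basis. f \<xi> i * (i \<bullet> l \<xi>) - (i \<bullet> k \<xi>) * g \<xi> i)"
    unfolding poisson_bracket_def canonical_bracket_def Let_def c0 z DF DG
    by (simp add: linear_0[OF lin(1)] linear_0[OF lin(2)])
  also have "\<dots> = f \<xi> (l \<xi>) - g \<xi> (k \<xi>)" by (rule sum_basis_bracket[OF lin])
  finally show ?thesis by (simp add: zero)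
qed

theorem integrals_commute:
  assumes F: "F \<in> range (I_fun \<A> \<eta> \<theta>) \<union> range (L_fun \<A> \<eta> \<theta>)"
    and G: "G \<in> range (I_fun \<A> \<eta> \<theta>) \<union> range (L_fun \<A> \<eta> \<theta>)"
    and X: "X \<in> tangent_bundle \<A>"
  shows "poisson_bracket \<A> \<eta> F G X = 0"
proof -
  define c where "c = chart_at \<A> (fst X)"
  define x where "x = snd c (fst X)"
  let ?S = "snd c ` fst c"
  have c: "c \<in> \<A>" "fst X \<in> fst c" using chart_at_in[of "fst X"] by (auto simp: charts_at_def c_def)
  hence x: "x \<in> ?S" by (simp add: x_def)
  obtain \<Gamma> Lam where lp: "local_pencil ?S (in_chart c (gup c)) (in_chart c (endo c)) \<Gamma> Lam"
    using local_pencil_in_chart[OF c(1)] by blast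
  then interpret lp: local_pencil ?S "in_chart c (gup c)" "in_chart c (endo c)" \<Gamma> Lam .
  let ?pull = "\<lambda>F. F \<circ> inv_into (tangent_bundle \<A>) (flat \<A> \<eta>) \<circ> cotangent_point \<A> c"
  have open': "open (?S \<times> (UNIV :: (complex^'n) set))" by (intro open_Times lp.open_S open_UNIV)
  have xin: "(x, \<xi>) \<in> ?S \<times> UNIV" for \<xi> :: "complex^'n" using x by simp
  have I: "(?pull (I_fun \<A> \<eta> \<theta> t) has_derivative (\<lambda>z. lp.DI t x \<xi> (fst z) + snd z \<bullet> lp.velI t x \<xi>)) (at (x, \<xi>))" for t \<xi>
    by (rule has_derivative_transform_within_open[OF lp.Iloc_deriv[OF x] open' xin])
      (use pullback_eq(1)[OF c(1) lp] in \<open>auto simp del: split_paired_All\<close>)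
  have L: "(?pull (L_fun \<A> \<eta> \<theta> t) has_derivative (\<lambda>z. lp.DL t x \<xi> (fst z) + snd z \<bullet> lp.velL t x)) (at (x, \<xi>))" for t \<xi>
    by (rule has_derivative_transform_within_open[OF lp.Lloc_deriv[OF x] open' xin])
      (use pullback_eq(2)[OF c(1) lp] in \<open>auto simp del: split_paired_All\<close>)
  note br = lp.brackets_vanish[OF x]
  have br3: "lp.DI s x \<xi> (lp.velL t x) - lp.DL t x \<xi> (lp.velI s x \<xi>) = 0" for s t \<xi>
    using br(3)[of t \<xi> s] by simp
  note pb = poisson_bracket_chart[OF X c_def x_def]
  from F G show ?thesis
    by (auto intro: pb[OF I I br(1)] pb[OF L L br(2)] pb[OF L I br(3)] pb[OF I L br3])
qed

end

theorem proposition5p14: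
  fixes \<A> :: "('m::{t2_space, second_countable_topology}, 'n::finite) chart set"
    and \<P> :: "('m, 'n) connection set"
    and \<eta> \<theta> :: "('m, 'n) herm_field"
  assumes "complex_atlas \<A>"
    and "2 * CARD('n) \<ge> 4"
    and "c_projective_structure \<A> \<P>"
    and "metrisability_pencil \<A> \<P> \<eta> \<theta>"
    and "nondegenerate \<A> \<eta>"
  shows "\<forall>F \<in> range (I_fun \<A> \<eta> \<theta>) \<union> range (L_fun \<A> \<eta> \<theta>).
         \<forall>G \<in> range (I_fun \<A> \<eta> \<theta>) \<union> range (L_fun \<A> \<eta> \<theta>).
         \<forall>X \<in> tangent_bundle \<A>. poisson_bracket \<A> \<eta> F G X = 0"
proof -
  interpret kaehler_pencil \<A> \<P> \<eta> \<theta>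
    by unfold_locales (use assms in auto)
  show ?thesis by (intro ballI integrals_commute)
qed

end
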